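(* Let $\mathfrak g$ be a simple Lie algebra and $\alpha\in\Pi$ a simple root. For the $(\mathbb Z,\alpha)$-grading of $\mathfrak g$, either $\mathfrak g_\alpha(1)$ is abelian (which happens if and only if $d_\alpha=1$), or $\dim\mathfrak a\le\frac12\dim\mathfrak g_\alpha(1)$ for any abelian subspace $\mathfrak a\subset\mathfrak g_\alpha(1)$.
   Context: The ground field $\Bbbk$ is algebraically closed of characteristic $0$. $\mathfrak g$ is a simple Lie algebra with Cartan subalgebra $\mathfrak t$, root system $\Delta$, positive roots $\Delta^+$, simple roots $\Pi$, highest root $\theta$. For $\gamma=\sum_{\beta\in\Pi}n_\beta\beta\in\Delta$ put $\mathsf{ht}_\alpha(\gamma)=n_\alpha$; $\Delta_\alpha(i)=\{\gamma\in\Delta\mid \mathsf{ht}_\alpha(\gamma)=i\}$; $d_\alpha=\mathsf{ht}_\alpha(\theta)$. The $(\mathbb Z,\alpha)$-grading is $\mathfrak g=\bigoplus_{i=-d_\alpha}^{d_\alpha}\mathfrak g_\alpha(i)$ with $\mathfrak g_\alpha(0)=\mathfrak t\oplus\bigoplus_{\gamma\in\Delta_\alpha(0)}\mathfrak g^\gamma$ and $\mathfrak g_\alpha(i)=\bigoplus_{\gamma\in\Delta_\alpha(i)}\mathfrak g^\gamma$ for $i\ne0$, where $\mathfrak g^\gamma$ is the root space. An abelian subspace is a linear subspace $\mathfrak a\subset\mathfrak g_\alpha(1)$ with $[\mathfrak a,\mathfrak a]=0$. *)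

theory Defs
  imports
    "HOL-Computational_Algebra.Polynomial"
    "HOL-Library.Function_Algebras"
begin

definition fscale :: "'k::field \<Rightarrow> ('g \<Rightarrow> 'k) \<Rightarrow> 'g \<Rightarrow> 'k"
  where "fscale c f = (\<lambda>x. c * f x)"

global_interpretation functional: vector_space "fscale :: 'k::field \<Rightarrow> ('g \<Rightarrow> 'k) \<Rightarrow> 'g \<Rightarrow> 'k"
  by unfold_locales (simp_all add: fscale_def fun_eq_iff algebra_simps)

definition int_comb :: "('g \<Rightarrow> 'k::field) set \<Rightarrow> (('g \<Rightarrow> 'k) \<Rightarrow> int) \<Rightarrow> 'g \<Rightarrow> 'k"
  where "int_comb B n = (\<Sum>\<beta>\<in>B. fscale (of_int (n \<beta>)) \<beta>)"

text \<open>
  The coefficient of \<open>\<gamma>\<close> at \<open>\<alpha>\<close>; for linearly independent \<open>B\<close> and in characteristic 0 it is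
  determined by \<open>\<gamma>\<close>, as \<open>ht_int_comb\<close> shows.
\<close>
definition ht :: "('g \<Rightarrow> 'k::field) set \<Rightarrow> ('g \<Rightarrow> 'k) \<Rightarrow> ('g \<Rightarrow> 'k) \<Rightarrow> int"
  where "ht B \<alpha> \<gamma> = (THE m. \<exists>n. \<gamma> = int_comb B n \<and> n \<alpha> = m)"

lemma ht_int_comb:
  fixes B :: "('g \<Rightarrow> 'k::field_char_0) set"
  assumes "finite B" "functional.independent B" "\<alpha> \<in> B"
  shows "ht B \<alpha> (int_comb B n) = n \<alpha>"
proof -
  have unique: "m \<alpha> = n \<alpha>" if eq: "int_comb B n = int_comb B m" for m
  proof -
    have "(\<Sum>\<beta>\<in>B. fscale (of_int (n \<beta>) - of_int (m \<beta>)) \<beta>) = int_comb B n - int_comb B m"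
      unfolding int_comb_def functional.scale_left_diff_distrib sum_subtractf ..
    then have "(\<Sum>\<beta>\<in>B. fscale (of_int (n \<beta>) - of_int (m \<beta>)) \<beta>) = 0"
      unfolding eq diff_self .
    from functional.independentD[OF assms(2,1) subset_refl this assms(3)]
    have "(of_int (n \<alpha>) :: 'k) = of_int (m \<alpha>)"
      by (rule eq_iff_diff_eq_0[THEN iffD2])
    then show ?thesis
      by (rule of_int_eq_iff[THEN iffD1, symmetric])
  qed
  show ?thesis
    unfolding ht_def
  proof (rule the_equality)
    show "\<exists>n'. int_comb B n = int_comb B n' \<and> n' \<alpha> = n \<alpha>" by (rule exI[of _ n]) (rule conjI[OF refl refl])
  next
    fix k assume "\<exists>n'. int_comb B n = int_comb B n' \<and> n' \<alpha> = k"
    then obtain n' where "int_comb B n = int_comb B n'" "n' \<alpha> = k" by (elim exE conjE)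
    with unique[of n'] show "k = n \<alpha>" by (simp only:)
  qed
qed

locale lie_algebra = vector_space scale
  for scale :: "'k::field \<Rightarrow> 'g::ab_group_add \<Rightarrow> 'g" (infixr \<open>*s\<close> 75) +
  fixes bracket :: "'g \<Rightarrow> 'g \<Rightarrow> 'g"
  assumes bracket_add_left: "bracket (x + y) z = bracket x z + bracket y z"
    and bracket_add_right: "bracket x (y + z) = bracket x y + bracket x z"
    and bracket_scale_left: "bracket (c *s x) y = c *s bracket x y"
    and bracket_scale_right: "bracket x (c *s y) = c *s bracket x y"
    and bracket_self: "bracket x x = 0"
    and jacobi: "bracket x (bracket y z) + bracket y (bracket z x) + bracket z (bracket x y) = 0"
begin

definition abelian :: "'g set \<Rightarrow> bool"
  where "abelian S \<longleftrightarrow> (\<forall>x\<in>S. \<forall>y\<in>S. bracket x y = 0)"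

definition lie_subalgebra :: "'g set \<Rightarrow> bool"
  where "lie_subalgebra S \<longleftrightarrow> subspace S \<and> (\<forall>x\<in>S. \<forall>y\<in>S. bracket x y \<in> S)"

definition lie_ideal :: "'g set \<Rightarrow> bool"
  where "lie_ideal I \<longleftrightarrow> subspace I \<and> (\<forall>x. \<forall>y\<in>I. bracket x y \<in> I)"

primrec lower_central :: "'g set \<Rightarrow> nat \<Rightarrow> 'g set"
  where
    "lower_central S 0 = S"
  | "lower_central S (Suc n) = span {bracket x y |x y. x \<in> S \<and> y \<in> lower_central S n}"

definition nilpotent :: "'g set \<Rightarrow> bool"
  where "nilpotent S \<longleftrightarrow> (\<exists>n. lower_central S n = {0})"

definition normalizer :: "'g set \<Rightarrow> 'g set"
  where "normalizer S = {x. \<forall>y\<in>S. bracket x y \<in> S}"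

definition cartan_subalgebra :: "'g set \<Rightarrow> bool"
  where "cartan_subalgebra T \<longleftrightarrow> lie_subalgebra T \<and> nilpotent T \<and> normalizer T = T"

text \<open>
  The dual space of a subspace \<open>T\<close>. A functional on \<open>T\<close> is represented by its extension by zero
  to the whole type, so that distinct members of \<open>dual T\<close> differ on \<open>T\<close>.
\<close>
definition dual :: "'g set \<Rightarrow> ('g \<Rightarrow> 'k) set"
  where "dual T = {f. (\<forall>x\<in>T. \<forall>y\<in>T. f (x + y) = f x + f y) \<and>
                      (\<forall>c. \<forall>x\<in>T. f (c *s x) = c * f x) \<and>
                      (\<forall>x. x \<notin> T \<longrightarrow> f x = 0)}"

definition root_space :: "'g set \<Rightarrow> ('g \<Rightarrow> 'k) \<Rightarrow> 'g set"
  where "root_space T \<gamma> = {x. \<forall>h\<in>T. bracket h x = \<gamma> h *s x}"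

definition roots :: "'g set \<Rightarrow> ('g \<Rightarrow> 'k) set"
  where "roots T = {\<gamma> \<in> dual T. \<gamma> \<noteq> 0 \<and> root_space T \<gamma> \<noteq> {0}}"

text \<open>
  A set of simple roots is a base of the root system: a basis of the dual of the Cartan subalgebra
  \<open>T\<close> consisting of roots, in which each root has integer coordinates that are all nonnegative
  (the positive roots) or all nonpositive.
\<close>
definition simple_roots :: "'g set \<Rightarrow> ('g \<Rightarrow> 'k) set \<Rightarrow> bool"
  where "simple_roots T B \<longleftrightarrow>
    finite B \<and> B \<subseteq> roots T \<and> functional.independent B \<and> functional.span B = dual T \<and>
    (\<forall>\<gamma>\<in>roots T. \<exists>n. \<gamma> = int_comb B n \<and> ((\<forall>\<beta>\<in>B. 0 \<le> n \<beta>) \<or> (\<forall>\<beta>\<in>B. n \<beta> \<le> 0)))"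

text \<open>
  The largest root for the root order, in which \<open>\<gamma> \<le> \<theta>\<close> if \<open>\<theta> - \<gamma>\<close> is a nonnegative integral
  combination of simple roots.
\<close>
definition highest_root :: "'g set \<Rightarrow> ('g \<Rightarrow> 'k) set \<Rightarrow> 'g \<Rightarrow> 'k"
  where "highest_root T B = (THE \<theta>. \<theta> \<in> roots T \<and>
    (\<forall>\<gamma>\<in>roots T. \<exists>n. \<theta> - \<gamma> = int_comb B n \<and> (\<forall>\<beta>\<in>B. 0 \<le> n \<beta>)))"

definition grading_depth :: "'g set \<Rightarrow> ('g \<Rightarrow> 'k) set \<Rightarrow> ('g \<Rightarrow> 'k) \<Rightarrow> int"
  where "grading_depth T B \<alpha> = ht B \<alpha> (highest_root T B)"

definition roots_of_ht :: "'g set \<Rightarrow> ('g \<Rightarrow> 'k) set \<Rightarrow> ('g \<Rightarrow> 'k) \<Rightarrow> int \<Rightarrow> ('g \<Rightarrow> 'k) set"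
  where "roots_of_ht T B \<alpha> i = {\<gamma> \<in> roots T. ht B \<alpha> \<gamma> = i}"

definition graded_piece :: "'g set \<Rightarrow> ('g \<Rightarrow> 'k) set \<Rightarrow> ('g \<Rightarrow> 'k) \<Rightarrow> int \<Rightarrow> 'g set"
  where "graded_piece T B \<alpha> i =
    span ((if i = 0 then T else {}) \<union> (\<Union>\<gamma>\<in>roots_of_ht T B \<alpha> i. root_space T \<gamma>))"

end

locale simple_lie_algebra = lie_algebra +
  assumes finite_dimensional: "\<exists>B. finite B \<and> span B = UNIV"
    and not_abelian: "\<not> abelian UNIV"
    and lie_ideal_trivial: "lie_ideal I \<Longrightarrow> I = {0} \<or> I = UNIV"

end

theory Submission
  imports Defs
begin

text \<open>
  The proof has a structural and a combinatorial half.

  \<^bold>\<open>From the Lie algebra to its roots.\<close> All roots and gradings are taken with respect to a Cartan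
  subalgebra \<open>T\<close> that is only assumed to be nilpotent and self-normalizing, so the classical
  structure theory comes first. The space decomposes into generalized weight spaces of \<open>T\<close>
  (\<open>W_decomposition\<close>). On a commutator of opposite weight vectors all weights are rational multiples
  of one of them, since traces over root strings vanish (\<open>weight_rational_multiple\<close>); the Killing
  form of such a commutator with itself is therefore a square times a positive rational, which
  forces the form to be nondegenerate (\<open>kappa_nondegenerate\<close>). Nondegeneracy makes \<open>T\<close> act
  diagonalizably (\<open>gws_eigen\<close>), and representations of \<open>sl\<^sub>2\<close> give one-dimensional root spaces,
  integral reflections, and a nonzero product of two root spaces whenever the roots sum to a root
  (\<open>root_space_line\<close>, \<open>root_reflection\<close>, \<open>root_bracket_nonzero\<close>).

  \<^bold>\<open>From abelian subspaces to sets of roots.\<close> Choose an additive, injective, integer-valued function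
  on the roots and pass from each vector of an abelian subspace of the first graded piece to its
  leading term. At least as many roots occur as leading roots as the dimension indicates, and no
  two of them sum to a root (\<open>leading_roots\<close>).

  \<^bold>\<open>Combinatorics.\<close> Let the height of a root be its coefficient at
  \<open>\<alpha>\<close>. It remains to see that a set of roots of height one of which no two sum to
  a root contains at most half of the roots of height one, once there is a root of height two
  (\<open>independent_set_le_half\<close>). Join two roots of height one by an edge if they have the
  same norm and their sum is a root. Roots of height one of equal norm are conjugate under the
  reflections in the simple roots other than \<open>\<alpha>\<close>
  (\<open>invariant_constant_on_norm_class\<close>), so the graph is regular on each norm class.
  Every degree is positive (\<open>valency_pos\<close>): there is a root \<open>\<mu>\<close> of
  height two at least as long as \<open>\<alpha>\<close>; the inner product with the average of a
  norm class is a positive multiple of the height, so some \<open>\<gamma>\<close> in the class has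
  positive inner product with \<open>\<mu>\<close>; then \<open>\<mu> - \<gamma>\<close> is minus the
  reflection of \<open>\<gamma>\<close> in \<open>\<mu>\<close>, has height one and the norm of
  \<open>\<gamma>\<close>. In a regular graph of positive degree an independent set contains at most
  half of the vertices.

  The first piece is abelian exactly if no root has height two, and the same averaging argument,
  applied to the highest root, shows that this happens exactly if the highest root has height one.
\<close>

section \<open>Linear endomorphisms\<close>

locale lin_space = vector_space scale
  for scale :: "'k::field \<Rightarrow> 'g::ab_group_add \<Rightarrow> 'g"
begin

abbreviation endo :: "('g \<Rightarrow> 'g) \<Rightarrow> bool"
  where "endo f \<equiv> Vector_Spaces.linear scale scale f"

lemma endoI:
  assumes "\<And>x y. f (x + y) = f x + f y" "\<And>c x. f (scale c x) = scale c (f x)"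
  shows "endo f"
  unfolding Vector_Spaces.linear_iff using assms vector_space_axioms by blast

lemma endo_add: "endo f \<Longrightarrow> f (x + y) = f x + f y"
  by (simp add: Vector_Spaces.linear_iff)

lemma endo_scale: "endo f \<Longrightarrow> f (scale c x) = scale c (f x)"
  by (simp add: Vector_Spaces.linear_iff)

lemma endo_zero: "endo f \<Longrightarrow> f 0 = 0"
  using endo_scale[of f 0 0] by simp

lemma endo_neg: "endo f \<Longrightarrow> f (- x) = - f x"
  using endo_scale[of f "- 1" x] by simp

lemma endo_diff: "endo f \<Longrightarrow> f (x - y) = f x - f y"
  using endo_add[of f x "- y"] endo_neg[of f y] by simp

lemma endo_sum: "endo f \<Longrightarrow> f (\<Sum>i\<in>A. g i) = (\<Sum>i\<in>A. f (g i))"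
  by (induction A rule: infinite_finite_induct) (simp_all add: endo_zero endo_add)

lemma endo_comp: "endo f \<Longrightarrow> endo g \<Longrightarrow> endo (\<lambda>x. f (g x))"
  by (intro endoI) (simp_all add: endo_add endo_scale)

lemma endo_funpow: "endo f \<Longrightarrow> endo (f ^^ n)"
  by (induction n) (auto intro!: endoI simp: endo_add endo_scale)

lemma endo_kernel_subspace: "endo f \<Longrightarrow> subspace {x. f x = 0}"
  by (intro subspaceI) (simp_all add: endo_zero endo_add endo_scale)

lemma endo_vimage_subspace: "endo f \<Longrightarrow> subspace W \<Longrightarrow> subspace {x. f x \<in> W}"
  by (intro subspaceI) (simp_all add: endo_zero endo_add endo_scale subspace_0 subspace_add subspace_scale)

lemma endo_image_subspace:
  assumes f: "endo f" and V: "subspace V"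
  shows "subspace (f ` V)"
proof (rule subspaceI)
  show "0 \<in> f ` V"
    using endo_zero[OF f] subspace_0[OF V] image_eqI[of 0 f 0 V] by simp
  show "x + y \<in> f ` V" if xy: "x \<in> f ` V" "y \<in> f ` V" for x y
  proof -
    from xy obtain a b where "a \<in> V" "x = f a" "b \<in> V" "y = f b" by blast
    then show ?thesis using image_eqI[of "x + y" f "a + b" V] subspace_add[OF V] by (simp add: endo_add[OF f])
  qed
  show "scale c x \<in> f ` V" if x: "x \<in> f ` V" for c x
  proof -
    from x obtain a where "a \<in> V" "x = f a" by blast
    then show ?thesis using image_eqI[of "scale c x" f "scale c a" V] subspace_scale[OF V] by (simp add: endo_scale[OF f])
  qed
qed

lemma funpow_kills_later: "endo f \<Longrightarrow> (f ^^ m) x = 0 \<Longrightarrow> m \<le> n \<Longrightarrow> (f ^^ n) x = 0"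
  using endo_zero[OF endo_funpow, of f "n - m"] funpow_add[of "n - m" m f] by simp

lemma locally_nilpotent_subspace:
  assumes f: "endo f"
  shows "subspace {x. \<exists>n. (f ^^ n) x = 0}"
proof (rule subspaceI)
  show "0 \<in> {x. \<exists>n. (f ^^ n) x = 0}" by (auto intro: exI[of _ 0])
next
  fix x y assume "x \<in> {x. \<exists>n. (f ^^ n) x = 0}" "y \<in> {x. \<exists>n. (f ^^ n) x = 0}"
  then obtain m n where "(f ^^ m) x = 0" "(f ^^ n) y = 0" by blast
  then have "(f ^^ (m + n)) (x + y) = 0"
    by (simp add: endo_add[OF endo_funpow[OF f]] funpow_kills_later[OF f, of m _ "m + n"]
        funpow_kills_later[OF f, of n _ "m + n"])
  then show "x + y \<in> {x. \<exists>n. (f ^^ n) x = 0}" by blast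
next
  fix c x assume "x \<in> {x. \<exists>n. (f ^^ n) x = 0}"
  then obtain n where "(f ^^ n) x = 0" by blast
  then have "(f ^^ n) (scale c x) = 0"
    by (subst endo_scale[OF endo_funpow[OF f]]) simp
  then show "scale c x \<in> {x. \<exists>n. (f ^^ n) x = 0}" by blast
qed

lemma funpow_comm:
  assumes "\<And>x. f (g x) = g (f x)"
  shows "(f ^^ n) (g x) = g ((f ^^ n) x)"
  by (induction n) (simp_all add: assms)

lemma endo_span_subset:
  assumes f: "endo f" and "\<And>x. x \<in> S \<Longrightarrow> f x \<in> W" and W: "subspace W" and x: "x \<in> span S"
  shows "f x \<in> W"
proof -
  have "span S \<subseteq> {x. f x \<in> W}"
    using assms by (intro span_minimal endo_vimage_subspace) auto
  with x show ?thesis by auto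
qed

lemma span_UN_eq_sum:
  assumes fin: "finite I" and sub: "\<And>i. i \<in> I \<Longrightarrow> subspace (G i)" and x: "x \<in> span (\<Union>i\<in>I. G i)"
  shows "\<exists>y. (\<forall>i\<in>I. y i \<in> G i) \<and> x = (\<Sum>i\<in>I. y i)"
proof -
  let ?S = "{x. \<exists>y. (\<forall>i\<in>I. y i \<in> G i) \<and> x = (\<Sum>i\<in>I. y i)}"
  have "subspace ?S"
  proof (rule subspaceI)
    show "0 \<in> ?S" using sub by (auto intro!: exI[of _ "\<lambda>_. 0"] simp: subspace_0)
  next
    fix x y assume "x \<in> ?S" "y \<in> ?S"
    then obtain a b where "\<forall>i\<in>I. a i \<in> G i" "x = sum a I" "\<forall>i\<in>I. b i \<in> G i" "y = sum b I" by blast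
    then show "x + y \<in> ?S"
      using sub by (auto intro!: exI[of _ "\<lambda>i. a i + b i"] simp: subspace_add sum.distrib)
  next
    fix c x assume "x \<in> ?S"
    then obtain a where "\<forall>i\<in>I. a i \<in> G i" "x = sum a I" by blast
    then show "scale c x \<in> ?S"
      using sub by (auto intro!: exI[of _ "\<lambda>i. scale c (a i)"] simp: subspace_scale scale_sum_right)
  qed
  moreover have "(\<Union>i\<in>I. G i) \<subseteq> ?S"
  proof clarify
    fix i z assume i: "i \<in> I" "z \<in> G i"
    then show "\<exists>y. (\<forall>i\<in>I. y i \<in> G i) \<and> z = sum y I"
      using sub fin by (intro exI[of _ "\<lambda>j. if j = i then z else 0"]) (auto simp: subspace_0 sum.delta')
  qed
  ultimately have "span (\<Union>i\<in>I. G i) \<subseteq> ?S" by (rule span_minimal[rotated])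
  with x show ?thesis by auto
qed

subsection \<open>Traces\<close>

text \<open>
  The trace of the compression of \<open>f\<close> to the span of \<open>C\<close>, for \<open>f\<close> mapping the span into itself.
  Bases of subspaces are needed besides a basis of the whole space because the proofs below pass to
  ranges.
\<close>
definition trace_on :: "'g set \<Rightarrow> ('g \<Rightarrow> 'g) \<Rightarrow> 'k"
  where "trace_on C f = (\<Sum>c\<in>C. representation C (f c) c)"

lemma trace_on_cong: "(\<And>x. x \<in> C \<Longrightarrow> f x = g x) \<Longrightarrow> trace_on C f = trace_on C g"
  by (simp add: trace_on_def)

text \<open>
  With \<open>f\<close> and \<open>g\<close> written as rectangular matrices over the two bases, both sides are the same
  double sum. Taking \<open>D\<close> to be a basis of the range of an endomorphism reduces traces to smaller
  spaces, which is how nilpotent maps and projections are handled below.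
\<close>
lemma trace_on_comm:
  assumes C: "independent C" "finite C" and D: "independent D" "finite D"
    and f: "endo f" "\<And>c. c \<in> C \<Longrightarrow> f c \<in> span D" and g: "endo g" "\<And>d. d \<in> D \<Longrightarrow> g d \<in> span C"
  shows "trace_on C (\<lambda>x. g (f x)) = trace_on D (\<lambda>x. f (g x))"
proof -
  have expand: "representation X (h (k x)) x = (\<Sum>y\<in>Y. representation Y (k x) y * representation X (h y) x)"
    if "independent X" "finite X" "independent Y" "finite Y" "endo h" "\<And>y. y \<in> Y \<Longrightarrow> h y \<in> span X"
      "k x \<in> span Y" for X Y h k x
  proof -
    have "h (k x) = h (\<Sum>y\<in>Y. scale (representation Y (k x) y) y)"
      using sum_representation_eq[OF that(3,7,4) subset_refl] by simp
    also have "\<dots> = (\<Sum>y\<in>Y. scale (representation Y (k x) y) (h y))"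
      by (simp add: endo_sum[OF that(5)] endo_scale[OF that(5)])
    finally have "representation X (h (k x)) = (\<lambda>b. \<Sum>y\<in>Y. representation X (scale (representation Y (k x) y) (h y)) b)"
      using representation_sum[OF that(1), of Y "\<lambda>y. scale (representation Y (k x) y) (h y)"]
      by (simp add: that(6) span_scale)
    then show ?thesis
      by (simp add: representation_scale[OF that(1) that(6)])
  qed
  have "trace_on C (\<lambda>x. g (f x)) = (\<Sum>c\<in>C. \<Sum>d\<in>D. representation D (f c) d * representation C (g d) c)"
    unfolding trace_on_def by (intro sum.cong refl expand) (use assms in auto)
  also have "\<dots> = (\<Sum>d\<in>D. \<Sum>c\<in>C. representation C (g d) c * representation D (f c) d)"
    by (subst sum.swap) (simp add: mult.commute)
  also have "\<dots> = trace_on D (\<lambda>x. f (g x))"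
    unfolding trace_on_def by (intro sum.cong refl expand[symmetric]) (use assms in auto)
  finally show ?thesis .
qed

lemma trace_on_ident:
  assumes "independent C"
  shows "trace_on C (\<lambda>x. x) = of_nat (card C)"
  by (simp add: trace_on_def representation_basis[OF assms])

end

locale fin_space = lin_space scale + finite_dimensional_vector_space scale Basis
  for scale :: "'k::field \<Rightarrow> 'g::ab_group_add \<Rightarrow> 'g" and Basis :: "'g set"
begin

lemma surjective_on_imp_kernel_trivial:
  assumes f: "endo f" and V: "subspace V" and surj: "V \<subseteq> f ` V" and x: "x \<in> V" "f x = 0"
  shows "x = 0"
proof -
  obtain C where C: "C \<subseteq> V" "independent C" "V \<subseteq> span C" "card C = dim V" using basis_exists by blast
  have finC: "finite C" using C finiteI_independent by blast
  interpret f: Vector_Spaces.linear scale scale f by (rule f)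
  have sp: "span C = V" using C V by (simp add: span_subspace)
  have spf: "span (f ` C) = f ` V" using f.span_image[of C] sp by simp
  have card: "card (f ` C) = card C"
  proof (rule antisym[OF card_image_le[OF finC]])
    have "dim V \<le> card (f ` C)"
      using surj spf finC by (intro dim_le_card) auto
    with C show "card C \<le> card (f ` C)" by simp
  qed
  then have inj: "inj_on f C" using finC eq_card_imp_inj_on by blast
  have "independent (f ` C)"
  proof (rule card_le_dim_spanning[of _ "f ` V"])
    show "f ` C \<subseteq> f ` V" using C by auto
    show "f ` V \<subseteq> span (f ` C)" using spf by simp
    show "card (f ` C) \<le> dim (f ` V)" using card C dim_subset[OF surj] by simp
  qed (use finC in simp)
  then have "inj_on f (span C)" using inj f.inj_on_span_iff_independent_image by blast
  then show ?thesis using x sp endo_zero[OF f] subspace_0[OF V] by (metis inj_onD)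
qed

text \<open>
  The trace does not change on restriction to the range, whose dimension is smaller unless the space
  is zero.
\<close>
lemma trace_on_nilpotent:
  assumes f: "endo f"
  shows "independent C \<Longrightarrow> (\<And>x. x \<in> span C \<Longrightarrow> f x \<in> span C) \<Longrightarrow> (\<And>x. x \<in> span C \<Longrightarrow> \<exists>n. (f ^^ n) x = 0)
    \<Longrightarrow> trace_on C f = 0"
proof (induction "card C" arbitrary: C rule: less_induct)
  case less
  have finC: "finite C" using less finiteI_independent by blast
  let ?V = "span C"
  show ?case
  proof (cases "f ` ?V = ?V")
    case True
    have zero: "x = 0" if x: "x \<in> ?V" for x
    proof -
      have "(f ^^ n) x = 0 \<Longrightarrow> x = 0" if "x \<in> ?V" for n x
        using that
      proof (induction n arbitrary: x)
        case (Suc n)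
        have "f x = 0" using Suc.IH[of "f x"] Suc.prems less.prems(2) by (simp add: funpow_swap1)
        then show ?case using surjective_on_imp_kernel_trivial[OF f _ _ Suc.prems(2)] True by auto
      qed simp
      then show ?thesis using less.prems(3) x by blast
    qed
    then have "C \<subseteq> {0}" using span_superset by blast
    moreover have "0 \<notin> C" using less.prems(1) dependent_zero by blast
    ultimately have "C = {}" by blast
    then show ?thesis by (simp add: trace_on_def)
  next
    case False
    then have ps: "f ` ?V \<subset> ?V" using less.prems(2) by auto
    have sub: "subspace (f ` ?V)" by (rule endo_image_subspace[OF f subspace_span])
    obtain D where D: "D \<subseteq> f ` ?V" "independent D" "f ` ?V \<subseteq> span D" "card D = dim (f ` ?V)"
      using basis_exists by blast
    have spD: "span D = f ` ?V" using D sub by (simp add: span_subspace)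
    have "card D < card C"
      using ps D dim_psubset[of "f ` ?V" C] sub dim_eq_card_independent[OF less.prems(1)]
      by (metis span_eq_iff)
    moreover have "trace_on C f = trace_on D f"
    proof (rule trace_on_comm[of C D f "\<lambda>x. x"])
      show "endo (\<lambda>x. x)" by (rule endoI) auto
      show "finite D" using D finiteI_independent by blast
      show "f c \<in> span D" if "c \<in> C" for c using that spD span_base by (metis imageI)
      show "d \<in> span C" if "d \<in> D" for d using that D ps by blast
    qed (use less.prems D f finC in auto)
    moreover have "trace_on D f = 0"
      by (rule less.hyps) (use calculation D spD ps less.prems in auto)
    ultimately show ?thesis by simp
  qed
qed

definition trace :: "('g \<Rightarrow> 'g) \<Rightarrow> 'k"
  where "trace = trace_on Basis"

lemma in_span_Basis: "x \<in> span Basis"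
  by (simp add: span_Basis)

lemma trace_add: "endo f \<Longrightarrow> endo g \<Longrightarrow> trace (\<lambda>x. f x + g x) = trace f + trace g"
  by (simp add: trace_def trace_on_def representation_add[OF independent_Basis] in_span_Basis sum.distrib)

lemma trace_scale: "trace (\<lambda>x. scale c (f x)) = c * trace f"
  by (simp add: trace_def trace_on_def representation_scale[OF independent_Basis] in_span_Basis sum_distrib_left)

lemma trace_sum: "trace (\<lambda>x. \<Sum>i\<in>I. f i x) = (\<Sum>i\<in>I. trace (f i))"
  by (simp add: trace_def trace_on_def representation_sum[OF independent_Basis] in_span_Basis)
    (rule sum.swap)

lemma trace_diff: "trace (\<lambda>x. f x - g x) = trace f - trace g"
  by (simp add: trace_def trace_on_def representation_diff[OF independent_Basis] in_span_Basis sum_subtractf)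

lemma trace_comm: "endo f \<Longrightarrow> endo g \<Longrightarrow> trace (\<lambda>x. f (g x)) = trace (\<lambda>x. g (f x))"
  unfolding trace_def
  by (rule trace_on_comm) (auto simp: independent_Basis finite_Basis in_span_Basis)

lemma trace_nilpotent: "endo f \<Longrightarrow> (\<And>x. \<exists>n. (f ^^ n) x = 0) \<Longrightarrow> trace f = 0"
  unfolding trace_def
  by (rule trace_on_nilpotent) (auto simp: independent_Basis in_span_Basis)

text \<open>
  Restricted to its range a projection is the identity.
\<close>
lemma trace_projection:
  assumes f: "endo f" and idem: "\<And>x. f (f x) = f x"
  shows "trace f = of_nat (dim (range f))"
proof -
  have sub: "subspace (range f)" by (rule endo_image_subspace[OF f subspace_UNIV])
  obtain D where D: "D \<subseteq> range f" "independent D" "range f \<subseteq> span D" "card D = dim (range f)"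
    using basis_exists by blast
  have spD: "span D = range f" using D sub by (simp add: span_subspace)
  have "trace f = trace_on D f"
    unfolding trace_def
  proof (rule trace_on_comm[of Basis D f "\<lambda>x. x"])
    show "endo (\<lambda>x. x)" by (rule endoI) auto
  qed (use D f finiteI_independent spD independent_Basis finite_Basis in_span_Basis in auto)
  also have "\<dots> = trace_on D (\<lambda>x. x)"
    by (rule trace_on_cong) (use D idem in auto)
  finally show ?thesis using D by (simp add: trace_on_ident)
qed

end

subsection \<open>Eigenvectors\<close>

context lin_space
begin

text \<open>
  Horner scheme for the action of \<open>p(f)\<close> on \<open>v\<close>.
\<close>
definition poly_act :: "('g \<Rightarrow> 'g) \<Rightarrow> 'k poly \<Rightarrow> 'g \<Rightarrow> 'g"
  where "poly_act f p v = fold_coeffs (\<lambda>a u. scale a v + f u) p 0"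

lemma poly_act_0: "poly_act f 0 v = 0"
  by (simp add: poly_act_def)

lemma poly_act_pCons: "endo f \<Longrightarrow> poly_act f (pCons a p) v = scale a v + f (poly_act f p v)"
  by (cases "a = 0 \<and> p = 0") (auto simp: poly_act_def endo_zero fold_coeffs_def cCons_def)

lemma poly_act_add: "endo f \<Longrightarrow> poly_act f (p + q) v = poly_act f p v + poly_act f q v"
  by (induction p q rule: poly_induct2)
    (simp_all add: poly_act_0 poly_act_pCons endo_add scale_left_distrib algebra_simps)

lemma poly_act_smult: "endo f \<Longrightarrow> poly_act f (smult c p) v = scale c (poly_act f p v)"
  by (induction p) (simp_all add: poly_act_0 poly_act_pCons endo_scale scale_right_distrib)

lemma poly_act_monom: "endo f \<Longrightarrow> poly_act f (monom 1 n) v = (f ^^ n) v"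
  by (induction n) (simp_all add: monom_0 monom_Suc poly_act_0 poly_act_pCons endo_zero)

lemma poly_act_closed:
  "endo f \<Longrightarrow> subspace V \<Longrightarrow> f ` V \<subseteq> V \<Longrightarrow> v \<in> V \<Longrightarrow> poly_act f p v \<in> V"
  by (induction p) (auto simp: poly_act_0 poly_act_pCons subspace_0 intro!: subspace_add subspace_scale)

end

context fin_space
begin

text \<open>
  The first iterate that depends linearly on its predecessors gives a monic polynomial.
\<close>
lemma annihilating_poly_exists:
  assumes f: "endo f"
  shows "\<exists>p. p \<noteq> 0 \<and> poly_act f p v = 0"
proof -
  let ?S = "\<lambda>k. (\<lambda>i. (f ^^ i) v) ` {..<k}"
  have "\<exists>k. (f ^^ k) v \<in> span (?S k)"
  proof (rule ccontr)
    assume *: "\<nexists>k. (f ^^ k) v \<in> span (?S k)"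
    have "independent (?S k) \<and> card (?S k) = k" for k
    proof (induction k)
      case (Suc k)
      have "?S (Suc k) = insert ((f ^^ k) v) (?S k)" by (simp only: lessThan_Suc image_insert)
      moreover have "(f ^^ k) v \<notin> ?S k"
        using * span_base[of "(f ^^ k) v" "?S k"] by auto
      moreover have "independent (insert ((f ^^ k) v) (?S k))"
        using * Suc by (intro independent_insertI) auto
      ultimately show ?case using Suc
        by (metis card_insert_disjoint finite_imageI finite_lessThan)
    qed (simp add: independent_empty)
    then have "Suc (card Basis) \<le> card Basis"
      using independent_card_le_dim[of "?S (Suc (card Basis))" UNIV] by (metis dim_UNIV subset_UNIV)
    then show False by simp
  qed
  then obtain k where k: "(f ^^ k) v \<in> span (?S k)" by blast
  let ?W = "{poly_act f q v | q. \<forall>i\<ge>k. coeff q i = 0}"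
  have "subspace ?W"
  proof (rule subspaceI)
    show "0 \<in> ?W" by (auto intro!: exI[of _ 0] simp: poly_act_0)
    show "x + y \<in> ?W" if xy: "x \<in> ?W" "y \<in> ?W" for x y
    proof -
      from xy obtain p q where "x = poly_act f p v" "y = poly_act f q v"
        "\<forall>i\<ge>k. coeff p i = 0" "\<forall>i\<ge>k. coeff q i = 0" by blast
      then show ?thesis by (auto intro!: exI[of _ "p + q"] simp: poly_act_add[OF f])
    qed
    show "scale c x \<in> ?W" if x: "x \<in> ?W" for c x
    proof -
      from x obtain p where "x = poly_act f p v" "\<forall>i\<ge>k. coeff p i = 0" by blast
      then show ?thesis by (auto intro!: exI[of _ "smult c p"] simp: poly_act_smult[OF f])
    qed
  qed
  moreover have "?S k \<subseteq> ?W"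
    by (auto intro!: exI[of _ "monom 1 _"] simp: poly_act_monom[OF f])
  ultimately have "span (?S k) \<subseteq> ?W" by (rule span_minimal[rotated])
  with k obtain q where q: "(f ^^ k) v = poly_act f q v" "\<forall>i\<ge>k. coeff q i = 0" by blast
  let ?p = "monom 1 k + smult (- 1) q"
  have "coeff ?p k = 1" using q by simp
  then have "?p \<noteq> 0" by force
  moreover have "poly_act f ?p v = 0"
    unfolding poly_act_add[OF f] poly_act_smult[OF f] poly_act_monom[OF f] using q by simp
  ultimately show ?thesis by blast
qed

end

text \<open>
  The minimal polynomial of a vector has a root \<open>r\<close>; applying the cofactor of \<open>X - r\<close> to the
  vector gives an eigenvector.
\<close>
lemma (in fin_space) eigenvector_exists:
  fixes f :: "'g \<Rightarrow> 'g"
  assumes closed: "\<And>p :: 'k poly. degree p > 0 \<Longrightarrow> \<exists>x. poly p x = 0"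
    and f: "endo f" and V: "subspace V" "f ` V \<subseteq> V" "V \<noteq> {0}"
  shows "\<exists>c v. v \<in> V \<and> v \<noteq> 0 \<and> f v = scale c v"
proof -
  obtain v where v: "v \<in> V" "v \<noteq> 0" using V subspace_0 by blast
  obtain p where p: "p \<noteq> 0" "poly_act f p v = 0"
    and minimal: "\<And>q. q \<noteq> 0 \<Longrightarrow> poly_act f q v = 0 \<Longrightarrow> degree p \<le> degree q"
  proof -
    obtain p0 where p0: "p0 \<noteq> 0 \<and> poly_act f p0 v = 0" using annihilating_poly_exists[OF f] by blast
    obtain p where "p \<noteq> 0 \<and> poly_act f p v = 0"
      "\<And>q. q \<noteq> 0 \<and> poly_act f q v = 0 \<Longrightarrow> degree p \<le> degree q"
      using ex_has_least_nat[of "\<lambda>p. p \<noteq> 0 \<and> poly_act f p v = 0", OF p0] by (metis (lifting))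
    then show thesis by (intro that[of p]) simp_all
  qed
  have "degree p > 0"
  proof (rule ccontr)
    assume "\<not> degree p > 0"
    then obtain a where a: "p = [:a:]" by (auto elim: degree_eq_zeroE)
    then show False using p v by (simp add: poly_act_pCons[OF f] poly_act_0 endo_zero[OF f])
  qed
  then obtain r where "poly p r = 0" using closed by blast
  then obtain q where q: "p = [:- r, 1:] * q" by (metis dvdE poly_eq_0_iff_dvd)
  let ?w = "poly_act f q v"
  have "q \<noteq> 0" using p q by auto
  moreover have "degree p = Suc (degree q)" using q \<open>q \<noteq> 0\<close> by (simp add: degree_mult_eq del: mult_pCons_left)
  ultimately have w: "?w \<noteq> 0" using minimal by force
  have "p = pCons 0 q + smult (- r) q" using q by (simp add: algebra_simps)
  then have "poly_act f p v = f ?w + scale (- r) ?w"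
    by (simp only: poly_act_add[OF f] poly_act_smult[OF f] poly_act_pCons[OF f]) simp
  with p have "f ?w = scale r ?w" by simp
  moreover have "?w \<in> V" using poly_act_closed f V v by blast
  ultimately show ?thesis using w by blast
qed

text \<open>
  Fitting's lemma, in the form used here: once the ranges of the powers of \<open>f\<close> on \<open>V\<close> have
  stabilised, every vector differs from one in the stable range by one that a power of \<open>f\<close> kills.
\<close>
lemma (in fin_space) fitting:
  assumes f: "endo f" and V: "subspace V" "f ` V \<subseteq> V"
  shows "\<exists>n. (f ^^ n) ` V \<subseteq> f ` ((f ^^ n) ` V) \<and> (\<forall>x\<in>V. \<exists>y\<in>(f ^^ n) ` V. (f ^^ n) (x - y) = 0)"
proof -
  have sub: "subspace ((f ^^ n) ` V)" for n by (rule endo_image_subspace[OF endo_funpow[OF f] V(1)])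
  have mono: "(f ^^ (n + k)) ` V \<subseteq> (f ^^ n) ` V" for n k
  proof -
    have "(f ^^ k) ` V \<subseteq> V" using V(2) by (induction k) auto
    then show ?thesis by (auto simp: funpow_add)
  qed
  obtain n where n: "\<And>m. dim ((f ^^ n) ` V) \<le> dim ((f ^^ m) ` V)"
    using ex_has_least_nat[of "\<lambda>_. True" 0 "\<lambda>n. dim ((f ^^ n) ` V)"] by auto
  have stable: "(f ^^ (n + k)) ` V = (f ^^ n) ` V" for k
    using subspace_dim_equal[OF sub sub mono n] .
  have "f ` ((f ^^ n) ` V) = (f ^^ n) ` V"
    using stable[of 1] by (simp add: image_comp o_def)
  moreover have "\<exists>y\<in>(f ^^ n) ` V. (f ^^ n) (x - y) = 0" if "x \<in> V" for x
  proof -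
    have "(f ^^ n) x \<in> (f ^^ (n + n)) ` V" using that stable[of n] by simp
    then obtain z where "z \<in> V" "(f ^^ n) x = (f ^^ n) ((f ^^ n) z)" by (auto simp: funpow_add)
    then have "(f ^^ n) (x - (f ^^ n) z) = 0" by (subst endo_diff[OF endo_funpow[OF f]]) simp
    with \<open>z \<in> V\<close> show ?thesis by blast
  qed
  ultimately show ?thesis by blast
qed

section \<open>Finite direct sum decompositions\<close>

locale direct_decomposition = lin_space scale
  for scale :: "'k::field \<Rightarrow> 'g::ab_group_add \<Rightarrow> 'g" +
  fixes W :: "'i set" and G :: "'i \<Rightarrow> 'g set"
  assumes finite_W: "finite W" and subspace_G: "subspace (G i)"
    and spanning: "x \<in> span (\<Union>i\<in>W. G i)"
    and direct: "(\<And>i. i \<in> W \<Longrightarrow> y i \<in> G i) \<Longrightarrow> (\<Sum>i\<in>W. y i) = 0 \<Longrightarrow> i \<in> W \<Longrightarrow> y i = 0"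
begin

definition decomp :: "'g \<Rightarrow> 'i \<Rightarrow> 'g"
  where "decomp x = (SOME y. (\<forall>i\<in>W. y i \<in> G i) \<and> x = (\<Sum>i\<in>W. y i))"

definition component :: "'i \<Rightarrow> 'g \<Rightarrow> 'g"
  where "component i x = (if i \<in> W then decomp x i else 0)"

lemma component_sum: "(\<Sum>i\<in>W. component i x) = x" and component_in: "component i x \<in> G i"
proof -
  have "(\<forall>i\<in>W. decomp x i \<in> G i) \<and> x = (\<Sum>i\<in>W. decomp x i)"
    using someI_ex[OF span_UN_eq_sum[OF finite_W subspace_G spanning[of x]]] unfolding decomp_def .
  then show "(\<Sum>i\<in>W. component i x) = x" "component i x \<in> G i" by (auto simp: component_def subspace_0[OF subspace_G])
qed

lemma component_unique:
  assumes "\<And>i. i \<in> W \<Longrightarrow> y i \<in> G i" "(\<Sum>i\<in>W. y i) = x" "i \<in> W"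
  shows "component i x = y i"
proof -
  have "(\<Sum>i\<in>W. component i x - y i) = 0" using assms by (simp add: sum_subtractf component_sum)
  from direct[OF _ this assms(3)] have "component i x - y i = 0"
    using assms component_in subspace_diff[OF subspace_G] by blast
  then show ?thesis by simp
qed

lemma component_outside: "i \<notin> W \<Longrightarrow> component i x = 0"
  by (simp add: component_def)

lemma component_endo: "endo (component i)"
proof (cases "i \<in> W")
  case True
  show ?thesis
  proof (rule endoI)
    show "component i (x + y) = component i x + component i y" for x y
      using True by (intro component_unique[of "\<lambda>i. component i x + component i y"])
        (auto simp: sum.distrib component_sum intro!: subspace_add[OF subspace_G] component_in)
    show "component i (scale c x) = scale c (component i x)" for c x
      using True by (intro component_unique[of "\<lambda>i. scale c (component i x)"])
        (auto simp: scale_sum_right[symmetric] component_sum intro!: subspace_scale[OF subspace_G] component_in)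
  qed
qed (simp add: component_outside endoI)

lemma component_of_member:
  assumes "x \<in> G i" "i \<in> W"
  shows "component j x = (if j = i then x else 0)"
proof (cases "j \<in> W")
  case True
  show ?thesis
    using assms True finite_W
    by (intro component_unique[of "\<lambda>j. if j = i then x else 0"]) (auto simp: sum.delta' subspace_0[OF subspace_G])
qed (use assms in \<open>auto simp: component_outside\<close>)

lemma endo_eqI:
  assumes "endo f" "endo g" "\<And>i x. i \<in> W \<Longrightarrow> x \<in> G i \<Longrightarrow> f x = g x"
  shows "f x = g x"
proof -
  have "f (\<Sum>i\<in>W. component i x) = g (\<Sum>i\<in>W. component i x)"
    unfolding endo_sum[OF assms(1)] endo_sum[OF assms(2)]
    by (intro sum.cong refl assms(3)[OF _ component_in]) auto
  then show ?thesis by (simp add: component_sum)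
qed

definition diag :: "('i \<Rightarrow> 'k) \<Rightarrow> 'g \<Rightarrow> 'g"
  where "diag a x = (\<Sum>i\<in>W. scale (a i) (component i x))"

lemma diag_endo: "endo (diag a)"
  by (rule endoI)
    (simp_all add: diag_def endo_add[OF component_endo] endo_scale[OF component_endo] scale_right_distrib
      sum.distrib scale_sum_right scale_left_commute mult.commute)

lemma diag_of_member: "x \<in> G i \<Longrightarrow> i \<in> W \<Longrightarrow> diag a x = scale (a i) x"
  by (simp add: diag_def component_of_member if_distrib[of "scale _"] sum.delta[OF finite_W] cong: if_cong)

end

locale finite_dimensional_decomposition =
  direct_decomposition scale W G + fin_space scale Basis
  for scale :: "'k::field \<Rightarrow> 'g::ab_group_add \<Rightarrow> 'g" and W :: "'i set" and G Basis
begin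

lemma trace_component: "i \<in> W \<Longrightarrow> trace (component i) = of_nat (dim (G i))"
proof -
  assume i: "i \<in> W"
  have "range (component i) = G i"
  proof
    show "range (component i) \<subseteq> G i" using component_in by auto
    show "G i \<subseteq> range (component i)"
    proof
      fix x assume "x \<in> G i"
      then have "x = component i x" by (simp add: component_of_member i)
      then show "x \<in> range (component i)" by (rule range_eqI)
    qed
  qed
  moreover have "component i (component i x) = component i x" for x using component_of_member[OF component_in i] by simp
  ultimately show ?thesis using trace_projection[OF component_endo, of i] by simp
qed

lemma trace_diag: "trace (diag a) = (\<Sum>i\<in>W. a i * of_nat (dim (G i)))"
  unfolding diag_def[abs_def] trace_sum trace_scale by (simp add: trace_component)

end

section \<open>Integral root systems and their highest root\<close>

text \<open>
  Roots are integer coordinate vectors with respect to the base, so that sizes of inner products can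
  be compared although the ground field carries no order. The number \<open>p x d\<close> is the value of \<open>x\<close> on
  the coroot of \<open>d\<close>, given by its values \<open>cartan b d\<close> at the simple roots, \<open>refl d\<close> is the reflection
  in \<open>d\<close>, and \<open>e b\<close> is the simple root \<open>b\<close>. The assumption \<open>equivariant\<close> says that reflections carry
  coroots to coroots; \<open>diff_in\<close> is the part of the string property that is used.
\<close>
locale coordinate_root_system =
  fixes Phi :: "('b \<Rightarrow> int) set" and B :: "'b set" and cartan :: "'b \<Rightarrow> ('b \<Rightarrow> int) \<Rightarrow> int"
    and p :: "('b \<Rightarrow> int) \<Rightarrow> ('b \<Rightarrow> int) \<Rightarrow> int"
    and refl :: "('b \<Rightarrow> int) \<Rightarrow> ('b \<Rightarrow> int) \<Rightarrow> ('b \<Rightarrow> int)"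
    and e :: "'b \<Rightarrow> 'b \<Rightarrow> int"
  assumes p_def: "p x d = (\<Sum>b\<in>B. x b * cartan b d)"
    and refl_def: "refl d x = (\<lambda>b. x b - p x d * d b)"
    and e_def: "e b = (\<lambda>c. if c = b then 1 else 0)"
    and finite_B: "finite B" and finite_Phi: "finite Phi"
    and support: "g \<in> Phi \<Longrightarrow> b \<notin> B \<Longrightarrow> g b = 0"
    and simple_in: "b \<in> B \<Longrightarrow> e b \<in> Phi"
    and sign: "g \<in> Phi \<Longrightarrow> (\<forall>b\<in>B. 0 \<le> g b) \<or> (\<forall>b\<in>B. g b \<le> 0)"
    and pair_self: "g \<in> Phi \<Longrightarrow> p g g = 2"
    and refl_in: "g \<in> Phi \<Longrightarrow> d \<in> Phi \<Longrightarrow> refl d g \<in> Phi"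
    and equivariant: "g \<in> Phi \<Longrightarrow> d \<in> Phi \<Longrightarrow> p x (refl d g) = p (refl d x) g"
    and diff_in: "g \<in> Phi \<Longrightarrow> d \<in> Phi \<Longrightarrow> p g d > 0 \<Longrightarrow> g \<noteq> d \<Longrightarrow> g - d \<in> Phi"
    and double_notin: "g \<in> Phi \<Longrightarrow> g + g \<notin> Phi"
    and nondegenerate: "(\<And>b. b \<notin> B \<Longrightarrow> x b = 0) \<Longrightarrow> (\<And>d. d \<in> Phi \<Longrightarrow> p x d = 0) \<Longrightarrow> x = 0"
    and irreducible: "S \<subseteq> B \<Longrightarrow> S \<noteq> {} \<Longrightarrow>
      (\<And>g. g \<in> Phi \<Longrightarrow> (\<forall>b\<in>S. g b = 0) \<or> (\<forall>b\<in>B - S. g b = 0)) \<Longrightarrow> S = B"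
begin

lemma e_simps: "e b b = 1" "c \<noteq> b \<Longrightarrow> e b c = 0"
  by (simp_all add: e_def)

lemma pair_add: "p (x + y) d = p x d + p y d"
  by (simp add: p_def distrib_right sum.distrib)

lemma pair_diff: "p (x - y) d = p x d - p y d"
  by (simp add: p_def left_diff_distrib sum_subtractf)

lemma pair_neg: "p (- x) d = - p x d"
  by (simp add: p_def sum_negf)

lemma pair_refl: "p (refl d x) g = p x g - p x d * p d g"
  unfolding p_def[of "refl d x"] p_def[of x g] p_def[of d g]
  by (simp add: refl_def algebra_simps sum_subtractf sum_distrib_left)

lemma pair_e: "b \<in> B \<Longrightarrow> p (e b) d = cartan b d"
  by (simp add: p_def e_def finite_B if_distrib[of "\<lambda>x. x * _"] sum.delta cong: if_cong)

lemma pair_expand: "p x d = (\<Sum>b\<in>B. x b * p (e b) d)"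
  unfolding p_def[of x] by (intro sum.cong refl) (simp add: pair_e)

lemma refl_self: "g \<in> Phi \<Longrightarrow> refl g g = - g"
  by (auto simp: refl_def pair_self)

lemma neg_in: "g \<in> Phi \<Longrightarrow> - g \<in> Phi"
  using refl_in[of g g] by (simp add: refl_self)

lemma refl_refl: "d \<in> Phi \<Longrightarrow> refl d (refl d x) = x"
  unfolding refl_def[of d "refl d x"] pair_refl by (auto simp: pair_self refl_def algebra_simps)

lemma nonzero: "g \<in> Phi \<Longrightarrow> g \<noteq> 0"
  using pair_self[of g] by (auto simp: p_def)

text \<open>
  The sum of the squares of all coroots: an invariant form with integer values, positive definite
  because the coroots separate points.
\<close>
definition ip :: "('b \<Rightarrow> int) \<Rightarrow> ('b \<Rightarrow> int) \<Rightarrow> int"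
  where "ip x y = (\<Sum>d\<in>Phi. p x d * p y d)"

lemma ip_sym: "ip x y = ip y x"
  by (simp add: ip_def mult.commute)

lemma ip_diff: "ip (x - y) z = ip x z - ip y z"
  by (simp add: ip_def pair_diff left_diff_distrib sum_subtractf)

lemma ip_neg: "ip (- x) z = - ip x z"
  by (simp add: ip_def pair_neg sum_negf)

lemma ip_diff_right: "ip z (x - y) = ip z x - ip z y"
  using ip_diff[of x y z] by (metis ip_sym)

lemma ip_neg_right: "ip z (- x) = - ip z x"
  using ip_neg[of x z] by (metis ip_sym)

lemma ip_diff_diff: "ip (x - y) (x - y) = ip x x - 2 * ip x y + ip y y"
  by (simp add: ip_diff ip_diff_right ip_sym[of y x])

lemma ip_refl_left: "ip (refl d x) y = ip x y - p x d * ip d y"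
  by (simp add: ip_def pair_refl algebra_simps sum_subtractf sum_distrib_left)

lemma ip_expand: "ip x y = (\<Sum>b\<in>B. y b * ip x (e b))"
  unfolding ip_def pair_expand[of y] by (simp add: sum_distrib_left algebra_simps) (rule sum.swap)

lemma ip_refl:
  assumes g: "g \<in> Phi"
  shows "ip (refl g x) (refl g y) = ip x y"
proof -
  have "ip (refl g x) (refl g y) = (\<Sum>d\<in>Phi. p x (refl g d) * p y (refl g d))"
    unfolding ip_def by (intro sum.cong refl) (simp add: equivariant g)
  also have "\<dots> = ip x y"
    unfolding ip_def
    by (rule sum.reindex_bij_witness[of _ "refl g" "refl g"]) (auto simp: refl_refl g refl_in)
  finally show ?thesis .
qed

lemma ip_pair: "g \<in> Phi \<Longrightarrow> p x g * ip g g = 2 * ip x g"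
  using ip_refl[of g x g] by (simp add: refl_self ip_neg_right ip_refl_left)

lemma ip_nonneg: "ip x x \<ge> 0"
  by (simp add: ip_def sum_nonneg)

lemma ip_definite: "(\<And>b. b \<notin> B \<Longrightarrow> x b = 0) \<Longrightarrow> ip x x \<le> 0 \<Longrightarrow> x = 0"
proof (rule nondegenerate)
  fix d assume "ip x x \<le> 0" "d \<in> Phi"
  moreover have "ip x x = 0" using ip_nonneg[of x] calculation by simp
  ultimately have "p x d * p x d = 0"
    unfolding ip_def using sum_nonneg_eq_0_iff[OF finite_Phi, of "\<lambda>d. p x d * p x d"] by auto
  then show "p x d = 0" by simp
qed

lemma ip_root_pos: "g \<in> Phi \<Longrightarrow> ip g g > 0"
  using ip_definite[of g] support nonzero by fastforce

lemma pair_pos_iff: "g \<in> Phi \<Longrightarrow> p x g > 0 \<longleftrightarrow> ip x g > 0"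
  using ip_pair[of g x] ip_root_pos[of g] by (metis mult_2 add_pos_pos not_less add_nonpos_nonpos zero_less_mult_pos2 mult_pos_pos)

lemma pair_nonneg_iff: "g \<in> Phi \<Longrightarrow> p x g \<le> 0 \<longleftrightarrow> ip x g \<le> 0"
  using pair_pos_iff[of g x] by (simp add: not_less[symmetric])

lemma diff_in_ip: "g \<in> Phi \<Longrightarrow> d \<in> Phi \<Longrightarrow> ip g d > 0 \<Longrightarrow> g \<noteq> d \<Longrightarrow> g - d \<in> Phi"
  using diff_in pair_pos_iff by blast

text \<open>Positivity of the norm of \<open>g - d\<close>; the Cauchy-Schwarz inequality is only used in this form.\<close>

lemma two_ip_less:
  assumes "g \<in> Phi" "d \<in> Phi" "g \<noteq> d"
  shows "2 * ip g d < ip g g + ip d d"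
proof (rule ccontr)
  assume "\<not> ?thesis"
  then have "g - d = 0" by (intro ip_definite) (auto simp: ip_diff_diff support assms)
  with assms show False by simp
qed

lemma pair_eq_1:
  assumes "g \<in> Phi" "d \<in> Phi" "g \<noteq> d" "ip g g \<le> ip d d" "ip g d > 0"
  shows "p g d = 1"
proof -
  have "p g d * ip d d < 2 * ip d d"
    using two_ip_less[OF assms(1-3)] assms ip_pair[of d g] by simp
  then have "p g d < 2" using ip_root_pos[OF assms(2)] by (simp add: mult_less_cancel_right)
  moreover have "p g d > 0" using assms pair_pos_iff by blast
  ultimately show ?thesis by simp
qed

lemma nonneg_if: "g \<in> Phi \<Longrightarrow> c \<in> B \<Longrightarrow> g c > 0 \<Longrightarrow> 0 \<le> g b"
  using sign[of g] support[of g b] by (cases "b \<in> B") force+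

lemma pair_simple_nonpos:
  assumes "b \<in> B" "c \<in> B" "b \<noteq> c"
  shows "p (e b) (e c) \<le> 0"
proof (rule ccontr)
  assume "\<not> ?thesis"
  then have "e b - e c \<in> Phi"
    using assms by (intro diff_in simple_in) (auto simp: e_def fun_eq_iff)
  from nonneg_if[OF this assms(1), of c] show False using assms by (simp add: e_def)
qed

subsection \<open>The highest root\<close>

definition total_height :: "('b \<Rightarrow> int) \<Rightarrow> int"
  where "total_height x = (\<Sum>b\<in>B. x b)"

text \<open>
  Subtract simple roots from a positive root one at a time. If the simple root \<open>b\<close> last subtracted
  lay on the other side of the splitting than what remains, it would be orthogonal to the rest \<open>d\<close>,
  and the reflection of \<open>d + b\<close> in \<open>b\<close> would be \<open>d - b\<close>, which has coefficients of both signs.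
\<close>
lemma orthogonal_support_splits:
  assumes S: "S \<subseteq> B"
    and orth: "\<And>b c. b \<in> S \<Longrightarrow> c \<in> B - S \<Longrightarrow> p (e b) (e c) = 0 \<and> p (e c) (e b) = 0"
    and g: "g \<in> Phi"
  shows "(\<forall>b\<in>S. g b = 0) \<or> (\<forall>b\<in>B - S. g b = 0)"
proof -
  have pos: "(\<forall>b\<in>S. g b = 0) \<or> (\<forall>b\<in>B - S. g b = 0)"
    if "g \<in> Phi" "\<forall>b\<in>B. 0 \<le> g b" for g
    using that
  proof (induction "nat (total_height g)" arbitrary: g rule: less_induct)
    case less
    have "0 < (\<Sum>b\<in>B. g b * ip g (e b))" using ip_root_pos[OF less(2)] ip_expand[of g g] by simp
    then obtain b where b: "b \<in> B" "g b * ip g (e b) > 0"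
      by (meson not_less sum_nonpos)
    then have gb: "g b > 0" "ip g (e b) > 0"
      using less(3) by (auto simp: zero_less_mult_iff dest!: bspec)
    show ?case
    proof (cases "g = e b")
      case True
      then show ?thesis by (auto simp: e_def)
    next
      case False
      let ?d = "g - e b"
      have d: "?d \<in> Phi" using diff_in_ip[OF less(2) simple_in[OF b(1)] gb(2) False] .
      have "\<not> (\<forall>c\<in>B. ?d c \<le> 0)"
      proof
        assume *: "\<forall>c\<in>B. ?d c \<le> 0"
        have "g c = e b c" for c
          using * less(3) gb(1) b(1) support[OF less(2), of c] by (cases "c \<in> B"; cases "c = b") (force simp: e_def)+
        with False show False by auto
      qed
      then obtain c where c: "c \<in> B" "?d c > 0" by force
      then have dpos: "0 \<le> ?d a" for a using nonneg_if[OF d] by blast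
      have "total_height ?d < total_height g"
        using b by (simp add: total_height_def sum_subtractf e_def finite_B sum.delta)
      moreover have "total_height ?d \<ge> 0" using dpos by (simp add: total_height_def sum_nonneg del: fun_diff_def)
      ultimately have IH: "(\<forall>b\<in>S. ?d b = 0) \<or> (\<forall>b\<in>B - S. ?d b = 0)"
        using less(1)[of ?d] d dpos by auto
      have side: "(\<forall>a\<in>S. ?d a = 0) \<Longrightarrow> b \<notin> S" "(\<forall>a\<in>B - S. ?d a = 0) \<Longrightarrow> b \<in> S"
      proof -
        have False if same: "\<And>a. a \<in> B \<Longrightarrow> ?d a \<noteq> 0 \<Longrightarrow> p (e a) (e b) = 0" and db: "?d b = 0"
        proof -
          have "p ?d (e b) = 0" unfolding pair_expand[of ?d] using same by (intro sum.neutral) auto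
          then have "p g (e b) = 2" using pair_self[OF simple_in[OF b(1)]] by (simp add: pair_diff)
          then have "refl (e b) g = ?d - e b" by (auto simp: refl_def)
          then have "?d - e b \<in> Phi" using refl_in[OF less(2) simple_in[OF b(1)]] by simp
          moreover have "(?d - e b) c > 0" using c db by (auto simp: e_def split: if_splits)
          ultimately have "(?d - e b) b \<ge> 0" using nonneg_if c(1) by blast
          then show False using db by (simp add: e_def)
        qed note contra = this
        show "b \<notin> S" if "\<forall>a\<in>S. ?d a = 0"
          using contra that orth S by (metis Diff_iff)
        show "b \<in> S" if "\<forall>a\<in>B - S. ?d a = 0"
          using contra that orth S b(1) by (metis Diff_iff)
      qed
      have g_eq: "g a = ?d a" if "a \<noteq> b" for a using that by (simp add: e_def)
      from IH show ?thesis
      proof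
        assume d0: "\<forall>a\<in>S. ?d a = 0"
        then have "\<forall>a\<in>S. g a = 0" using side(1)[OF d0] g_eq by (metis (full_types))
        then show ?thesis ..
      next
        assume d0: "\<forall>a\<in>B - S. ?d a = 0"
        then have "\<forall>a\<in>B - S. g a = 0" using side(2)[OF d0] g_eq by (metis (full_types) DiffE)
        then show ?thesis ..
      qed
    qed
  qed
  from sign[OF g] show ?thesis
  proof
    assume "\<forall>b\<in>B. 0 \<le> g b"
    then show ?thesis using pos g by blast
  next
    assume "\<forall>b\<in>B. g b \<le> 0"
    then show ?thesis using pos[OF neg_in[OF g]] by simp
  qed
qed

definition maximal_root :: "('b \<Rightarrow> int) \<Rightarrow> bool"
  where "maximal_root m \<longleftrightarrow> m \<in> Phi \<and> (\<forall>g\<in>Phi. (\<forall>b\<in>B. m b \<le> g b) \<longrightarrow> g = m)"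

lemma below_maximal_root:
  assumes g: "g \<in> Phi"
  shows "\<exists>m. maximal_root m \<and> (\<forall>b\<in>B. g b \<le> m b)"
proof -
  let ?X = "{d \<in> Phi. \<forall>b\<in>B. g b \<le> d b}"
  have "finite ?X" "?X \<noteq> {}" using finite_Phi g by auto
  then have "Max (total_height ` ?X) \<in> total_height ` ?X" by (intro Max_in) auto
  then obtain m where m: "m \<in> ?X" "total_height m = Max (total_height ` ?X)" by auto
  then have m: "m \<in> ?X" "\<And>d. d \<in> ?X \<Longrightarrow> total_height d \<le> total_height m"
    using \<open>finite ?X\<close> by (auto intro!: Max_ge)
  have "d = m" if d: "d \<in> Phi" "\<forall>b\<in>B. m b \<le> d b" for d
  proof -
    have "d \<in> ?X" using d m by force
    then have "(\<Sum>b\<in>B. d b - m b) \<le> 0" using m by (simp add: total_height_def sum_subtractf)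
    moreover have nn: "\<forall>b\<in>B. 0 \<le> d b - m b" using d by simp
    ultimately have "(\<Sum>b\<in>B. d b - m b) = 0" using sum_nonneg[of B "\<lambda>b. d b - m b"] by simp
    then have "\<forall>b\<in>B. d b - m b = 0"
      using sum_nonneg_eq_0_iff[OF finite_B, of "\<lambda>b. d b - m b"] nn by blast
    then have "d b = m b" for b using support[OF d(1), of b] support[of m b] m(1) by (cases "b \<in> B") auto
    then show ?thesis by auto
  qed
  then show ?thesis using m(1) by (auto simp: maximal_root_def)
qed

lemma maximal_root_dominant:
  assumes m: "maximal_root m" and b: "b \<in> B"
  shows "0 \<le> p m (e b)"
proof (rule ccontr)
  assume *: "\<not> ?thesis"
  have "refl (e b) m \<in> Phi" using m b simple_in refl_in by (simp add: maximal_root_def)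
  moreover have "\<forall>c\<in>B. m c \<le> refl (e b) m c" using * by (simp add: refl_def e_def)
  ultimately have "refl (e b) m = m" using m by (simp add: maximal_root_def)
  then have "refl (e b) m b = m b" by simp
  with * show False by (simp add: refl_def e_def)
qed

text \<open>
  The support of a maximal root is orthogonal to the simple roots outside it, so it is everything
  by irreducibility.
\<close>
lemma maximal_root_full_support:
  assumes m: "maximal_root m" and b: "b \<in> B"
  shows "0 < m b"
proof -
  have mPhi: "m \<in> Phi" using m by (simp add: maximal_root_def)
  have nonneg: "0 \<le> m c" for c
  proof (cases "\<forall>b\<in>B. m b \<le> 0")
    case True
    then have "\<forall>b\<in>B. m b \<le> (- m) b" by simp
    then have "- m = m" using m neg_in[OF mPhi] by (simp add: maximal_root_def)
    then have "p m m = - p m m" using pair_neg by metis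
    then show ?thesis using pair_self[OF mPhi] by simp
  next
    case False
    then show ?thesis using nonneg_if[OF mPhi] by (meson not_le)
  qed
  let ?S = "{b \<in> B. 0 < m b}"
  have "?S = B"
  proof (rule irreducible)
    show "?S \<noteq> {}"
    proof
      assume "?S = {}"
      then have "m c = 0" for c using nonneg[of c] support[OF mPhi, of c] by (cases "c \<in> B") force+
      then show False using nonzero[OF mPhi] by auto
    qed
    show "(\<forall>b\<in>?S. g b = 0) \<or> (\<forall>b\<in>B - ?S. g b = 0)" if "g \<in> Phi" for g
    proof (rule orthogonal_support_splits[OF _ _ that])
      fix a c assume a: "a \<in> ?S" and c: "c \<in> B - ?S"
      have mc: "m c = 0" using c nonneg[of c] by auto
      have nonpos: "m x * p (e x) (e c) \<le> 0" if "x \<in> B" for x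
        using that c nonneg[of x] pair_simple_nonpos[of x c] mc by (cases "x = c") (auto simp: mult_nonneg_nonpos)
      have "(\<Sum>x\<in>B. - (m x * p (e x) (e c))) \<le> 0"
        using maximal_root_dominant[OF m, of c] c pair_expand[of m "e c"] by (simp add: sum_negf)
      then have "(\<Sum>x\<in>B. - (m x * p (e x) (e c))) = 0"
        using nonpos sum_nonneg[of B "\<lambda>x. - (m x * p (e x) (e c))"] by fastforce
      then have "\<forall>x\<in>B. - (m x * p (e x) (e c)) = 0"
        using sum_nonneg_eq_0_iff[OF finite_B, of "\<lambda>x. - (m x * p (e x) (e c))"] nonpos by fastforce
      then have z: "p (e a) (e c) = 0" using a by auto
      have aB: "a \<in> B" and cB: "c \<in> B" using a c by auto
      have "ip (e a) (e c) = 0" using ip_pair[OF simple_in[OF cB], of "e a"] z by simp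
      then have "p (e c) (e a) * ip (e a) (e a) = 0"
        using ip_pair[OF simple_in[OF aB], of "e c"] by (simp add: ip_sym)
      then show "p (e a) (e c) = 0 \<and> p (e c) (e a) = 0"
        using z ip_root_pos[OF simple_in[OF aB]] by auto
    qed simp
  qed simp
  then show ?thesis using b by auto
qed

text \<open>
  Two maximal roots are dominant with full support, so they have positive inner product, and their
  difference would be a root, positive or negative.
\<close>
lemma maximal_root_unique:
  assumes m: "maximal_root m" and m': "maximal_root m'"
  shows "m = m'"
proof (rule ccontr)
  assume ne: "m \<noteq> m'"
  have Phi: "m \<in> Phi" "m' \<in> Phi" using m m' by (auto simp: maximal_root_def)
  have nn: "0 \<le> ip m (e b)" if "b \<in> B" for b
    using maximal_root_dominant[OF m that] ip_pair[OF simple_in[OF that], of m] ip_root_pos[OF simple_in[OF that]]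
    by (metis mult_nonneg_nonneg less_imp_le zero_le_mult_iff not_numeral_le_zero)
  have "0 < (\<Sum>b\<in>B. m b * ip m (e b))" using ip_root_pos[OF Phi(1)] ip_expand[of m m] by simp
  then obtain b where b: "b \<in> B" "m b * ip m (e b) > 0" by (meson not_less sum_nonpos)
  then have "ip m (e b) \<noteq> 0" by auto
  then have "0 < (\<Sum>b\<in>B. m' b * ip m (e b))"
    using b(1) nn maximal_root_full_support[OF m'] finite_B
    by (intro sum_pos2[of B b]) (auto simp: less_le)
  then have "ip m m' > 0" using ip_expand[of m m'] by simp
  then have "m - m' \<in> Phi" using diff_in_ip Phi ne by blast
  from sign[OF this] show False using m m' Phi ne unfolding maximal_root_def by force
qed

theorem highest_root_exists: "B \<noteq> {} \<Longrightarrow> \<exists>t\<in>Phi. \<forall>g\<in>Phi. \<forall>b\<in>B. g b \<le> t b"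
proof -
  assume "B \<noteq> {}"
  then obtain m where m: "maximal_root m" using below_maximal_root simple_in by blast
  then have "\<forall>g\<in>Phi. \<forall>b\<in>B. g b \<le> m b"
    using below_maximal_root maximal_root_unique by blast
  then show ?thesis using m by (auto simp: maximal_root_def)
qed

end

section \<open>Roots of height one with no two summing to a root\<close>

locale marked_root_system = coordinate_root_system Phi B cartan p refl e
  for Phi :: "('b \<Rightarrow> int) set" and B cartan p refl e +
  fixes al :: 'b
  assumes al: "al \<in> B"
begin

definition layer :: "int \<Rightarrow> ('b \<Rightarrow> int) set"
  where "layer i = {g \<in> Phi. g al = i}"

lemma layerD: "g \<in> layer i \<Longrightarrow> g \<in> Phi" "g \<in> layer i \<Longrightarrow> g al = i"
  by (simp_all add: layer_def)

lemma finite_layer: "finite (layer i)"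
  using finite_Phi by (simp add: layer_def)

lemma e_al_layer: "e al \<in> layer 1"
  using simple_in[OF al] by (simp add: layer_def e_def)

lemma layer1_nonneg: "g \<in> layer 1 \<Longrightarrow> 0 \<le> g b"
  using nonneg_if[of g al b] al by (simp add: layer_def)

lemma refl_layer: "b \<in> B - {al} \<Longrightarrow> g \<in> layer i \<Longrightarrow> refl (e b) g \<in> layer i"
  using refl_in[of g "e b"] simple_in by (auto simp: layer_def refl_def e_def)

lemma ip_refl_simple: "b \<in> B - {al} \<Longrightarrow> ip (refl (e b) x) (refl (e b) y) = ip x y"
  using ip_refl simple_in by auto

text \<open>
  The sum of a set stable under the reflections in the other simple roots is orthogonal to those
  roots, so pairing with it is a multiple of the coefficient at \<open>al\<close>; the multiple is positive,
  because the coefficient and the norm of the sum itself are.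
\<close>
lemma stable_set_meets_halfspace:
  assumes fin: "finite X" "X \<noteq> {}" and X: "X \<subseteq> layer 1"
    and stable: "\<And>b g. b \<in> B - {al} \<Longrightarrow> g \<in> X \<Longrightarrow> refl (e b) g \<in> X"
    and nu: "nu al > 0"
  shows "\<exists>g\<in>X. ip g nu > 0"
proof -
  define s where "s = (\<lambda>c. \<Sum>g\<in>X. g c)"
  have p_s: "p s d = (\<Sum>g\<in>X. p g d)" for d
    unfolding p_def s_def sum_distrib_right by (rule sum.swap)
  have ip_s: "ip s y = (\<Sum>g\<in>X. ip g y)" for y
    unfolding ip_def p_s sum_distrib_right by (rule sum.swap)
  have orth: "ip s (e b) = 0" if b: "b \<in> B - {al}" for b
  proof -
    have eb: "e b \<in> Phi" using b simple_in by auto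
    have "s b = (\<Sum>g\<in>X. refl (e b) g b)"
      unfolding s_def
      by (rule sum.reindex_bij_witness[of _ "refl (e b)" "refl (e b)"]) (auto simp: refl_refl eb stable[OF b])
    also have "\<dots> = s b - p s (e b)" 
      unfolding refl_def sum_subtractf by (simp add: e_simps p_s s_def[symmetric] sum_distrib_right[symmetric]) (simp add: s_def)
    finally show ?thesis using ip_pair[OF eb, of s] by simp
  qed
  have "(\<Sum>b\<in>B. y b * ip s (e b)) = (\<Sum>b\<in>B. if b = al then y al * ip s (e al) else 0)" for y
    using orth by (intro sum.cong) auto
  then have ip_al: "ip s y = y al * ip s (e al)" for y
    using ip_expand[of s y] al by (simp add: sum.delta finite_B)
  have s_al: "s al = int (card X)" 
  proof -
    have "s al = (\<Sum>g\<in>X. 1)" unfolding s_def using X by (intro sum.cong refl layerD(2)) auto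
    then show ?thesis by simp
  qed
  have "s \<noteq> 0" using s_al fin by auto
  moreover have "s b = 0" if "b \<notin> B" for b
    unfolding s_def using that X support by (intro sum.neutral) (auto simp: layer_def)
  ultimately have "ip s s > 0" using ip_definite[of s] by force
  then have "ip s (e al) > 0" using ip_al[of s] s_al by (simp add: zero_less_mult_iff)
  then have pos: "(\<Sum>g\<in>X. ip g nu) > 0" using ip_al[of nu] nu ip_s[of nu] by simp
  show ?thesis
  proof (rule ccontr)
    assume "\<not> ?thesis"
    then have "(\<Sum>g\<in>X. ip g nu) \<le> 0" by (intro sum_nonpos) (auto simp: not_less)
    with pos show False by simp
  qed
qed

definition norm_class :: "int \<Rightarrow> ('b \<Rightarrow> int) set"
  where "norm_class l = {g \<in> layer 1. ip g g = l}"

lemma norm_class_meets_halfspace: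
  assumes "g0 \<in> layer 1" "nu al > 0"
  shows "\<exists>g\<in>layer 1. ip g g = ip g0 g0 \<and> ip g nu > 0"
proof -
  have "\<exists>g\<in>norm_class (ip g0 g0). ip g nu > 0"
    by (rule stable_set_meets_halfspace)
      (use assms finite_layer in \<open>auto simp: norm_class_def intro: refl_layer simp: ip_refl_simple\<close>)
  then show ?thesis by (auto simp: norm_class_def)
qed

definition antidominant :: "('b \<Rightarrow> int) \<Rightarrow> bool"
  where "antidominant g \<longleftrightarrow> g \<in> layer 1 \<and> (\<forall>b\<in>B - {al}. p g (e b) \<le> 0)"

lemma antidominant_ip_nonpos:
  assumes "antidominant g" "\<And>b. b \<in> B \<Longrightarrow> 0 \<le> x b" "x al = 0"
  shows "ip g x \<le> 0"
  unfolding ip_expand[of g x]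
proof (rule sum_nonpos)
  fix b assume "b \<in> B"
  then show "x b * ip g (e b) \<le> 0"
    using assms pair_nonneg_iff[OF simple_in, of b g]
    by (cases "b = al") (auto simp: antidominant_def intro!: mult_nonneg_nonpos)
qed

lemma antidominant_ip_al:
  assumes "antidominant g"
  shows "ip g g \<le> ip g (e al)"
proof -
  have "ip g (g - e al) \<le> 0"
    using assms layer1_nonneg[of g] layerD(2)[of g 1]
    by (intro antidominant_ip_nonpos) (auto simp: antidominant_def e_def)
  then show ?thesis by (simp add: ip_diff_right)
qed

text \<open>
  Together with the preceding lemma, \<open>g - e al\<close> would otherwise have nonpositive norm.
\<close>
lemma antidominant_long:
  assumes g: "antidominant g" and "ip (e al) (e al) \<le> ip g g"
  shows "g = e al"
proof -
  have "g \<in> Phi" using g layerD by (auto simp: antidominant_def)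
  then show ?thesis
    using two_ip_less[of g "e al"] antidominant_ip_al[OF g] assms simple_in[OF al] by force
qed

text \<open>
  Norms of at least that of \<open>al\<close> are covered by the preceding lemma. For a smaller norm, suppose that
  \<open>g\<close> and \<open>h\<close> are distinct. If their inner product is positive, then \<open>g - h\<close> is a root without \<open>al\<close>
  component, and antidominance makes its norm nonpositive. If it is not, then \<open>2 (g, al) = (al, al)\<close>,
  likewise for \<open>h\<close>, and \<open>(al, al)\<close> is at least twice the common norm, so that \<open>al - g - h\<close> has
  nonpositive norm; but its coefficient at \<open>al\<close> is \<open>-1\<close>.
\<close>
lemma antidominant_unique:
  assumes g: "antidominant g" and h: "antidominant h" and norm: "ip g g = ip h h"
  shows "g = h"
proof (cases "ip (e al) (e al) \<le> ip g g")
  case True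
  then show ?thesis using antidominant_long g h norm by metis
next
  case short: False
  have layer: "g \<in> layer 1" "h \<in> layer 1" using g h by (auto simp: antidominant_def)
  then have Phi: "g \<in> Phi" "h \<in> Phi" by (auto dest: layerD)
  show ?thesis
  proof (rule ccontr)
    assume ne: "g \<noteq> h"
    show False
    proof (cases "ip g h > 0")
      case True
      then have d: "g - h \<in> Phi" using diff_in_ip Phi ne by blast
      have "(g - h) al = 0" "(h - g) al = 0" using layerD(2)[OF layer(1)] layerD(2)[OF layer(2)] by auto
      with sign[OF d] have "ip g (g - h) \<le> 0 \<or> ip h (h - g) \<le> 0"
        using antidominant_ip_nonpos[OF g, of "g - h"] antidominant_ip_nonpos[OF h, of "h - g"] by auto
      then have "ip g g \<le> ip g h"
        using norm ip_sym[of g h] by (auto simp: ip_diff_right)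
      then show False using two_ip_less[OF Phi ne] norm by simp
    next
      case False
      have al_half: "2 * ip x (e al) = ip (e al) (e al)" and al_double: "2 * ip x x \<le> ip (e al) (e al)"
        if x: "antidominant x" and "ip x x < ip (e al) (e al)" for x
      proof -
        have xPhi: "x \<in> Phi" using x layerD by (auto simp: antidominant_def)
        have pos: "ip x (e al) > 0" using antidominant_ip_al[OF x] ip_root_pos[OF xPhi] by simp
        then have "p x (e al) = 1" using that by (intro pair_eq_1 xPhi simple_in al) auto
        then show half: "2 * ip x (e al) = ip (e al) (e al)"
          using ip_pair[OF simple_in[OF al], of x] by simp
        have eq: "p (e al) x * ip x x = ip (e al) (e al)"
          using ip_pair[OF xPhi, of "e al"] half by (simp add: ip_sym)
        then have "ip x x < p (e al) x * ip x x" using that by simp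
        then have "p (e al) x > 1" using ip_root_pos[OF xPhi] by (simp add: mult_less_cancel_right1)
        then have "2 * ip x x \<le> p (e al) x * ip x x" using ip_root_pos[OF xPhi] by (intro mult_right_mono) auto
        then show "2 * ip x x \<le> ip (e al) (e al)" using eq by simp
      qed
      let ?x = "e al - g - h"
      have "ip ?x ?x = ip (e al) (e al) + ip g g + ip h h - 2 * ip g (e al) - 2 * ip h (e al) + 2 * ip g h"
        by (simp add: ip_diff ip_diff_right ip_sym[of "e al" g] ip_sym[of "e al" h] ip_sym[of h g])
      also have "\<dots> \<le> 0"
        using al_half[OF g] al_half[OF h] al_double[OF g] short norm False by simp
      finally have "?x = 0" by (intro ip_definite) (auto simp: support Phi simple_in al)
      then have "?x al = 0" by simp
      then show False using layerD(2)[OF layer(1)] layerD(2)[OF layer(2)] by (simp add: e_def)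
    qed
  qed
qed

text \<open>
  Reflecting in a simple root with which \<open>g\<close> pairs positively lowers the sum of the coefficients,
  so this ends at an antidominant root.
\<close>
lemma invariant_at_antidominant:
  assumes inv: "\<And>b g. b \<in> B - {al} \<Longrightarrow> g \<in> layer 1 \<Longrightarrow> f (refl (e b) g) = f g" and g: "g \<in> layer 1"
  shows "\<exists>h. antidominant h \<and> ip h h = ip g g \<and> f h = f g"
  using g
proof (induction "nat (total_height g)" arbitrary: g rule: less_induct)
  case less
  show ?case
  proof (cases "antidominant g")
    case False
    then obtain b where b: "b \<in> B - {al}" "p g (e b) > 0" using less(2) by (auto simp: antidominant_def not_le)
    let ?h = "refl (e b) g"
    have h: "?h \<in> layer 1" using refl_layer[OF b(1) less(2)] .
    have "total_height ?h = total_height g - p g (e b)"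
      using b by (simp add: total_height_def refl_def sum_subtractf e_def finite_B sum.delta if_distrib[of "\<lambda>x. _ * x"] cong: if_cong)
    moreover have "0 \<le> total_height ?h" using layer1_nonneg[OF h] by (simp add: total_height_def sum_nonneg)
    ultimately have "nat (total_height ?h) < nat (total_height g)" using b by simp
    from less(1)[OF this h] show ?thesis using inv[OF b(1) less(2)] ip_refl_simple[OF b(1)] by simp
  qed auto
qed

text \<open>
  Roots in the first layer of equal norm are conjugate under the reflections preserving the layers, as
  each is conjugate to the same antidominant root.
\<close>
lemma invariant_constant_on_norm_class:
  assumes "\<And>b g. b \<in> B - {al} \<Longrightarrow> g \<in> layer 1 \<Longrightarrow> f (refl (e b) g) = f g"
    and "g \<in> layer 1" "h \<in> layer 1" "ip g g = ip h h"
  shows "f g = f h"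
  using invariant_at_antidominant[of f g] invariant_at_antidominant[of f h] antidominant_unique assms
  by metis

lemma norm_layer1_le: "g \<in> layer 1 \<Longrightarrow> ip g g \<le> ip (e al) (e al)"
  using invariant_at_antidominant[of "\<lambda>_. ()" g] antidominant_long by (metis linear)

text \<open>
  Subtracting roots of the first layer and of the norm of \<open>al\<close> leads down to the second layer;
  \<open>P\<close> is any property that these steps preserve.
\<close>
lemma descend_to_layer2:
  assumes nu: "nu \<in> Phi" "nu al \<ge> 2" "P nu"
    and step: "\<And>nu g. nu \<in> Phi \<Longrightarrow> P nu \<Longrightarrow> g \<in> layer 1 \<Longrightarrow> ip g g = ip (e al) (e al) \<Longrightarrow> ip nu g > 0 \<Longrightarrow> nu \<noteq> g
      \<Longrightarrow> P (nu - g)"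
  shows "\<exists>mu\<in>layer 2. P mu"
  using nu
proof (induction "nat (nu al)" arbitrary: nu rule: less_induct)
  case less
  show ?case
  proof (cases "nu al = 2")
    case False
    obtain g where g: "g \<in> layer 1" "ip g g = ip (e al) (e al)" "ip g nu > 0"
      using norm_class_meets_halfspace[OF e_al_layer, of nu] less(3) by force
    have "nu \<noteq> g" using g(1) less(3) by (auto dest: layerD)
    then have "nu - g \<in> Phi" "P (nu - g)"
      using diff_in_ip[of nu g] step[of nu g] less g by (auto simp: ip_sym dest: layerD)
    moreover have "(nu - g) al = nu al - 1" using layerD(2)[OF g(1)] by simp
    ultimately show ?thesis using less(1)[of "nu - g"] less(3) False by auto
  qed (use less in \<open>auto simp: layer_def\<close>)
qed

lemma layer2_nonempty: "nu \<in> Phi \<Longrightarrow> nu al \<ge> 2 \<Longrightarrow> layer 2 \<noteq> {}"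
  using descend_to_layer2[of nu "\<lambda>_. True"] by auto

lemma layer2_splits:
  assumes "mu \<in> layer 2"
  shows "\<exists>g\<in>layer 1. \<exists>h\<in>layer 1. g + h = mu"
proof -
  obtain g where g: "g \<in> layer 1" "ip g mu > 0"
    using norm_class_meets_halfspace[OF e_al_layer, of mu] layerD(2)[OF assms] by auto
  have "mu \<noteq> g" using layerD(2)[OF g(1)] layerD(2)[OF assms] by auto
  then have "mu - g \<in> Phi" using g assms by (intro diff_in_ip) (auto simp: ip_sym dest: layerD)
  then have "mu - g \<in> layer 1" using g assms by (auto simp: layer_def)
  then show ?thesis using g by force
qed

text \<open>
  If \<open>mu\<close> in the second layer is shorter than \<open>al\<close>, reflecting in it a root \<open>g\<close> of the norm of \<open>al\<close>
  gives, up to sign, a root of that norm in a layer beyond the second, from which subtracting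
  further such roots leads down to the second layer within that norm.
\<close>
lemma long_in_layer2:
  assumes "layer 2 \<noteq> {}"
  shows "\<exists>mu\<in>layer 2. ip (e al) (e al) \<le> ip mu mu"
proof -
  obtain mu where mu: "mu \<in> layer 2" using assms by auto
  show ?thesis
  proof (cases "ip (e al) (e al) \<le> ip mu mu")
    case False
    have muPhi: "mu \<in> Phi" "mu al = 2" using mu by (auto dest: layerD)
    obtain g where g: "g \<in> layer 1" "ip g g = ip (e al) (e al)" "ip g mu > 0"
      using norm_class_meets_halfspace[OF e_al_layer, of mu] muPhi by auto
    have gPhi: "g \<in> Phi" "g al = 1" using g by (auto dest: layerD)
    have "p mu g = 1"
      using g False muPhi gPhi e_al_layer by (intro pair_eq_1) (auto simp: ip_sym)
    then have "p g mu * ip mu mu = ip g g"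
      using ip_pair[OF gPhi(1), of mu] ip_pair[OF muPhi(1), of g] by (simp add: ip_sym)
    then have "1 * ip mu mu < p g mu * ip mu mu" using False g by simp
    then have r: "p g mu \<ge> 2" using ip_root_pos[OF muPhi(1)] by (simp only: mult_less_cancel_right) auto
    let ?n = "- refl mu g"
    have "?n \<in> Phi" using neg_in[OF refl_in[OF gPhi(1) muPhi(1)]] .
    moreover have "?n al \<ge> 2" using r muPhi gPhi by (simp add: refl_def)
    moreover have "ip ?n ?n = ip (e al) (e al)"
      using ip_refl[OF muPhi(1), of g g] g by (simp add: ip_neg ip_neg_right)
    ultimately have "\<exists>mu\<in>layer 2. ip mu mu = ip (e al) (e al)"
    proof (rule descend_to_layer2)
      fix nu g assume *: "nu \<in> Phi" "ip nu nu = ip (e al) (e al)" "g \<in> layer 1"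
        "ip g g = ip (e al) (e al)" "ip nu g > 0" "nu \<noteq> g"
      then have gP: "g \<in> Phi" by (auto dest: layerD)
      have "p nu g = 1" using * gP by (intro pair_eq_1) auto
      then have "refl g nu = nu - g" by (auto simp: refl_def)
      then show "ip (nu - g) (nu - g) = ip (e al) (e al)" using ip_refl[OF gP, of nu nu] * by simp
    qed
    then show ?thesis by (metis order_refl)
  qed (use mu in auto)
qed

definition adjacent :: "('b \<Rightarrow> int) \<Rightarrow> ('b \<Rightarrow> int) \<Rightarrow> bool"
  where "adjacent g h \<longleftrightarrow> g \<in> layer 1 \<and> h \<in> layer 1 \<and> g + h \<in> Phi \<and> ip g g = ip h h"

definition valency :: "('b \<Rightarrow> int) \<Rightarrow> nat"
  where "valency g = card {h. adjacent g h}"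

lemma finite_adjacent: "finite {h. adjacent g h}"
  by (rule finite_subset[OF _ finite_layer[of 1]]) (auto simp: adjacent_def)

lemma adjacent_refl:
  assumes b: "b \<in> B - {al}" and "adjacent g h"
  shows "adjacent (refl (e b) g) (refl (e b) h)"
proof -
  have eb: "e b \<in> Phi" using b simple_in by auto
  have "refl (e b) g + refl (e b) h = refl (e b) (g + h)"
    by (auto simp: refl_def pair_add algebra_simps)
  then show ?thesis
    using assms refl_layer[OF b] refl_in[OF _ eb] ip_refl_simple[OF b] by (auto simp: adjacent_def)
qed

lemma valency_refl:
  assumes b: "b \<in> B - {al}"
  shows "valency (refl (e b) g) = valency g"
proof -
  have eb: "e b \<in> Phi" using b simple_in by auto
  have "bij_betw (refl (e b)) {h. adjacent (refl (e b) g) h} {h. adjacent g h}"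
    by (rule bij_betw_byWitness[of _ "refl (e b)"])
      (use adjacent_refl[OF b] refl_refl[OF eb] in \<open>force+\<close>)
  then show ?thesis unfolding valency_def by (rule bij_betw_same_card)
qed

lemma valency_eq: "adjacent g h \<Longrightarrow> valency g = valency h"
  using invariant_constant_on_norm_class[of valency g h] valency_refl by (auto simp: adjacent_def)

text \<open>
  For \<open>mu\<close> in the second layer and at least as long as \<open>g\<close>, a positive pairing makes \<open>mu - g\<close> the
  negative of the reflection of \<open>g\<close>, hence a neighbour of \<open>g\<close> of the same norm.
\<close>
lemma valency_pos:
  assumes g0: "g0 \<in> layer 1" and ne: "layer 2 \<noteq> {}"
  shows "valency g0 > 0"
proof -
  obtain mu where mu: "mu \<in> layer 2" "ip (e al) (e al) \<le> ip mu mu" using long_in_layer2[OF ne] by blast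
  then have muPhi: "mu \<in> Phi" "mu al = 2" by (auto dest: layerD)
  obtain g where g: "g \<in> layer 1" "ip g g = ip g0 g0" "ip g mu > 0"
    using norm_class_meets_halfspace[OF g0, of mu] muPhi by auto
  then have gPhi: "g \<in> Phi" "g al = 1" by (auto dest: layerD)
  have "p g mu = 1"
    using norm_layer1_le[OF g(1)] mu g gPhi muPhi by (intro pair_eq_1) auto
  then have r: "mu - g = - refl mu g" by (auto simp: refl_def)
  then have "mu - g \<in> Phi" using neg_in[OF refl_in[OF gPhi(1) muPhi(1)]] by simp
  moreover have "ip (mu - g) (mu - g) = ip g g"
    unfolding r using ip_refl[OF muPhi(1), of g g] by (simp add: ip_neg ip_neg_right)
  ultimately have "adjacent g (mu - g)"
    using g gPhi muPhi by (auto simp: adjacent_def layer_def)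
  then have "valency g > 0" unfolding valency_def using finite_adjacent by (auto simp: card_gt_0_iff)
  moreover have "valency g = valency g0"
    using invariant_constant_on_norm_class[of valency g g0] valency_refl g g0 by auto
  ultimately show ?thesis by simp
qed

text \<open>
  The graph joining roots of equal norm whose sum is a root is regular of positive degree on each
  norm class, and an independent set in a regular graph contains at most half of the vertices.
\<close>
theorem independent_set_le_half:
  assumes A: "A \<subseteq> layer 1" and indep: "\<And>g h. g \<in> A \<Longrightarrow> h \<in> A \<Longrightarrow> g \<noteq> h \<Longrightarrow> g + h \<notin> Phi"
    and ne: "layer 2 \<noteq> {}"
  shows "2 * card A \<le> card (layer 1)"
proof -
  let ?X = "layer 1"
  \<comment> \<open>The ends of an edge have equal valency, so these weights are symmetric and sum to 1 at each root.\<close>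
  define w :: "('b \<Rightarrow> int) \<Rightarrow> ('b \<Rightarrow> int) \<Rightarrow> real"
    where "w g h = (if adjacent g h then 1 / real (valency g) else 0)" for g h
  have sym: "adjacent g h \<longleftrightarrow> adjacent h g" for g h by (auto simp: adjacent_def add.commute)
  have w_sym: "w g h = w h g" for g h using sym[of g h] valency_eq[of g h] by (simp add: w_def)
  have total: "(\<Sum>h\<in>?X. w g h) = 1" if "g \<in> ?X" for g
  proof -
    have "(\<Sum>h\<in>?X. w g h) = (\<Sum>h\<in>{h. adjacent g h}. 1 / real (valency g))"
      unfolding w_def using finite_layer
      by (intro sum.mono_neutral_cong_right) (auto simp: adjacent_def)
    also have "\<dots> = 1" using valency_pos[OF that ne] by (simp add: valency_def)
    finally show ?thesis .
  qed
  have finA: "finite A" using A finite_layer finite_subset by blast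
  have inside: "w g h = 0" if "g \<in> A" "h \<in> A" for g h
    using indep[of g h] that double_notin[of g] A by (cases "g = h") (auto simp: w_def adjacent_def dest: layerD)
  have "real (card A) = (\<Sum>g\<in>A. \<Sum>h\<in>?X. w g h)" using total A by (simp add: subset_iff)
  also have "\<dots> = (\<Sum>g\<in>A. \<Sum>h\<in>?X - A. w g h)"
    using A finite_layer inside by (intro sum.cong refl sum.mono_neutral_right) auto
  also have "\<dots> = (\<Sum>h\<in>?X - A. \<Sum>g\<in>A. w h g)" by (subst sum.swap) (simp add: w_sym)
  also have "\<dots> \<le> (\<Sum>h\<in>?X - A. \<Sum>g\<in>?X. w h g)"
    using A finite_layer by (intro sum_mono sum_mono2) (auto simp: w_def)
  also have "\<dots> = real (card (?X - A))" using total by simp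
  also have "card (?X - A) = card ?X - card A" using A finA by (simp add: card_Diff_subset)
  finally have "real (card A) \<le> real (card ?X - card A)" .
  then show ?thesis using card_mono[OF finite_layer A] by linarith
qed

end

section \<open>Generalized weight spaces of a Cartan subalgebra\<close>

context lie_algebra
begin

lemma bracket_zero_left [simp]: "bracket 0 y = 0"
  using bracket_scale_left[of 0 0 y] by simp

lemma bracket_zero_right [simp]: "bracket x 0 = 0"
  using bracket_scale_right[of x 0 0] by simp

lemma bracket_anti: "bracket y x = - bracket x y"
proof -
  have "bracket (x + y) (x + y) = 0" by (rule bracket_self)
  then have "bracket x y + bracket y x = 0"
    unfolding bracket_add_left bracket_add_right by (simp add: bracket_self add.commute)
  then show ?thesis by (simp add: eq_neg_iff_add_eq_0 add.commute)
qed

lemma bracket_neg_right: "bracket x (- y) = - bracket x y"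
  using bracket_scale_right[of x "- 1" y] by simp

lemma bracket_neg_left: "bracket (- x) y = - bracket x y"
  using bracket_scale_left[of "- 1" x y] by simp

lemma bracket_diff_right: "bracket x (y - z) = bracket x y - bracket x z"
  using bracket_add_right[of x y "- z"] by (simp add: bracket_neg_right)

lemma bracket_diff_left: "bracket (x - y) z = bracket x z - bracket y z"
  using bracket_add_left[of x "- y" z] by (simp add: bracket_neg_left)

lemma bracket_derivation: "bracket x (bracket y z) = bracket (bracket x y) z + bracket y (bracket x z)"
  using jacobi[of x y z] bracket_anti[of z "bracket x y"] bracket_anti[of x z]
  by (simp add: bracket_neg_right algebra_simps)

lemma bracket_bracket: "bracket (bracket x y) z = bracket x (bracket y z) - bracket y (bracket x z)"
  using bracket_derivation[of x y z] by simp

end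

locale cartan_setup =
  simple_lie_algebra scale bracket + fin_space scale Basis
  for scale :: "'k::{alg_closed_field, field_char_0} \<Rightarrow> 'g::ab_group_add \<Rightarrow> 'g" (infixr \<open>*s\<close> 75)
    and bracket and Basis +
  fixes T :: "'g set" and B :: "('g \<Rightarrow> 'k) set"
  assumes cartan: "cartan_subalgebra T" and base: "simple_roots T B" and base_nonempty: "B \<noteq> {}"
begin

lemma endo_bracket: "endo (bracket x)"
  by (rule endoI) (simp_all add: bracket_add_right bracket_scale_right)

lemma endo_bracket_left: "endo (\<lambda>x. bracket x y)"
  by (rule endoI) (simp_all add: bracket_add_left bracket_scale_left)

lemma subspace_T: "subspace T"
  using cartan by (simp add: cartan_subalgebra_def lie_subalgebra_def)

lemma T_bracket_closed: "h \<in> T \<Longrightarrow> h' \<in> T \<Longrightarrow> bracket h h' \<in> T"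
  using cartan by (simp add: cartan_subalgebra_def lie_subalgebra_def)

lemma T_normalizer: "normalizer T = T"
  using cartan by (simp add: cartan_subalgebra_def)

lemma root_vector: "\<gamma> \<in> roots T \<Longrightarrow> \<exists>x. x \<noteq> 0 \<and> (\<forall>h\<in>T. bracket h x = \<gamma> h *s x)"
  by (auto simp: roots_def root_space_def)

lemma base_roots: "\<beta> \<in> B \<Longrightarrow> \<beta> \<in> roots T"
  using base by (auto simp: simple_roots_def)

lemma dual_separates:
  assumes x: "x \<in> T" "x \<noteq> 0"
  shows "\<exists>f\<in>dual T. f x \<noteq> 0"
proof -
  let ?E = "extend_basis {x}"
  have ind: "independent {x}" using x by simp
  have E: "independent ?E" "span ?E = UNIV" "x \<in> ?E"
    using independent_extend_basis[OF ind] span_extend_basis[OF ind] extend_basis_superset[OF ind] by simp_all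
  let ?f = "\<lambda>y. if y \<in> T then representation ?E y x else 0"
  have "?f \<in> dual T"
    using subspace_T E unfolding dual_def
    by (auto simp: representation_add representation_scale subspace_add subspace_scale)
  moreover have "?f x \<noteq> 0" using x E by (simp add: representation_basis)
  ultimately show ?thesis by (intro bexI[of _ ?f])
qed

lemma base_separates:
  assumes x: "x \<in> T" and zero: "\<And>\<beta>. \<beta> \<in> B \<Longrightarrow> \<beta> x = 0"
  shows "x = 0"
proof (rule ccontr)
  assume "x \<noteq> 0"
  with x obtain f where f: "f \<in> dual T" "f x \<noteq> 0" using dual_separates by blast
  have "f \<in> functional.span B" using base f by (auto simp: simple_roots_def)
  moreover have "functional.subspace {f. f x = 0}"
    by (rule functional.subspaceI) (auto simp: fscale_def)
  ultimately have "f x = 0"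
    using functional.span_minimal[of B "{f. f x = 0}"] zero by auto
  with f show False by simp
qed

text \<open>A common eigenvector kills commutators, and the roots separate the points of \<open>T\<close>.\<close>

lemma T_abelian: "h \<in> T \<Longrightarrow> h' \<in> T \<Longrightarrow> bracket h h' = 0"
proof (rule base_separates)
  fix \<beta> assume h: "h \<in> T" "h' \<in> T" and \<beta>: "\<beta> \<in> B"
  obtain x where x: "x \<noteq> 0" "\<And>h. h \<in> T \<Longrightarrow> bracket h x = \<beta> h *s x"
    using root_vector[OF base_roots[OF \<beta>]] by blast
  have "\<beta> (bracket h h') *s x = bracket (bracket h h') x" using x(2) T_bracket_closed h by simp
  also have "\<dots> = 0" by (simp add: bracket_bracket x(2) h bracket_scale_right scale_left_commute)
  finally show "\<beta> (bracket h h') = 0" using x(1) by simp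
qed (rule T_bracket_closed)

lemma T_commute: "h \<in> T \<Longrightarrow> h' \<in> T \<Longrightarrow> bracket h (bracket h' x) = bracket h' (bracket h x)"
  using bracket_derivation[of h h' x] T_abelian by simp

definition shift :: "'g \<Rightarrow> 'k \<Rightarrow> 'g \<Rightarrow> 'g"
  where "shift h c x = bracket h x - c *s x"

lemma endo_shift: "endo (shift h c)"
  by (rule endoI) (simp_all add: shift_def bracket_add_right bracket_scale_right algebra_simps)

lemma shift_commute: "h \<in> T \<Longrightarrow> h' \<in> T \<Longrightarrow> shift h c (bracket h' x) = bracket h' (shift h c x)"
  by (simp add: shift_def T_commute[of h h'] bracket_diff_right bracket_scale_right)

lemma shift_shift_commute: "h \<in> T \<Longrightarrow> h' \<in> T \<Longrightarrow> shift h c (shift h' c' x) = shift h' c' (shift h c x)"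
  unfolding shift_def[of h' c'] by (simp add: endo_diff[OF endo_shift] endo_scale[OF endo_shift] shift_commute)

definition gws :: "('g \<Rightarrow> 'k) \<Rightarrow> 'g set"
  where "gws \<gamma> = {x. \<forall>h\<in>T. \<exists>n. (shift h (\<gamma> h) ^^ n) x = 0}"

lemma subspace_gws: "subspace (gws \<gamma>)"
proof -
  have "gws \<gamma> = (\<Inter>h\<in>T. {x. \<exists>n. (shift h (\<gamma> h) ^^ n) x = 0})" by (auto simp: gws_def)
  then show ?thesis using subspace_Int[of T] locally_nilpotent_subspace[OF endo_shift] by simp
qed

lemma gws_bracket_T: "x \<in> gws \<gamma> \<Longrightarrow> h \<in> T \<Longrightarrow> bracket h x \<in> gws \<gamma>"
proof -
  assume x: "x \<in> gws \<gamma>" and h: "h \<in> T"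
  have "\<exists>n. (shift h' (\<gamma> h') ^^ n) (bracket h x) = 0" if h': "h' \<in> T" for h'
  proof -
    obtain n where "(shift h' (\<gamma> h') ^^ n) x = 0" using x h' by (auto simp: gws_def)
    moreover have "(shift h' (\<gamma> h') ^^ n) (bracket h x) = bracket h ((shift h' (\<gamma> h') ^^ n) x)"
      by (rule funpow_comm) (rule shift_commute[OF h' h])
    ultimately show ?thesis by auto
  qed
  then show ?thesis by (simp add: gws_def)
qed

lemma gws_shift: "x \<in> gws \<gamma> \<Longrightarrow> h \<in> T \<Longrightarrow> shift h c x \<in> gws \<gamma>"
  unfolding shift_def by (intro subspace_diff subspace_scale subspace_gws gws_bracket_T)

lemma gws_shift_funpow: "x \<in> gws \<gamma> \<Longrightarrow> h \<in> T \<Longrightarrow> (shift h c ^^ n) x \<in> gws \<gamma>"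
  by (induction n) (auto intro: gws_shift)

text \<open>
  The Leibniz rule: of \<open>m + n\<close> applications of \<open>shift\<close> to a bracket, at least \<open>m\<close> fall on the first
  factor or at least \<open>n\<close> on the second.
\<close>
lemma gws_bracket:
  assumes x: "x \<in> gws \<gamma>" and y: "y \<in> gws \<delta>"
  shows "bracket x y \<in> gws (\<gamma> + \<delta>)"
proof -
  have "(shift h (a + b) ^^ s) (bracket x y) = 0"
    if "m + n = s" "(shift h a ^^ m) x = 0" "(shift h b ^^ n) y = 0" for h a b m n s x y
    using that
  proof (induction s arbitrary: m n x y)
    case (Suc s)
    show ?case
    proof (cases "m = 0 \<or> n = 0")
      case True
      then have "bracket x y = 0" using Suc.prems by auto
      then show ?thesis using endo_zero[OF endo_funpow[OF endo_shift]] by (simp del: funpow.simps)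
    next
      case False
      then obtain m' n' where mn: "m = Suc m'" "n = Suc n'" by (metis not0_implies_Suc)
      have "shift h (a + b) (bracket x y) = bracket (shift h a x) y + bracket x (shift h b y)"
        by (simp add: shift_def bracket_derivation[of h x y] bracket_diff_left bracket_diff_right
            bracket_scale_left bracket_scale_right scale_left_distrib)
      then have "(shift h (a + b) ^^ Suc s) (bracket x y)
        = (shift h (a + b) ^^ s) (bracket (shift h a x) y) + (shift h (a + b) ^^ s) (bracket x (shift h b y))"
        by (simp only: funpow_Suc_right o_apply endo_add[OF endo_funpow[OF endo_shift]])
      also have "\<dots> = 0"
        using Suc.IH[of m' n "shift h a x" y] Suc.IH[of m n' x "shift h b y"] Suc.prems mn
        by (simp add: funpow_swap1)
      finally show ?thesis .
    qed
  qed auto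
  note kills = this
  show ?thesis
    unfolding gws_def mem_Collect_eq plus_fun_apply
  proof
    fix h assume h: "h \<in> T"
    obtain m n where "(shift h (\<gamma> h) ^^ m) x = 0" "(shift h (\<delta> h) ^^ n) y = 0"
      using x y h unfolding gws_def by blast
    from kills[OF refl this] show "\<exists>n. (shift h (\<gamma> h + \<delta> h) ^^ n) (bracket x y) = 0" ..
  qed
qed

subsection \<open>The decomposition\<close>

lemma two_eigenvalues:
  assumes ne: "a \<noteq> c" and "(shift h a ^^ n) x = 0" "(shift h c ^^ m) x = 0" "h \<in> T"
  shows "x = 0"
  using assms(2,3)
proof (induction m arbitrary: x)
  case (Suc m)
  let ?y = "shift h c x"
  have "(shift h a ^^ n) ?y = shift h c ((shift h a ^^ n) x)"
    by (rule funpow_comm) (simp add: shift_shift_commute assms(4))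
  then have "(shift h a ^^ n) ?y = 0" using Suc.prems(1) by (simp add: endo_zero[OF endo_shift])
  moreover have "(shift h c ^^ m) ?y = 0" using Suc.prems(2) by (simp add: funpow_swap1)
  ultimately have "?y = 0" by (rule Suc.IH)
  then have step: "shift h a x = (c - a) *s x" by (simp add: shift_def scale_left_diff_distrib)
  have "(shift h a ^^ k) x = (c - a) ^ k *s x" for k
    by (induction k) (simp_all add: step endo_scale[OF endo_shift] mult.commute)
  with Suc.prems(1) ne show ?case by simp
qed simp

definition T_invariant :: "'g set \<Rightarrow> bool"
  where "T_invariant V \<longleftrightarrow> subspace V \<and> (\<forall>h\<in>T. \<forall>x\<in>V. bracket h x \<in> V)"

lemma T_invariant_shift: "T_invariant V \<Longrightarrow> h \<in> T \<Longrightarrow> x \<in> V \<Longrightarrow> shift h c x \<in> V"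
  by (simp add: T_invariant_def shift_def subspace_diff subspace_scale)

lemma T_invariant_shift_funpow: "T_invariant V \<Longrightarrow> h \<in> T \<Longrightarrow> x \<in> V \<Longrightarrow> (shift h c ^^ n) x \<in> V"
  by (induction n) (auto intro: T_invariant_shift)

lemma dim_smaller: "subspace V \<Longrightarrow> subspace V' \<Longrightarrow> V' \<subset> V \<Longrightarrow> dim V' < dim V"
  using dim_psubset[of V' V] by (metis span_eq_iff)

text \<open>
  If some element of \<open>T\<close> has more than one eigenvalue on \<open>V\<close>, Fitting's lemma splits \<open>V\<close> into two
  smaller invariant parts; otherwise \<open>V\<close> lies in one generalized weight space.
\<close>
lemma gws_decomposition_exists:
  assumes "T_invariant V"
  shows "\<exists>F. finite F \<and> (\<forall>\<gamma>\<in>F. \<forall>x. x \<notin> T \<longrightarrow> \<gamma> x = 0) \<and> V \<subseteq> span (\<Union>\<gamma>\<in>F. gws \<gamma>)"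
  using assms
proof (induction "dim V" arbitrary: V rule: less_induct)
  case less
  have V: "subspace V" using less.prems by (simp add: T_invariant_def)
  show ?case
  proof (cases "\<forall>h\<in>T. \<exists>c. \<forall>x\<in>V. \<exists>n. (shift h c ^^ n) x = 0")
    case True
    then obtain c where c: "\<And>h x. h \<in> T \<Longrightarrow> x \<in> V \<Longrightarrow> \<exists>n. (shift h (c h) ^^ n) x = 0" by metis
    let ?\<gamma> = "\<lambda>h. if h \<in> T then c h else 0"
    have "V \<subseteq> gws ?\<gamma>" using c by (auto simp: gws_def)
    then show ?thesis using span_superset by (intro exI[of _ "{?\<gamma>}"]) auto
  next
    case False
    then obtain h where h: "h \<in> T" and no: "\<And>c. \<exists>x\<in>V. \<forall>n. (shift h c ^^ n) x \<noteq> 0" by auto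
    have "V \<noteq> {0}" using no[of 0] by (auto dest: spec[of _ "0::nat"])
    moreover have "bracket h ` V \<subseteq> V" using less.prems h by (auto simp: T_invariant_def)
    ultimately obtain c v where v: "v \<in> V" "v \<noteq> 0" "bracket h v = c *s v"
      using eigenvector_exists[OF alg_closed_imp_poly_has_root endo_bracket V] by metis
    let ?f = "shift h c"
    have fV: "?f ` V \<subseteq> V" using T_invariant_shift[OF less.prems h] by auto
    obtain n where n: "(?f ^^ n) ` V \<subseteq> ?f ` ((?f ^^ n) ` V)"
      and split: "\<And>x. x \<in> V \<Longrightarrow> \<exists>y\<in>(?f ^^ n) ` V. (?f ^^ n) (x - y) = 0"
      using fitting[OF endo_shift V fV] by blast
    let ?V0 = "{x \<in> V. (?f ^^ n) x = 0}" and ?V1 = "(?f ^^ n) ` V"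
    have comm: "(?f ^^ n) (bracket h' x) = bracket h' ((?f ^^ n) x)" if "h' \<in> T" for h' x
      by (rule funpow_comm) (simp add: shift_commute h that)
    have sub0: "subspace ?V0"
      using subspace_inter[OF V endo_kernel_subspace[OF endo_funpow[OF endo_shift]]]
      by (simp add: Int_def)
    have inv0: "T_invariant ?V0"
      using sub0 less.prems comm unfolding T_invariant_def by (auto simp: endo_zero[OF endo_bracket])
    have sub1: "subspace ?V1" by (rule endo_image_subspace[OF endo_funpow[OF endo_shift] V])
    have inv1: "T_invariant ?V1"
      unfolding T_invariant_def
    proof (intro conjI ballI sub1)
      fix h' x assume h': "h' \<in> T" "x \<in> ?V1"
      then obtain z where "z \<in> V" "x = (?f ^^ n) z" by blast
      then have "bracket h' x = (?f ^^ n) (bracket h' z)" "bracket h' z \<in> V"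
        using comm[OF h'(1)] less.prems h' by (auto simp: T_invariant_def)
      then show "bracket h' x \<in> ?V1" by blast
    qed
    have V1V: "?V1 \<subseteq> V" using T_invariant_shift_funpow[OF less.prems h] by auto
    have "?V0 \<noteq> V" using no[of c] by blast
    then have lt0: "dim ?V0 < dim V" using sub0 V by (intro dim_smaller) auto
    have "?V1 \<noteq> V"
    proof
      assume "?V1 = V"
      then have "V \<subseteq> ?f ` V" using n by simp
      then have "v = 0"
        using surjective_on_imp_kernel_trivial[OF endo_shift V _ v(1)] v(3) by (simp add: shift_def)
      with v show False by simp
    qed
    then have lt1: "dim ?V1 < dim V" using sub1 V V1V by (intro dim_smaller) auto
    obtain F0 where F0: "finite F0" "\<forall>\<gamma>\<in>F0. \<forall>x. x \<notin> T \<longrightarrow> \<gamma> x = 0" "?V0 \<subseteq> span (\<Union>\<gamma>\<in>F0. gws \<gamma>)"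
      using less.hyps[OF lt0 inv0] by blast
    obtain F1 where F1: "finite F1" "\<forall>\<gamma>\<in>F1. \<forall>x. x \<notin> T \<longrightarrow> \<gamma> x = 0" "?V1 \<subseteq> span (\<Union>\<gamma>\<in>F1. gws \<gamma>)"
      using less.hyps[OF lt1 inv1] by blast
    let ?S = "span (\<Union>\<gamma>\<in>F0 \<union> F1. gws \<gamma>)"
    have in0: "?V0 \<subseteq> ?S"
      using F0(3) span_mono[of "\<Union>\<gamma>\<in>F0. gws \<gamma>" "\<Union>\<gamma>\<in>F0 \<union> F1. gws \<gamma>"] by blast
    have in1: "?V1 \<subseteq> ?S"
      using F1(3) span_mono[of "\<Union>\<gamma>\<in>F1. gws \<gamma>" "\<Union>\<gamma>\<in>F0 \<union> F1. gws \<gamma>"] by blast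
    have "V \<subseteq> ?S"
    proof
      fix x assume x: "x \<in> V"
      then obtain y where y: "y \<in> ?V1" "(?f ^^ n) (x - y) = 0" using split by blast
      then have "x - y \<in> ?V0" using x V1V V by (auto intro: subspace_diff)
      then have "x - y + y \<in> ?S" using in0 in1 y(1) by (intro span_add) auto
      then show "x \<in> ?S" by simp
    qed
    then show ?thesis using F0 F1 by (intro exI[of _ "F0 \<union> F1"]) auto
  qed
qed

text \<open>
  A power of \<open>shift h (\<delta> h)\<close> removes the \<open>\<delta>\<close> term and is injective on the terms whose weight
  differs from \<open>\<delta>\<close> at \<open>h\<close>.
\<close>
lemma gws_direct:
  assumes "finite F" "\<And>\<gamma> x. \<gamma> \<in> F \<Longrightarrow> x \<notin> T \<Longrightarrow> \<gamma> x = 0" "\<And>\<gamma>. \<gamma> \<in> F \<Longrightarrow> y \<gamma> \<in> gws \<gamma>"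
    "(\<Sum>\<gamma>\<in>F. y \<gamma>) = 0" "\<gamma> \<in> F"
  shows "y \<gamma> = 0"
  using assms
proof (induction F arbitrary: y \<gamma> rule: finite_induct)
  case (insert \<delta> F)
  have F_zero: "y \<epsilon> = 0" if \<epsilon>: "\<epsilon> \<in> F" for \<epsilon>
  proof -
    have "\<epsilon> \<noteq> \<delta>" using insert.hyps \<epsilon> by auto
    then obtain h where "\<epsilon> h \<noteq> \<delta> h" by auto
    then have h: "h \<in> T" "\<delta> h \<noteq> \<epsilon> h" using insert.prems(1)[of \<epsilon> h] insert.prems(1)[of \<delta> h] \<epsilon> by fastforce+
    obtain n where n: "(shift h (\<delta> h) ^^ n) (y \<delta>) = 0"
      using insert.prems(2)[of \<delta>] h by (auto simp: gws_def)
    let ?g = "shift h (\<delta> h) ^^ n"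
    have "?g (\<Sum>\<gamma>\<in>insert \<delta> F. y \<gamma>) = 0"
      using insert.prems(3) endo_zero[OF endo_funpow[OF endo_shift]] by simp
    then have "(\<Sum>\<gamma>\<in>F. ?g (y \<gamma>)) = 0"
      using insert.hyps n by (simp add: endo_sum[OF endo_funpow[OF endo_shift]] endo_add[OF endo_funpow[OF endo_shift]])
    then have g0: "?g (y \<epsilon>) = 0"
      using insert.IH[of "\<lambda>\<gamma>. ?g (y \<gamma>)" \<epsilon>] insert.prems(1,2) gws_shift_funpow h(1) \<epsilon> by auto
    obtain m where "(shift h (\<epsilon> h) ^^ m) (y \<epsilon>) = 0" using insert.prems(2)[of \<epsilon>] \<epsilon> h by (auto simp: gws_def)
    with g0 show ?thesis using two_eigenvalues[OF h(2)] h(1) by blast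
  qed
  then have "y \<delta> = 0" using insert.prems(3) insert.hyps by simp
  with F_zero insert.prems show ?case by auto
qed simp

text \<open>
  The weights, extended by zero outside \<open>T\<close> like the members of \<open>dual T\<close>.
\<close>
definition W :: "('g \<Rightarrow> 'k) set"
  where "W = {\<gamma>. (\<forall>x. x \<notin> T \<longrightarrow> \<gamma> x = 0) \<and> gws \<gamma> \<noteq> {0}}"

lemma W_decomposition: "finite W \<and> span (\<Union>\<gamma>\<in>W. gws \<gamma>) = UNIV"
proof -
  have "T_invariant UNIV" by (simp add: T_invariant_def)
  from gws_decomposition_exists[OF this] obtain F where F: "finite F" "\<And>\<gamma> x. \<gamma> \<in> F \<Longrightarrow> x \<notin> T \<Longrightarrow> \<gamma> x = 0"
    "span (\<Union>\<gamma>\<in>F. gws \<gamma>) = UNIV" by blast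
  have "W \<subseteq> F"
  proof
    fix \<delta> assume \<delta>: "\<delta> \<in> W"
    show "\<delta> \<in> F"
    proof (rule ccontr)
      assume nF: "\<delta> \<notin> F"
      obtain x where x: "x \<in> gws \<delta>" "x \<noteq> 0" using \<delta> subspace_0[OF subspace_gws] by (auto simp: W_def)
      obtain y where y: "\<And>\<gamma>. \<gamma> \<in> F \<Longrightarrow> y \<gamma> \<in> gws \<gamma>" "x = (\<Sum>\<gamma>\<in>F. y \<gamma>)"
        using span_UN_eq_sum[OF F(1), of gws x] subspace_gws F(3) by auto
      let ?y = "\<lambda>\<gamma>. if \<gamma> = \<delta> then - x else y \<gamma>"
      have "(\<Sum>\<gamma>\<in>F. ?y \<gamma>) = (\<Sum>\<gamma>\<in>F. y \<gamma>)" using nF by (intro sum.cong) auto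
      then have "(\<Sum>\<gamma>\<in>insert \<delta> F. ?y \<gamma>) = 0" using nF F(1) y(2) by simp
      then have "?y \<delta> = 0"
        using F(2) \<delta> x y(1) by (intro gws_direct[of "insert \<delta> F" ?y]) (auto simp: F(1) W_def subspace_neg subspace_gws)
      with x show False by simp
    qed
  qed
  then have "finite W" using F(1) finite_subset by blast
  moreover have "(\<Union>\<gamma>\<in>F. gws \<gamma>) \<subseteq> span (\<Union>\<gamma>\<in>W. gws \<gamma>)"
  proof
    fix x assume "x \<in> (\<Union>\<gamma>\<in>F. gws \<gamma>)"
    then obtain \<gamma> where \<gamma>: "\<gamma> \<in> F" "x \<in> gws \<gamma>" by blast
    show "x \<in> span (\<Union>\<gamma>\<in>W. gws \<gamma>)"
    proof (cases "gws \<gamma> = {0}")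
      case True
      then show ?thesis using \<gamma> span_zero by simp
    next
      case False
      then have "\<gamma> \<in> W" using F(2) \<gamma> by (auto simp: W_def)
      then show ?thesis using \<gamma> by (intro span_base) auto
    qed
  qed
  then have "span (\<Union>\<gamma>\<in>F. gws \<gamma>) \<subseteq> span (\<Union>\<gamma>\<in>W. gws \<gamma>)" by (intro span_minimal) auto
  ultimately show ?thesis using F(3) by blast
qed

lemma W_outside: "\<gamma> \<in> W \<Longrightarrow> x \<notin> T \<Longrightarrow> \<gamma> x = 0"
  by (simp add: W_def)

sublocale finite_dimensional_decomposition scale W gws Basis
proof unfold_locales
  show "finite W" using W_decomposition by blast
  show "subspace (gws i)" for i by (rule subspace_gws)
  show "x \<in> span (\<Union>i\<in>W. gws i)" for x using W_decomposition by simp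
  show "y i = 0" if "\<And>i. i \<in> W \<Longrightarrow> y i \<in> gws i" "(\<Sum>i\<in>W. y i) = 0" "i \<in> W" for y i
    using gws_direct[of W y i] that W_decomposition W_outside by blast
qed

lemma gws_zero_if_not_weight: "(\<And>x. x \<notin> T \<Longrightarrow> \<gamma> x = 0) \<Longrightarrow> \<gamma> \<notin> W \<Longrightarrow> x \<in> gws \<gamma> \<Longrightarrow> x = 0"
  by (auto simp: W_def)

lemma gws_bracket_not_weight:
  "x \<in> gws \<gamma> \<Longrightarrow> y \<in> gws \<delta> \<Longrightarrow> \<gamma> \<in> W \<Longrightarrow> \<delta> \<in> W \<Longrightarrow> \<gamma> + \<delta> \<notin> W \<Longrightarrow> bracket x y = 0"
  by (rule gws_zero_if_not_weight[of "\<gamma> + \<delta>"]) (auto simp: W_outside gws_bracket)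

text \<open>
  Engel's theorem for commuting operators that act nilpotently on \<open>V\<close> modulo \<open>Z\<close>: as long as some
  operator acts nontrivially modulo \<open>Z\<close>, its kernel there is smaller, nonzero and invariant.
\<close>
lemma common_kernel_exists:
  assumes "T_invariant V" "T_invariant Z" "Z \<subset> V"
    and "\<And>h x. h \<in> T \<Longrightarrow> x \<in> V \<Longrightarrow> \<exists>n. (shift h (\<gamma> h) ^^ n) x \<in> Z"
  shows "\<exists>x\<in>V - Z. \<forall>h\<in>T. shift h (\<gamma> h) x \<in> Z"
  using assms
proof (induction "dim V" arbitrary: V rule: less_induct)
  case less
  show ?case
  proof (cases "\<forall>h\<in>T. \<forall>x\<in>V. shift h (\<gamma> h) x \<in> Z")
    case True
    then show ?thesis using less.prems by blast
  next
    case False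
    then obtain h x0 where h: "h \<in> T" "x0 \<in> V" "shift h (\<gamma> h) x0 \<notin> Z" by blast
    let ?f = "shift h (\<gamma> h)"
    let ?V = "{x \<in> V. ?f x \<in> Z}"
    have V: "subspace V" "subspace Z" using less.prems by (auto simp: T_invariant_def)
    have sub: "subspace ?V"
      using subspace_inter[OF V(1) endo_vimage_subspace[OF endo_shift V(2)]] by (simp add: Int_def)
    have inv: "T_invariant ?V"
      using less.prems(1,2) sub h(1) by (auto simp: T_invariant_def shift_commute)
    have "?V \<subset> V" using h by blast
    then have lt: "dim ?V < dim V" using dim_smaller sub V by blast
    obtain x where x: "x \<in> V" "x \<notin> Z" using less.prems by blast
    obtain n where "(?f ^^ n) x \<in> Z" "\<And>m. m < n \<Longrightarrow> (?f ^^ m) x \<notin> Z"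
      using less.prems(4)[OF h(1) x(1)] exists_least_iff[of "\<lambda>n. (?f ^^ n) x \<in> Z"] by blast
    moreover from this x obtain m where "n = Suc m" by (cases n) auto
    ultimately have "(?f ^^ m) x \<in> ?V - Z"
      using T_invariant_shift_funpow[OF less.prems(1) h(1) x(1)] by auto
    moreover have "Z \<subseteq> ?V" using less.prems T_invariant_shift[OF less.prems(2) h(1)] by blast
    ultimately have "Z \<subset> ?V" by blast
    from less.hyps[OF lt inv less.prems(2) this] less.prems(4)
    show ?thesis by blast
  qed
qed

lemma T_invariant_gws: "T_invariant (gws \<gamma>)"
  by (simp add: T_invariant_def subspace_gws gws_bracket_T)

text \<open>
  Otherwise some vector outside \<open>T\<close> would be killed by \<open>T\<close> modulo \<open>T\<close> and hence normalize \<open>T\<close>.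
\<close>
lemma gws_0: "gws 0 = T"
proof (rule ccontr)
  assume ne: "gws 0 \<noteq> T"
  have "T \<subseteq> gws 0"
    unfolding gws_def by (auto intro!: exI[of _ 1] simp: shift_def T_abelian)
  with ne have ps: "T \<subset> gws 0" by blast
  have "T_invariant T" by (simp add: T_invariant_def subspace_T T_bracket_closed)
  have "\<exists>x\<in>gws 0 - T. \<forall>h\<in>T. shift h ((0 :: 'g \<Rightarrow> 'k) h) x \<in> T"
  proof (rule common_kernel_exists[OF T_invariant_gws \<open>T_invariant T\<close> ps])
    fix h x assume "h \<in> T" "x \<in> gws 0"
    then obtain n where "(shift h ((0 :: 'g \<Rightarrow> 'k) h) ^^ n) x = 0" unfolding gws_def by blast
    then show "\<exists>n. (shift h ((0 :: 'g \<Rightarrow> 'k) h) ^^ n) x \<in> T"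
      using subspace_0[OF subspace_T] by (intro exI[of _ n]) simp
  qed
  then obtain x where x: "x \<notin> T" "\<And>h. h \<in> T \<Longrightarrow> bracket h x \<in> T"
    by (auto simp: shift_def)
  have "x \<in> normalizer T"
    unfolding normalizer_def using x(2) bracket_anti[of x] subspace_neg[OF subspace_T] by force
  with x show False by (simp add: T_normalizer)
qed

lemma weight_vector:
  assumes "\<gamma> \<in> W"
  shows "\<exists>x. x \<noteq> 0 \<and> (\<forall>h\<in>T. bracket h x = \<gamma> h *s x)"
proof -
  have "T_invariant {0}" by (simp add: T_invariant_def)
  moreover have "{0} \<subset> gws \<gamma>" using assms subspace_0[OF subspace_gws] by (auto simp: W_def)
  ultimately have "\<exists>x\<in>gws \<gamma> - {0}. \<forall>h\<in>T. shift h (\<gamma> h) x \<in> {0}"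
    by (intro common_kernel_exists T_invariant_gws) (auto simp: gws_def)
  then show ?thesis by (auto simp: shift_def)
qed

lemma W_dual:
  assumes \<gamma>: "\<gamma> \<in> W"
  shows "\<gamma> \<in> dual T"
proof -
  obtain x where x: "x \<noteq> 0" "\<And>h. h \<in> T \<Longrightarrow> bracket h x = \<gamma> h *s x" using weight_vector[OF \<gamma>] by blast
  have "\<gamma> (h + h') = \<gamma> h + \<gamma> h'" if h: "h \<in> T" "h' \<in> T" for h h'
  proof -
    have "\<gamma> (h + h') *s x = (\<gamma> h + \<gamma> h') *s x"
      using x(2)[of "h + h'"] x(2)[of h] x(2)[of h'] h subspace_add[OF subspace_T]
      by (simp add: bracket_add_left scale_left_distrib)
    then show ?thesis using x(1) by simp
  qed
  moreover have "\<gamma> (c *s h) = c * \<gamma> h" if h: "h \<in> T" for c h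
  proof -
    have "\<gamma> (c *s h) *s x = bracket (c *s h) x" using x(2) h subspace_scale[OF subspace_T] by simp
    also have "\<dots> = (c * \<gamma> h) *s x" by (simp add: bracket_scale_left x(2) h)
    finally have "\<gamma> (c *s h) *s x = (c * \<gamma> h) *s x" .
    then show ?thesis using x(1) by (simp only: scale_cancel_right simp_thms)
  qed
  ultimately show ?thesis using \<gamma> by (simp add: dual_def W_def)
qed

lemma dual_add: "\<gamma> \<in> dual T \<Longrightarrow> h \<in> T \<Longrightarrow> h' \<in> T \<Longrightarrow> \<gamma> (h + h') = \<gamma> h + \<gamma> h'"
  by (simp add: dual_def)

lemma dual_scale: "\<gamma> \<in> dual T \<Longrightarrow> h \<in> T \<Longrightarrow> \<gamma> (c *s h) = c * \<gamma> h"
  by (simp add: dual_def)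

lemma roots_W: "roots T \<subseteq> W"
proof
  fix \<gamma> assume \<gamma>: "\<gamma> \<in> roots T"
  obtain x where x: "x \<noteq> 0" "\<And>h. h \<in> T \<Longrightarrow> bracket h x = \<gamma> h *s x" using root_vector[OF \<gamma>] by blast
  have "x \<in> gws \<gamma>" using x(2) by (auto simp: gws_def shift_def intro!: exI[of _ 1])
  then show "\<gamma> \<in> W" using \<gamma> x(1) by (auto simp: W_def roots_def dual_def)
qed

lemma T_nontrivial: "\<exists>h\<in>T. h \<noteq> 0"
proof (rule ccontr)
  assume "\<not> ?thesis"
  then have T: "T = {0}" using subspace_0[OF subspace_T] by auto
  obtain \<beta> where "\<beta> \<in> B" using base_nonempty by blast
  then have "\<beta> \<in> dual T" "\<beta> \<noteq> 0" using base_roots by (auto simp: roots_def)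
  moreover have "\<beta> x = 0" for x
    using calculation(1) dual_scale[of \<beta> 0 0] T by (cases "x = 0") (auto simp: dual_def)
  ultimately show False by auto
qed

lemma zero_W: "0 \<in> W"
  using T_nontrivial by (auto simp: W_def gws_0)

lemma W_eq: "W = insert 0 (roots T)"
proof -
  have "\<gamma> \<in> roots T" if "\<gamma> \<in> W" "\<gamma> \<noteq> 0" for \<gamma>
    using W_dual[OF that(1)] that(2) weight_vector[OF that(1)] by (force simp: roots_def root_space_def)
  then show ?thesis using roots_W zero_W by blast
qed

section \<open>The Killing form\<close>

definition kappa :: "'g \<Rightarrow> 'g \<Rightarrow> 'k"
  where "kappa x y = trace (\<lambda>z. bracket x (bracket y z))"

lemma endo_bracket2: "endo (\<lambda>z. bracket x (bracket y z))"
  by (rule endo_comp[OF endo_bracket endo_bracket])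

lemma kappa_sym: "kappa x y = kappa y x"
  unfolding kappa_def by (rule trace_comm[OF endo_bracket endo_bracket])

lemma kappa_add: "kappa (x + y) z = kappa x z + kappa y z"
  unfolding kappa_def bracket_add_left by (rule trace_add[OF endo_bracket2 endo_bracket2])

lemma kappa_scale: "kappa (c *s x) z = c * kappa x z"
  unfolding kappa_def bracket_scale_left by (rule trace_scale)

lemma kappa_zero [simp]: "kappa 0 z = 0"
  using kappa_scale[of 0 0 z] by simp

lemma kappa_scale_right: "kappa z (c *s x) = c * kappa z x"
  using kappa_scale[of c x z] by (simp add: kappa_sym[of z])

lemma kappa_add_right: "kappa z (x + y) = kappa z x + kappa z y"
  using kappa_add[of x y z] by (simp add: kappa_sym[of z])

lemma kappa_invariant: "kappa (bracket x y) z = kappa x (bracket y z)"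
proof -
  have "kappa (bracket x y) z
      = trace (\<lambda>u. bracket x (bracket y (bracket z u))) - trace (\<lambda>u. bracket y (bracket x (bracket z u)))"
    unfolding kappa_def bracket_bracket by (rule trace_diff)
  moreover have "kappa x (bracket y z)
      = trace (\<lambda>u. bracket x (bracket y (bracket z u))) - trace (\<lambda>u. bracket x (bracket z (bracket y u)))"
    unfolding kappa_def bracket_bracket bracket_diff_right by (rule trace_diff)
  moreover have "trace (\<lambda>u. bracket y (bracket x (bracket z u))) = trace (\<lambda>u. bracket x (bracket z (bracket y u)))"
    by (rule trace_comm[OF endo_bracket endo_bracket2])
  ultimately show ?thesis by simp
qed

lemma diag_commute:
  assumes f: "endo f" and "\<And>\<gamma> x. \<gamma> \<in> W \<Longrightarrow> x \<in> gws \<gamma> \<Longrightarrow> f x \<in> gws \<gamma>"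
  shows "diag a (f x) = f (diag a x)"
  by (rule endo_eqI[OF endo_comp[OF diag_endo f] endo_comp[OF f diag_endo]])
    (simp add: diag_of_member assms(2) endo_scale[OF f])

text \<open>
  For \<open>h\<close> in \<open>T\<close> this is the nilpotent part in the Jordan decomposition of the action of \<open>h\<close>.
\<close>
definition nilpart :: "'g \<Rightarrow> 'g \<Rightarrow> 'g"
  where "nilpart h x = bracket h x - diag (\<lambda>\<gamma>. \<gamma> h) x"

lemma endo_nilpart: "endo (nilpart h)"
  unfolding nilpart_def
  by (rule endoI)
    (simp_all add: bracket_add_right bracket_scale_right endo_add[OF diag_endo] endo_scale[OF diag_endo] algebra_simps)

lemma nilpart_of_member: "\<gamma> \<in> W \<Longrightarrow> x \<in> gws \<gamma> \<Longrightarrow> nilpart h x = shift h (\<gamma> h) x"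
  by (simp add: nilpart_def shift_def diag_of_member)

lemma nilpart_gws: "h \<in> T \<Longrightarrow> \<gamma> \<in> W \<Longrightarrow> x \<in> gws \<gamma> \<Longrightarrow> nilpart h x \<in> gws \<gamma>"
  by (simp add: nilpart_of_member gws_shift)

lemma nilpart_locally_nilpotent:
  assumes h: "h \<in> T"
  shows "\<exists>n. (nilpart h ^^ n) x = 0"
proof -
  let ?S = "{x. \<exists>n. (nilpart h ^^ n) x = 0}"
  have "(\<Union>\<gamma>\<in>W. gws \<gamma>) \<subseteq> ?S"
  proof
    fix x assume "x \<in> (\<Union>\<gamma>\<in>W. gws \<gamma>)"
    then obtain \<gamma> where \<gamma>: "\<gamma> \<in> W" "x \<in> gws \<gamma>" by blast
    have "(nilpart h ^^ n) x = (shift h (\<gamma> h) ^^ n) x" for n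
      by (induction n) (simp_all add: nilpart_of_member[OF \<gamma>(1) gws_shift_funpow[OF \<gamma>(2) h]])
    then show "x \<in> ?S" using \<gamma> h by (auto simp: gws_def)
  qed
  then have "span (\<Union>\<gamma>\<in>W. gws \<gamma>) \<subseteq> ?S" by (intro span_minimal locally_nilpotent_subspace endo_nilpart)
  then show ?thesis using spanning by blast
qed

lemma trace_nilpart_commuting:
  assumes h: "h \<in> T" and f: "endo f" and comm: "\<And>x. f (nilpart h x) = nilpart h (f x)"
  shows "trace (\<lambda>x. nilpart h (f x)) = 0"
proof (rule trace_nilpotent)
  show "endo (\<lambda>x. nilpart h (f x))" by (rule endo_comp[OF endo_nilpart f])
  fix x
  have "((\<lambda>x. nilpart h (f x)) ^^ n) x = (f ^^ n) ((nilpart h ^^ n) x)" for n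
  proof (induction n arbitrary: x)
    case (Suc n)
    have "((\<lambda>x. nilpart h (f x)) ^^ Suc n) x = (f ^^ n) ((nilpart h ^^ n) (nilpart h (f x)))"
      unfolding funpow_Suc_right o_apply Suc.IH ..
    also have "\<dots> = (f ^^ n) (f ((nilpart h ^^ Suc n) x))"
      using funpow_comm[of "nilpart h" f "Suc n" x] comm by (simp add: funpow_swap1)
    finally show ?case by (simp add: funpow_swap1)
  qed simp
  moreover obtain n where "(nilpart h ^^ n) x = 0" using nilpart_locally_nilpotent[OF h] by blast
  ultimately have "((\<lambda>x. nilpart h (f x)) ^^ n) x = 0" using endo_zero[OF endo_funpow[OF f]] by simp
  then show "\<exists>n. ((\<lambda>x. nilpart h (f x)) ^^ n) x = 0" ..
qed

lemma trace_diag_bracket: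
  assumes t: "t \<in> T"
  shows "trace (\<lambda>x. diag a (bracket t x)) = (\<Sum>\<gamma>\<in>W. a \<gamma> * \<gamma> t * of_nat (dim (gws \<gamma>)))"
proof -
  have comm: "diag a (nilpart t x) = nilpart t (diag a x)" for x
    by (rule diag_commute[OF endo_nilpart]) (rule nilpart_gws[OF t])
  have "diag a (bracket t x) = nilpart t (diag a x) + diag (\<lambda>\<gamma>. a \<gamma> * \<gamma> t) x" for x
  proof -
    have "diag a (diag (\<lambda>\<gamma>. \<gamma> t) x) = diag (\<lambda>\<gamma>. a \<gamma> * \<gamma> t) x"
      by (rule endo_eqI[OF endo_comp[OF diag_endo diag_endo] diag_endo])
        (simp add: diag_of_member endo_scale[OF diag_endo] mult.commute)
    then show ?thesis
      using comm[of x] by (simp add: nilpart_def endo_diff[OF diag_endo] diff_eq_eq)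
  qed
  then have "trace (\<lambda>x. diag a (bracket t x)) = trace (\<lambda>x. nilpart t (diag a x)) + trace (diag (\<lambda>\<gamma>. a \<gamma> * \<gamma> t))"
    using trace_add[OF endo_comp[OF endo_nilpart diag_endo] diag_endo] by simp
  then show ?thesis
    using trace_nilpart_commuting[OF t diag_endo comm] by (simp add: trace_diag)
qed

lemma kappa_T:
  assumes t: "t \<in> T"
  shows "kappa t t = (\<Sum>\<gamma>\<in>W. \<gamma> t * \<gamma> t * of_nat (dim (gws \<gamma>)))"
proof -
  have comm: "bracket t (nilpart t x) = nilpart t (bracket t x)" for x
    unfolding nilpart_def
    using diag_commute[OF endo_bracket, of t] gws_bracket_T[OF _ t] by (simp add: bracket_diff_right)
  have "bracket t (bracket t x) = nilpart t (bracket t x) + diag (\<lambda>\<gamma>. \<gamma> t) (bracket t x)" for x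
    by (simp add: nilpart_def)
  then have "kappa t t = trace (\<lambda>x. nilpart t (bracket t x)) + trace (\<lambda>x. diag (\<lambda>\<gamma>. \<gamma> t) (bracket t x))"
    unfolding kappa_def
    using trace_add[OF endo_comp[OF endo_nilpart endo_bracket] endo_comp[OF diag_endo endo_bracket], of t t] by simp
  then show ?thesis
    using trace_nilpart_commuting[OF t endo_bracket comm] trace_diag_bracket[OF t] by simp
qed

text \<open>
  For a function on the weights that is periodic modulo \<open>\<gamma>\<close>, the corresponding diagonal operator
  commutes with the action of \<open>x\<close>, so its product with the commutator of the actions of \<open>x\<close> and
  \<open>y\<close> is again a commutator.
\<close>
lemma trace_string:
  assumes \<gamma>: "\<gamma> \<in> W" and x: "x \<in> gws \<gamma>"
    and periodic: "\<And>\<epsilon>. \<epsilon> \<in> W \<Longrightarrow> \<epsilon> + \<gamma> \<in> W \<Longrightarrow> a (\<epsilon> + \<gamma>) = a \<epsilon>"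
  shows "trace (\<lambda>z. diag a (bracket (bracket x y) z)) = 0"
proof -
  have comm: "diag a (bracket x z) = bracket x (diag a z)" for z
  proof (rule endo_eqI[OF endo_comp[OF diag_endo endo_bracket] endo_comp[OF endo_bracket diag_endo]])
    fix \<epsilon> u assume \<epsilon>: "\<epsilon> \<in> W" "u \<in> gws \<epsilon>"
    show "diag a (bracket x u) = bracket x (diag a u)"
    proof (cases "\<epsilon> + \<gamma> \<in> W")
      case True
      have "bracket x u \<in> gws (\<epsilon> + \<gamma>)" using gws_bracket[OF x \<epsilon>(2)] by (simp add: add.commute)
      then show ?thesis using True \<epsilon> periodic by (simp add: diag_of_member bracket_scale_right)
    next
      case False
      then have "bracket x u = 0" using gws_bracket_not_weight[OF x \<epsilon>(2) \<gamma> \<epsilon>(1)] by (simp add: add.commute)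
      then show ?thesis using \<epsilon> by (simp add: diag_of_member bracket_scale_right endo_zero[OF diag_endo])
    qed
  qed
  have "trace (\<lambda>z. diag a (bracket (bracket x y) z))
    = trace (\<lambda>z. diag a (bracket x (bracket y z))) - trace (\<lambda>z. diag a (bracket y (bracket x z)))"
    unfolding bracket_bracket endo_diff[OF diag_endo] by (rule trace_diff)
  also have "trace (\<lambda>z. diag a (bracket x (bracket y z))) = trace (\<lambda>z. bracket x (diag a (bracket y z)))"
    by (simp add: comm)
  also have "\<dots> = trace (\<lambda>z. diag a (bracket y (bracket x z)))"
    by (rule trace_comm[OF endo_bracket endo_comp[OF diag_endo endo_bracket]])
  finally show ?thesis by simp
qed

lemma dim_gws_pos: "\<gamma> \<in> W \<Longrightarrow> dim (gws \<gamma>) > 0"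
  using subspace_0[OF subspace_gws, of \<gamma>] by (auto simp: W_def dim_eq_0 intro!: Nat.gr0I)

text \<open>Cartan's rationality argument: the trace over the \<open>\<gamma>\<close>-string through \<open>\<delta>\<close> vanishes.\<close>

lemma weight_rational_multiple:
  assumes \<gamma>: "\<gamma> \<in> W" and x: "x \<in> gws \<gamma>" and t: "bracket x y \<in> T" and \<delta>: "\<delta> \<in> W"
  shows "\<exists>q::rat. \<delta> (bracket x y) = of_rat q * \<gamma> (bracket x y)"
proof -
  let ?t = "bracket x y"
  let ?str = "{\<epsilon>. \<exists>k::int. \<epsilon> = \<delta> + fscale (of_int k) \<gamma>}"
  \<comment> \<open>The diagonal operator of \<open>?a\<close> is the projection to the string.\<close>
  let ?a = "\<lambda>\<epsilon>. if \<epsilon> \<in> ?str then 1 else (0::'k)"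
  have "\<epsilon> + \<gamma> \<in> ?str \<longleftrightarrow> \<epsilon> \<in> ?str" for \<epsilon>
  proof
    assume "\<epsilon> \<in> ?str"
    then obtain k where "\<epsilon> = \<delta> + fscale (of_int k) \<gamma>" by blast
    then have "\<epsilon> + \<gamma> = \<delta> + fscale (of_int (k + 1)) \<gamma>" by (simp add: fscale_def fun_eq_iff algebra_simps)
    then show "\<epsilon> + \<gamma> \<in> ?str" by blast
  next
    assume "\<epsilon> + \<gamma> \<in> ?str"
    then obtain k where "\<epsilon> + \<gamma> = \<delta> + fscale (of_int k) \<gamma>" by blast
    then have "\<epsilon> = \<delta> + fscale (of_int (k - 1)) \<gamma>" by (simp add: fscale_def fun_eq_iff algebra_simps)
    then show "\<epsilon> \<in> ?str" by blast
  qed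
  then have "trace (\<lambda>z. diag ?a (bracket ?t z)) = 0" by (intro trace_string[OF \<gamma> x]) simp
  then have sum0: "(\<Sum>\<epsilon>\<in>W. ?a \<epsilon> * \<epsilon> ?t * of_nat (dim (gws \<epsilon>))) = 0"
    using trace_diag_bracket[OF t] by simp
  let ?S = "W \<inter> ?str"
  have "\<forall>\<epsilon>\<in>?S. \<exists>k::int. \<epsilon> = \<delta> + fscale (of_int k) \<gamma>" by blast
  then obtain k where k: "\<And>\<epsilon>. \<epsilon> \<in> ?S \<Longrightarrow> \<epsilon> = \<delta> + fscale (of_int (k \<epsilon>)) \<gamma>" by metis
  have val: "\<epsilon> ?t = \<delta> ?t + of_int (k \<epsilon>) * \<gamma> ?t" if "\<epsilon> \<in> ?S" for \<epsilon>
    using arg_cong[OF k[OF that], of "\<lambda>f. f ?t"] by (simp add: fscale_def)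
  have "(\<Sum>\<epsilon>\<in>?S. (\<delta> ?t + of_int (k \<epsilon>) * \<gamma> ?t) * of_nat (dim (gws \<epsilon>)))
      = (\<Sum>\<epsilon>\<in>?S. ?a \<epsilon> * \<epsilon> ?t * of_nat (dim (gws \<epsilon>)))"
    by (intro sum.cong refl) (use val in auto)
  also have "\<dots> = (\<Sum>\<epsilon>\<in>W. ?a \<epsilon> * \<epsilon> ?t * of_nat (dim (gws \<epsilon>)))"
    using finite_W by (intro sum.mono_neutral_left) auto
  also have "\<dots> = 0" by (rule sum0)
  finally have "of_nat (\<Sum>\<epsilon>\<in>?S. dim (gws \<epsilon>)) * \<delta> ?t + of_int (\<Sum>\<epsilon>\<in>?S. k \<epsilon> * int (dim (gws \<epsilon>))) * \<gamma> ?t = 0"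
    (is "of_nat ?N * _ + of_int ?K * _ = 0")
    by (simp add: distrib_right sum.distrib sum_distrib_left sum_distrib_right algebra_simps)
  moreover have "?N > 0"
  proof -
    have "\<delta> = \<delta> + fscale (of_int 0) \<gamma>" by (simp add: fscale_def fun_eq_iff)
    then have "\<delta> \<in> ?S" using \<delta> by blast
    moreover have "dim (gws \<delta>) \<le> ?N" using calculation finite_W by (intro member_le_sum) auto
    ultimately show ?thesis using dim_gws_pos[OF \<delta>] by linarith
  qed
  moreover have "d = (- of_int K / of_nat N) * g" if "of_nat N * d + of_int K * g = 0" "N > 0"
    for d g :: 'k and N :: nat and K :: int
  proof -
    have "of_nat N * d = - of_int K * g" using that(1) by (simp add: eq_neg_iff_add_eq_0)
    then show ?thesis using that(2) by (simp add: field_simps)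
  qed
  ultimately have "\<delta> ?t = (- of_int ?K / of_nat ?N) * \<gamma> ?t" by blast
  also have "- of_int ?K / of_nat ?N = (of_rat (- of_int ?K / of_nat ?N) :: 'k)"
    by (simp only: of_rat_divide of_rat_minus of_rat_of_int_eq of_rat_of_nat_eq)
  finally show ?thesis by blast
qed

lemma W_separates: "t \<in> T \<Longrightarrow> (\<And>\<delta>. \<delta> \<in> W \<Longrightarrow> \<delta> t = 0) \<Longrightarrow> t = 0"
  using base_separates roots_W base_roots by blast

lemma commutator_T_zero:
  assumes "\<gamma> \<in> W" "x \<in> gws \<gamma>" "bracket x y \<in> T" "\<gamma> (bracket x y) = 0"
  shows "bracket x y = 0"
  by (rule W_separates) (use weight_rational_multiple assms in fastforce)+

text \<open>
  By rationality the Killing form of the commutator \<open>t\<close> with itself is the square of \<open>\<gamma> t\<close> times a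
  sum of squares of rationals, in which the term of \<open>\<gamma>\<close> is positive.
\<close>
lemma commutator_isotropic_zero:
  assumes \<gamma>: "\<gamma> \<in> W" and x: "x \<in> gws \<gamma>" and t: "bracket x y \<in> T"
    and iso: "kappa (bracket x y) (bracket x y) = 0"
  shows "bracket x y = 0"
proof (rule commutator_T_zero[OF \<gamma> x t])
  let ?t = "bracket x y"
  have "\<forall>\<delta>\<in>W. \<exists>q::rat. \<delta> ?t = of_rat q * \<gamma> ?t" using weight_rational_multiple[OF \<gamma> x t] by blast
  then obtain q where q: "\<And>\<delta>. \<delta> \<in> W \<Longrightarrow> \<delta> ?t = of_rat (q \<delta>) * \<gamma> ?t" by metis
  show "\<gamma> ?t = 0"
  proof (rule ccontr)
    assume ne: "\<gamma> ?t \<noteq> 0"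
    then have "of_rat (q \<gamma>) = (1::'k)" using q[OF \<gamma>] by simp
    then have q1: "q \<gamma> = 1" by (metis of_rat_1 of_rat_eq_iff)
    let ?s = "\<Sum>\<delta>\<in>W. q \<delta> * q \<delta> * of_nat (dim (gws \<delta>))"
    have "kappa ?t ?t = (\<Sum>\<delta>\<in>W. of_rat (q \<delta> * q \<delta> * of_nat (dim (gws \<delta>))) * (\<gamma> ?t * \<gamma> ?t))"
      unfolding kappa_T[OF t] by (intro sum.cong refl) (simp add: q of_rat_mult)
    also have "\<dots> = of_rat ?s * (\<gamma> ?t * \<gamma> ?t)"
      unfolding of_rat_sum sum_distrib_right ..
    finally have "of_rat ?s * (\<gamma> ?t * \<gamma> ?t) = 0" using iso by simp
    then have "?s = 0" using ne by simp
    moreover have "?s > 0"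
      by (rule sum_pos2[OF finite_W \<gamma>]) (simp_all add: q1 dim_gws_pos[OF \<gamma>])
    ultimately show False by simp
  qed
qed

text \<open>
  If the Killing form vanished, all commutators of opposite weight vectors would vanish by the
  preceding lemma. As the algebra is spanned by commutators, this would leave nothing of weight 0.
\<close>
theorem kappa_nondegenerate:
  assumes "\<And>y. kappa x y = 0"
  shows "x = 0"
proof -
  let ?R = "{x. \<forall>y. kappa x y = 0}"
  have "lie_ideal ?R"
    unfolding lie_ideal_def
  proof (intro conjI allI ballI)
    show "subspace ?R" by (rule subspaceI) (auto simp: kappa_add kappa_scale)
    fix x y assume y: "y \<in> ?R"
    have "kappa (bracket y x) z = 0" for z using y kappa_invariant[of y x z] by simp
    then have "kappa (- bracket y x) z = 0" for z using kappa_scale[of "- 1" "bracket y x" z] by simp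
    then show "bracket x y \<in> ?R" using bracket_anti[of x y] by simp
  qed
  moreover have "?R \<noteq> UNIV"
  proof
    assume R: "?R = UNIV"
    let ?D = "span {bracket x y | x y. True}"
    have "lie_ideal ?D" unfolding lie_ideal_def by (auto intro: span_base)
    then have D: "?D = {0} \<or> ?D = UNIV" by (rule lie_ideal_trivial)
    have "?D \<noteq> {0}"
    proof
      assume "?D = {0}"
      then have "bracket x y = 0" for x y using span_base[of "bracket x y" "{bracket x y | x y. True}"] by auto
      then show False using not_abelian by (simp add: abelian_def)
    qed
    with D have D: "?D = UNIV" by blast
    have "component 0 (bracket x y) = 0" for x y
    proof (rule endo_eqI[of "\<lambda>x. component 0 (bracket x y)" "\<lambda>_. 0"])
      show "endo (\<lambda>x. component 0 (bracket x y))" by (rule endo_comp[OF component_endo endo_bracket_left])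
      show zero: "endo (\<lambda>_. 0)" by (rule endoI) auto
      fix \<gamma> x assume \<gamma>: "\<gamma> \<in> W" "x \<in> gws \<gamma>"
      show "component 0 (bracket x y) = 0"
      proof (rule endo_eqI[OF endo_comp[OF component_endo endo_bracket] zero])
        fix \<delta> y assume \<delta>: "\<delta> \<in> W" "y \<in> gws \<delta>"
        have xy: "bracket x y \<in> gws (\<gamma> + \<delta>)" by (rule gws_bracket[OF \<gamma>(2) \<delta>(2)])
        show "component 0 (bracket x y) = 0"
        proof (cases "\<gamma> + \<delta> = 0")
          case True
          then have "bracket x y = 0"
            using commutator_isotropic_zero[OF \<gamma>] xy R gws_0 by auto
          then show ?thesis by (simp add: endo_zero[OF component_endo])
        next
          case False
          show ?thesis
          proof (cases "\<gamma> + \<delta> \<in> W")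
            case True
            then show ?thesis using component_of_member[OF xy] False by auto
          next
            case False
            then show ?thesis
              using gws_bracket_not_weight[OF \<gamma>(2) \<delta>(2) \<gamma>(1) \<delta>(1)] by (simp add: endo_zero[OF component_endo])
          qed
        qed
      qed
    qed
    then have "?D \<subseteq> {z. component 0 z = 0}"
      by (intro span_minimal endo_kernel_subspace component_endo) auto
    then have comp0: "component 0 z = 0" for z using D by auto
    obtain h where "h \<in> T" "h \<noteq> 0" using T_nontrivial by blast
    then show False using comp0[of h] component_of_member[of h 0 0] by (simp add: gws_0 zero_W)
  qed
  ultimately have "?R = {0}" using lie_ideal_trivial by blast
  with assms show ?thesis by auto
qed

section \<open>The Cartan subalgebra acts diagonalizably\<close>

text \<open>
  Weights add under brackets.
\<close>
lemma diag_derivation: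
  assumes h: "h \<in> T"
  shows "diag (\<lambda>\<gamma>. \<gamma> h) (bracket x y) = bracket (diag (\<lambda>\<gamma>. \<gamma> h) x) y + bracket x (diag (\<lambda>\<gamma>. \<gamma> h) y)"
    (is "_ = bracket (?S x) y + _")
proof (rule endo_eqI[of "\<lambda>x. ?S (bracket x y)" "\<lambda>x. bracket (?S x) y + bracket x (?S y)" x])
  show "endo (\<lambda>x. ?S (bracket x y))" by (rule endo_comp[OF diag_endo endo_bracket_left])
  show "endo (\<lambda>x. bracket (?S x) y + bracket x (?S y))"
    by (rule endoI) (simp_all add: endo_add[OF diag_endo] endo_scale[OF diag_endo] bracket_add_left
        bracket_scale_left scale_right_distrib)
  fix \<gamma> x assume \<gamma>: "\<gamma> \<in> W" "x \<in> gws \<gamma>"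
  show "?S (bracket x y) = bracket (?S x) y + bracket x (?S y)"
  proof (rule endo_eqI[of "\<lambda>y. ?S (bracket x y)" "\<lambda>y. bracket (?S x) y + bracket x (?S y)" y])
    show "endo (\<lambda>y. ?S (bracket x y))" by (rule endo_comp[OF diag_endo endo_bracket])
    show "endo (\<lambda>y. bracket (?S x) y + bracket x (?S y))"
      by (rule endoI) (simp_all add: endo_add[OF diag_endo] endo_scale[OF diag_endo] bracket_add_right
          bracket_scale_right scale_right_distrib)
    fix \<delta> y assume \<delta>: "\<delta> \<in> W" "y \<in> gws \<delta>"
    have "?S (bracket x y) = (\<gamma> h + \<delta> h) *s bracket x y"
    proof (cases "\<gamma> + \<delta> \<in> W")
      case True
      then show ?thesis using diag_of_member[OF gws_bracket[OF \<gamma>(2) \<delta>(2)]] by simp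
    next
      case False
      then show ?thesis
        using gws_bracket_not_weight[OF \<gamma>(2) \<delta>(2) \<gamma>(1) \<delta>(1)] by (simp add: endo_zero[OF diag_endo])
    qed
    then show "?S (bracket x y) = bracket (?S x) y + bracket x (?S y)"
      using \<gamma> \<delta> by (simp add: diag_of_member bracket_scale_left bracket_scale_right scale_left_distrib)
  qed
qed

lemma nilpart_derivation:
  assumes h: "h \<in> T"
  shows "nilpart h (bracket x y) = bracket (nilpart h x) y + bracket x (nilpart h y)"
  by (simp add: nilpart_def diag_derivation[OF h] bracket_derivation[of h x y] bracket_diff_left bracket_diff_right)

text \<open>
  For \<open>z\<close> of weight zero the operator is nilpotent. For \<open>z\<close> of weight \<open>\<gamma>\<close> with \<open>\<gamma> t\<close> nonzero, it is,
  up to the factor \<open>\<gamma> t\<close>, its own commutator with the diagonal action of \<open>t\<close>.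
\<close>
lemma trace_nilpart_bracket:
  assumes h: "h \<in> T"
  shows "trace (\<lambda>u. nilpart h (bracket z u)) = 0"
proof -
  have member: "trace (\<lambda>u. nilpart h (bracket z u)) = 0" if z: "\<gamma> \<in> W" "z \<in> gws \<gamma>" for \<gamma> z
  proof (cases "\<gamma> = 0")
    case True
    then have zT: "z \<in> T" using z gws_0 by simp
    show ?thesis
    proof (rule trace_nilpart_commuting[OF h endo_bracket])
      show "bracket z (nilpart h x) = nilpart h (bracket z x)" for x
        unfolding nilpart_def
        using diag_commute[OF endo_bracket, of z] gws_bracket_T[OF _ zT] T_commute[OF h zT]
        by (simp add: bracket_diff_right)
    qed
  next
    case False
    then obtain t where t: "t \<in> T" "\<gamma> t \<noteq> 0" using W_outside[OF z(1)] by (metis ext zero_fun_apply)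
    let ?S = "diag (\<lambda>\<gamma>. \<gamma> t)" and ?f = "\<lambda>u. nilpart h (bracket z u)"
    have f: "endo ?f" by (rule endo_comp[OF endo_nilpart endo_bracket])
    have "?S (?f u) - ?f (?S u) = \<gamma> t *s ?f u" for u
    proof -
      have "?S (?f u) = nilpart h (?S (bracket z u))"
        using diag_commute[OF endo_nilpart] nilpart_gws[OF h] by blast
      also have "\<dots> = nilpart h (\<gamma> t *s bracket z u + bracket z (?S u))"
        by (simp add: diag_derivation[OF t(1)] diag_of_member[OF z(2,1)] bracket_scale_left)
      finally show ?thesis by (simp add: endo_add[OF endo_nilpart] endo_scale[OF endo_nilpart])
    qed
    then have "\<gamma> t * trace ?f = trace (\<lambda>u. ?S (?f u) - ?f (?S u))" using trace_scale[of "\<gamma> t" ?f] by simp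
    also have "\<dots> = 0" unfolding trace_diff using trace_comm[OF diag_endo f] by simp
    finally show ?thesis using t by simp
  qed
  have "nilpart h (bracket z u) = (\<Sum>\<gamma>\<in>W. nilpart h (bracket (component \<gamma> z) u))" for u
    using endo_sum[OF endo_comp[OF endo_nilpart endo_bracket_left[of u]], where g = "\<lambda>\<gamma>. component \<gamma> z" and A = W]
    by (simp add: component_sum)
  then show ?thesis using trace_sum[of "\<lambda>\<gamma> u. nilpart h (bracket (component \<gamma> z) u)" W] member[OF _ component_in] by simp
qed

text \<open>
  As the nilpotent part \<open>N\<close> is a derivation, the action of \<open>N x\<close> is the commutator of \<open>N\<close> with that of
  \<open>x\<close>, and the Killing form of \<open>N x\<close> and \<open>y\<close> becomes the trace of \<open>N\<close> times the action of \<open>[x, y]\<close>.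
\<close>
lemma nilpart_zero:
  assumes h: "h \<in> T"
  shows "nilpart h x = 0"
proof (rule kappa_nondegenerate)
  fix y
  have N: "endo (\<lambda>u. nilpart h (bracket a u))" for a by (rule endo_comp[OF endo_nilpart endo_bracket])
  have "kappa (nilpart h x) y = trace (\<lambda>u. nilpart h (bracket x (bracket y u)) - bracket x (nilpart h (bracket y u)))"
    unfolding kappa_def using nilpart_derivation[OF h, of x "bracket y _"] by simp
  also have "\<dots> = trace (\<lambda>u. nilpart h (bracket x (bracket y u))) - trace (\<lambda>u. bracket x (nilpart h (bracket y u)))"
    by (rule trace_diff)
  also have "trace (\<lambda>u. bracket x (nilpart h (bracket y u))) = trace (\<lambda>u. nilpart h (bracket y (bracket x u)))"
    by (rule trace_comm[OF endo_bracket N])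
  also have "trace (\<lambda>u. nilpart h (bracket x (bracket y u))) - \<dots> = trace (\<lambda>u. nilpart h (bracket (bracket x y) u))"
    unfolding trace_diff[symmetric] by (simp add: bracket_bracket endo_diff[OF endo_nilpart])
  finally show "kappa (nilpart h x) y = 0" using trace_nilpart_bracket[OF h] by simp
qed

theorem gws_eigen: "x \<in> gws \<gamma> \<Longrightarrow> \<gamma> \<in> W \<Longrightarrow> h \<in> T \<Longrightarrow> bracket h x = \<gamma> h *s x"
  using nilpart_zero[of h x] nilpart_of_member[of \<gamma> x h] by (simp add: shift_def)

end

section \<open>Root strings\<close>

context cartan_setup
begin

lemma gws_root_space: "\<gamma> \<in> W \<Longrightarrow> gws \<gamma> = root_space T \<gamma>"
  using gws_eigen[of _ \<gamma>] by (auto simp: root_space_def gws_def shift_def intro!: exI[of _ 1])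

lemma root_W: "\<gamma> \<in> roots T \<Longrightarrow> \<gamma> \<in> W"
  using roots_W by blast

lemma root_nonzero: "\<gamma> \<in> roots T \<Longrightarrow> \<gamma> \<noteq> 0"
  by (simp add: roots_def)

lemma W_root: "\<gamma> \<in> W \<Longrightarrow> \<gamma> \<noteq> 0 \<Longrightarrow> \<gamma> \<in> roots T"
  using W_eq by blast

lemma root_dual: "\<gamma> \<in> roots T \<Longrightarrow> \<gamma> \<in> dual T"
  by (simp add: roots_def)

lemma W_I: "x \<in> gws \<gamma> \<Longrightarrow> x \<noteq> 0 \<Longrightarrow> (\<And>x. x \<notin> T \<Longrightarrow> \<gamma> x = 0) \<Longrightarrow> \<gamma> \<in> W"
  by (auto simp: W_def)

lemma W_nonzero_vector: "\<gamma> \<in> W \<Longrightarrow> \<exists>x\<in>gws \<gamma>. x \<noteq> 0"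
  using subspace_0[OF subspace_gws] by (auto simp: W_def)

lemma weight_ne_zero: "\<gamma> \<in> W \<Longrightarrow> \<gamma> \<noteq> 0 \<Longrightarrow> \<exists>h\<in>T. \<gamma> h \<noteq> 0"
  using W_outside by (metis ext zero_fun_apply)

lemma kappa_weights:
  assumes x: "x \<in> gws \<gamma>" "\<gamma> \<in> W" and y: "y \<in> gws \<delta>" "\<delta> \<in> W" and ne: "\<gamma> + \<delta> \<noteq> 0"
  shows "kappa x y = 0"
proof -
  obtain h where h: "(\<gamma> + \<delta>) h \<noteq> 0" using ne by (metis ext zero_fun_apply)
  then have hT: "h \<in> T" using W_outside[OF x(2), of h] W_outside[OF y(2), of h] by fastforce
  have "kappa (bracket h x) y = - kappa x (bracket h y)"
    using kappa_invariant[of x h y] bracket_anti[of h x] kappa_scale[of "- 1" "bracket h x" y] by simp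
  then have "(\<gamma> h + \<delta> h) * kappa x y = 0"
    using gws_eigen[OF x hT] gws_eigen[OF y hT]
    by (simp add: kappa_scale kappa_scale_right distrib_right eq_neg_iff_add_eq_0)
  with h show ?thesis by simp
qed

lemma dual_pairing:
  assumes x: "x \<in> gws \<gamma>" "\<gamma> \<in> W" "x \<noteq> 0"
  shows "- \<gamma> \<in> W \<and> (\<exists>y\<in>gws (- \<gamma>). kappa x y \<noteq> 0)"
proof -
  obtain z where z: "kappa x z \<noteq> 0" using kappa_nondegenerate x by blast
  have "kappa x z = (\<Sum>\<delta>\<in>W. kappa x (component \<delta> z))"
  proof -
    have "kappa x (\<Sum>\<delta>\<in>A. component \<delta> z) = (\<Sum>\<delta>\<in>A. kappa x (component \<delta> z))" if "finite A" for A
      using that kappa_scale_right[of x 0 0] by (induction A) (simp_all add: kappa_add_right)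
    then show ?thesis using component_sum[of z] finite_W by metis
  qed
  with z obtain \<delta> where \<delta>: "\<delta> \<in> W" "kappa x (component \<delta> z) \<noteq> 0"
    by (metis (no_types, lifting) sum.neutral)
  then have "\<gamma> + \<delta> = 0" using kappa_weights[OF x(1,2) component_in] by blast
  then have "\<delta> = - \<gamma>" by (simp add: eq_neg_iff_add_eq_0 add.commute)
  then show ?thesis using \<delta> component_in by blast
qed

lemma neg_W: "\<gamma> \<in> W \<Longrightarrow> - \<gamma> \<in> W"
  using dual_pairing W_nonzero_vector by blast

lemma neg_root: "\<gamma> \<in> roots T \<Longrightarrow> - \<gamma> \<in> roots T"
  using neg_W root_W W_root root_nonzero by force

lemma kappa_T_nondegenerate:
  assumes "t \<in> T" "\<And>h. h \<in> T \<Longrightarrow> kappa h t = 0"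
  shows "t = 0"
  using dual_pairing[of t 0] assms zero_W gws_0 kappa_sym[of t] by auto

lemma opposite_bracket_T: "x \<in> gws \<gamma> \<Longrightarrow> y \<in> gws (- \<gamma>) \<Longrightarrow> bracket x y \<in> T"
  using gws_bracket[of x \<gamma> y "- \<gamma>"] by (simp add: gws_0)

lemma kappa_opposite_bracket:
  assumes "\<gamma> \<in> W" "x \<in> gws \<gamma>" "h \<in> T"
  shows "kappa h (bracket x y) = \<gamma> h * kappa x y"
  using kappa_invariant[of h x y] gws_eigen[OF assms(2,1,3)] by (simp add: kappa_scale)

subsection \<open>Triples spanning a copy of \<open>sl\<^sub>2\<close>\<close>

definition sl2 :: "('g \<Rightarrow> 'k) \<Rightarrow> 'g \<Rightarrow> 'g \<Rightarrow> bool"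
  where "sl2 \<gamma> e f \<longleftrightarrow> \<gamma> \<in> roots T \<and> e \<in> gws \<gamma> \<and> f \<in> gws (- \<gamma>) \<and> \<gamma> (bracket e f) = 2"

lemma sl2_exists_with:
  assumes \<gamma>: "\<gamma> \<in> roots T" and x: "x \<in> gws \<gamma>" "x \<noteq> 0"
  shows "\<exists>f. sl2 \<gamma> x f"
proof -
  obtain y where y: "y \<in> gws (- \<gamma>)" "kappa x y \<noteq> 0" using dual_pairing[OF x(1) root_W[OF \<gamma>] x(2)] by blast
  let ?t = "bracket x y"
  have tT: "?t \<in> T" by (rule opposite_bracket_T[OF x(1) y(1)])
  have "\<gamma> ?t \<noteq> 0"
  proof
    assume "\<gamma> ?t = 0"
    then have "?t = 0" by (rule commutator_T_zero[OF root_W[OF \<gamma>] x(1) tT])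
    then have "\<gamma> h = 0" if "h \<in> T" for h
      using kappa_opposite_bracket[OF root_W[OF \<gamma>] x(1) that, of y] y(2) kappa_scale_right[of h 0 0] by simp
    then show False using weight_ne_zero[OF root_W[OF \<gamma>] root_nonzero[OF \<gamma>]] by blast
  qed
  then have "sl2 \<gamma> x ((2 / \<gamma> ?t) *s y)"
    using \<gamma> x y tT dual_scale[OF root_dual[OF \<gamma>]]
    by (simp add: sl2_def bracket_scale_right subspace_scale subspace_gws)
  then show ?thesis ..
qed

lemma sl2D:
  assumes "sl2 \<gamma> e f"
  shows "\<gamma> \<in> roots T" "e \<in> gws \<gamma>" "f \<in> gws (- \<gamma>)" "\<gamma> (bracket e f) = 2" "bracket e f \<in> T" "- \<gamma> \<in> roots T"
  using assms opposite_bracket_T neg_root by (auto simp: sl2_def)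

lemma sl2_swap:
  assumes "sl2 \<gamma> e f"
  shows "sl2 (- \<gamma>) f e"
proof -
  note d = sl2D[OF assms]
  have "\<gamma> (bracket f e) = - \<gamma> (bracket e f)"
    using dual_scale[OF root_dual[OF d(1)] d(5), of "- 1"] bracket_anti[of f e] by simp
  then show ?thesis using d by (simp add: sl2_def)
qed

text \<open>
  Applying \<open>e\<close> to \<open>f\<close>-powers of \<open>v\<close> gives \<open>e f^(k+1) v = (k+1) (c - k) f^k v\<close>, so the first power
  of \<open>f\<close> that kills \<open>v\<close> determines \<open>c\<close>.
\<close>
lemma highest_weight:
  assumes h: "bracket (bracket e f) e = 2 *s e" "bracket (bracket e f) f = (- 2) *s f"
    and v: "bracket e v = 0" "bracket (bracket e f) v = c *s v" "v \<noteq> 0"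
    and fin: "\<exists>n. (bracket f ^^ n) v = 0"
  shows "\<exists>m::nat. c = of_nat m \<and> (\<forall>k\<le>m. (bracket f ^^ k) v \<noteq> 0 \<and> (0 < k \<longrightarrow> bracket e ((bracket f ^^ k) v) \<noteq> 0))"
proof -
  let ?h = "bracket e f" and ?v = "\<lambda>k. (bracket f ^^ k) v"
  have hv: "bracket ?h (?v k) = (c - 2 * of_nat k) *s ?v k" for k
  proof (induction k)
    case (Suc k)
    have "bracket ?h (?v (Suc k)) = bracket (bracket ?h f) (?v k) + bracket f (bracket ?h (?v k))"
      using bracket_derivation[of ?h f "?v k"] by simp
    also have "\<dots> = (c - 2 * of_nat (Suc k)) *s ?v (Suc k)"
      unfolding h Suc bracket_scale_left bracket_scale_right funpow.simps o_apply scale_left_distrib[symmetric]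
      by (simp add: algebra_simps)
    finally show ?case .
  qed (simp add: v)
  have ev: "bracket e (?v (Suc k)) = (of_nat (Suc k) * (c - of_nat k)) *s ?v k" for k
  proof (induction k)
    case 0
    show ?case using bracket_derivation[of e f v] v by simp
  next
    case (Suc k)
    have "bracket e (?v (Suc (Suc k))) = bracket ?h (?v (Suc k)) + bracket f (bracket e (?v (Suc k)))"
      using bracket_derivation[of e f "?v (Suc k)"] by simp
    also have "\<dots> = (c - 2 * of_nat (Suc k)) *s ?v (Suc k) + (of_nat (Suc k) * (c - of_nat k)) *s ?v (Suc k)"
      unfolding hv Suc bracket_scale_right by simp
    also have "\<dots> = (of_nat (Suc (Suc k)) * (c - of_nat (Suc k))) *s ?v (Suc k)"
      unfolding scale_left_distrib[symmetric] by (simp add: algebra_simps)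
    finally show ?case .
  qed
  obtain n where n: "?v n = 0" "\<And>k. k < n \<Longrightarrow> ?v k \<noteq> 0"
    using fin exists_least_iff[of "\<lambda>n. ?v n = 0"] by blast
  then obtain m where m: "n = Suc m" using v(3) by (cases n) auto
  have "(of_nat (Suc m) * (c - of_nat m)) *s ?v m = 0" using ev[of m] n(1) m by simp
  then have "of_nat (Suc m) * (c - of_nat m) = 0 \<or> ?v m = 0" by (simp only: scale_eq_0_iff)
  then have c: "c = of_nat m" using n(2)[of m] m by (simp del: of_nat_Suc)
  have "bracket e (?v k) \<noteq> 0" if k: "0 < k" "k \<le> m" for k
  proof -
    obtain j where j: "k = Suc j" using k by (cases k) auto
    have "of_nat m - of_nat j = (of_nat (m - j) :: 'k)" using k j by (simp add: of_nat_diff)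
    then have "c - of_nat j \<noteq> 0" unfolding c using k j by simp
    then have "(of_nat (Suc j) * (c - of_nat j)) *s ?v j \<noteq> 0"
      using n(2)[of j] k j m by (simp del: of_nat_Suc)
    then show ?thesis using ev[of j] j by simp
  qed
  then show ?thesis using c n(2) m by (intro exI[of _ m]) auto
qed

lemma gws_iterate:
  assumes "x \<in> gws \<gamma>" "v \<in> gws \<epsilon>"
  shows "(bracket x ^^ n) v \<in> gws (\<epsilon> + fscale (of_nat n) \<gamma>)"
proof (induction n)
  case 0
  have "\<epsilon> + fscale (of_nat 0) \<gamma> = \<epsilon>" by (simp add: fscale_def fun_eq_iff)
  then show ?case using assms by simp
next
  case (Suc n)
  have "\<gamma> + (\<epsilon> + fscale (of_nat n) \<gamma>) = \<epsilon> + fscale (of_nat (Suc n)) \<gamma>"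
    by (simp add: fscale_def fun_eq_iff algebra_simps)
  then show ?case using gws_bracket[OF assms(1) Suc] by (simp only: funpow.simps o_apply)
qed

lemma bracket_locally_nilpotent:
  assumes \<gamma>: "\<gamma> \<in> roots T" and x: "x \<in> gws \<gamma>" and v: "v \<in> gws \<epsilon>" "\<epsilon> \<in> W"
  shows "\<exists>n. (bracket x ^^ n) v = 0"
proof (rule ccontr)
  assume *: "\<not> ?thesis"
  let ?g = "\<lambda>n::nat. \<epsilon> + fscale (of_nat n) \<gamma>"
  have "?g n \<in> W" for n
    by (rule W_I[OF gws_iterate[OF x v(1)]]) (use * in \<open>auto simp: fscale_def W_outside[OF v(2)] W_outside[OF root_W[OF \<gamma>]]\<close>)
  then have "range ?g \<subseteq> W" by auto
  then have "finite (range ?g)" using finite_W finite_subset by blast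
  moreover have "inj ?g"
  proof (rule injI)
    fix m n assume eq: "?g m = ?g n"
    obtain h where "\<gamma> h \<noteq> 0" using weight_ne_zero root_W root_nonzero \<gamma> by blast
    then show "m = n" using fun_cong[OF eq, of h] by (simp add: fscale_def)
  qed
  ultimately show False using finite_imageD infinite_UNIV_nat by blast
qed

lemma sl2_highest:
  assumes s: "sl2 \<gamma> e f" and \<epsilon>: "\<epsilon> \<in> W" and v: "v \<in> gws \<epsilon>" "v \<noteq> 0" "bracket e v = 0"
  shows "\<exists>m::nat. \<epsilon> (bracket e f) = of_nat m \<and>
    (\<forall>k\<le>m. (bracket f ^^ k) v \<noteq> 0 \<and> (0 < k \<longrightarrow> bracket e ((bracket f ^^ k) v) \<noteq> 0))"
proof (rule highest_weight[OF _ _ v(3)])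
  note d = sl2D[OF s]
  show "bracket (bracket e f) e = 2 *s e" using gws_eigen[OF d(2) root_W[OF d(1)] d(5)] d(4) by simp
  show "bracket (bracket e f) f = (- 2) *s f" using gws_eigen[OF d(3) root_W[OF d(6)] d(5)] d(4) by simp
  show "bracket (bracket e f) v = \<epsilon> (bracket e f) *s v" by (rule gws_eigen[OF v(1) \<epsilon> d(5)])
  show "\<exists>n. (bracket f ^^ n) v = 0" by (rule bracket_locally_nilpotent[OF d(6,3) v(1) \<epsilon>])
qed (rule v)

text \<open>
  Apply \<open>e\<close> as often as possible to reach a vector of highest weight, \<open>p\<close> steps up; its weight is the
  length \<open>m\<close> of its string.
\<close>
lemma string_top:
  assumes s: "sl2 \<gamma> e f" and \<epsilon>: "\<epsilon> \<in> W" and v: "v \<in> gws \<epsilon>" "v \<noteq> 0"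
  shows "\<exists>(p::nat) (m::nat) w. \<epsilon> (bracket e f) = of_nat m - 2 * of_nat p \<and> w \<in> gws (\<epsilon> + fscale (of_nat p) \<gamma>) \<and>
    (\<forall>k\<le>m. (bracket f ^^ k) w \<noteq> 0 \<and> (0 < k \<longrightarrow> bracket e ((bracket f ^^ k) w) \<noteq> 0))"
proof -
  note d = sl2D[OF s]
  obtain n where n: "(bracket e ^^ n) v = 0" "\<And>k. k < n \<Longrightarrow> (bracket e ^^ k) v \<noteq> 0"
    using bracket_locally_nilpotent[OF d(1,2) v(1) \<epsilon>] exists_least_iff[of "\<lambda>n. (bracket e ^^ n) v = 0"] by blast
  then obtain p where p: "n = Suc p" using v(2) by (cases n) auto
  let ?w = "(bracket e ^^ p) v" and ?\<epsilon> = "\<epsilon> + fscale (of_nat p) \<gamma>"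
  have w: "?w \<in> gws ?\<epsilon>" "?w \<noteq> 0" "bracket e ?w = 0"
    using gws_iterate[OF d(2) v(1)] n p by auto
  have "?\<epsilon> \<in> W" by (rule W_I[OF w(1,2)]) (simp add: fscale_def W_outside[OF \<epsilon>] W_outside[OF root_W[OF d(1)]])
  from sl2_highest[OF s this w] obtain m :: nat where m: "?\<epsilon> (bracket e f) = of_nat m"
    "\<forall>k\<le>m. (bracket f ^^ k) ?w \<noteq> 0 \<and> (0 < k \<longrightarrow> bracket e ((bracket f ^^ k) ?w) \<noteq> 0)" by blast
  have "\<epsilon> (bracket e f) = of_nat m - 2 * of_nat p"
    using m(1) d(4) by (simp add: fscale_def algebra_simps)
  with w(1) m(2) show ?thesis by blast
qed

text \<open>
  A nonnegative value \<open>n = m - 2 p\<close> gives \<open>p \<le> m\<close>, so the reflected weight lies \<open>m - p\<close> steps below the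
  top of the string, within its length.
\<close>
lemma reflection_nonneg:
  assumes s: "sl2 \<gamma> e f" and \<epsilon>: "\<epsilon> \<in> W"
  shows "\<exists>n::int. \<epsilon> (bracket e f) = of_int n \<and> (0 \<le> n \<longrightarrow> \<epsilon> - fscale (of_int n) \<gamma> \<in> W)"
proof -
  note d = sl2D[OF s]
  obtain v where v: "v \<in> gws \<epsilon>" "v \<noteq> 0" using W_nonzero_vector \<epsilon> by blast
  obtain p m :: nat and w where pm: "\<epsilon> (bracket e f) = of_nat m - 2 * of_nat p"
    "w \<in> gws (\<epsilon> + fscale (of_nat p) \<gamma>)" "\<And>k. k \<le> m \<Longrightarrow> (bracket f ^^ k) w \<noteq> 0"
    using string_top[OF s \<epsilon> v] by blast
  let ?n = "int m - 2 * int p"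
  have "\<epsilon> - fscale (of_int ?n) \<gamma> \<in> W" if n: "0 \<le> ?n"
  proof -
    have "of_nat (m - p) = (of_nat m - of_nat p :: 'k)" using n by (simp add: of_nat_diff)
    then have eq: "\<epsilon> + fscale (of_nat p) \<gamma> + fscale (of_nat (m - p)) (- \<gamma>) = \<epsilon> - fscale (of_int ?n) \<gamma>"
      unfolding fscale_def fun_eq_iff by (simp only: plus_fun_apply fun_diff_def uminus_apply) (simp add: algebra_simps)
    have "(bracket f ^^ (m - p)) w \<in> gws (\<epsilon> - fscale (of_int ?n) \<gamma>)"
      using gws_iterate[OF d(3) pm(2), of "m - p"] unfolding eq .
    moreover have "(bracket f ^^ (m - p)) w \<noteq> 0" by (rule pm(3)) simp
    ultimately show ?thesis
      by (rule W_I) (simp add: fscale_def W_outside[OF \<epsilon>] W_outside[OF root_W[OF d(1)]])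
  qed
  then show ?thesis using pm(1) by (intro exI[of _ ?n]) simp
qed

text \<open>
  A negative value becomes positive on exchanging \<open>e\<close> and \<open>f\<close>.
\<close>
lemma reflection:
  assumes s: "sl2 \<gamma> e f" and \<epsilon>: "\<epsilon> \<in> W"
  shows "\<exists>n::int. \<epsilon> (bracket e f) = of_int n \<and> \<epsilon> - fscale (of_int n) \<gamma> \<in> W"
proof -
  note d = sl2D[OF s]
  obtain n where n: "\<epsilon> (bracket e f) = of_int n" "0 \<le> n \<longrightarrow> \<epsilon> - fscale (of_int n) \<gamma> \<in> W"
    using reflection_nonneg[OF s \<epsilon>] by blast
  obtain n' where n': "\<epsilon> (bracket f e) = of_int n'" "0 \<le> n' \<longrightarrow> \<epsilon> - fscale (of_int n') (- \<gamma>) \<in> W"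
    using reflection_nonneg[OF sl2_swap[OF s] \<epsilon>] by blast
  have "\<epsilon> (bracket f e) = - \<epsilon> (bracket e f)"
    using dual_scale[OF W_dual[OF \<epsilon>] d(5), of "- 1"] bracket_anti[of f e] by simp
  then have "(of_int n' :: 'k) = of_int (- n)" using n n' by simp
  then have "n' = - n" by (simp only: of_int_eq_iff)
  moreover have "\<epsilon> - fscale (of_int (- n)) (- \<gamma>) = \<epsilon> - fscale (of_int n) \<gamma>"
    by (simp add: fscale_def fun_eq_iff)
  ultimately show ?thesis using n n' by (cases "0 \<le> n") auto
qed

text \<open>
  If a vector of the root space of \<open>-\<gamma>\<close> pairs to zero with \<open>e\<close>, then \<open>e\<close> kills it, and a highest
  weight cannot be \<open>-2\<close>.
\<close>
lemma opposite_line: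
  assumes s: "sl2 \<gamma> e f" and y: "y \<in> gws (- \<gamma>)"
  shows "\<exists>c. y = c *s f"
proof -
  note d = sl2D[OF s]
  have W: "\<gamma> \<in> W" "- \<gamma> \<in> W" using d root_W by auto
  have zero: "z = 0" if z: "z \<in> gws (- \<gamma>)" "kappa e z = 0" for z
  proof (rule ccontr)
    assume "z \<noteq> 0"
    have "bracket e z = 0"
      by (rule kappa_T_nondegenerate[OF opposite_bracket_T[OF d(2) z(1)]])
        (simp add: kappa_opposite_bracket[OF W(1) d(2)] z(2))
    from sl2_highest[OF s W(2) z(1) \<open>z \<noteq> 0\<close> this] obtain m :: nat where "- 2 = (of_nat m :: 'k)"
      using d(4) by auto
    then have "of_nat (m + 2) = (0 :: 'k)" by (simp add: algebra_simps)
    then show False by (simp only: of_nat_eq_0_iff)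
  qed
  have "kappa e f \<noteq> 0" using zero[OF d(3)] d(4) dual_scale[OF root_dual[OF d(1)] subspace_0[OF subspace_T], of 0] by auto
  then have "kappa e (y - (kappa e y / kappa e f) *s f) = 0"
    using kappa_add_right[of e y "- ((kappa e y / kappa e f) *s f)"] kappa_scale_right[of e "- (kappa e y / kappa e f)" f]
    by simp
  then have "y - (kappa e y / kappa e f) *s f = 0"
    using y d(3) by (intro zero subspace_diff subspace_scale subspace_gws)
  then show ?thesis by auto
qed

text \<open>
  \<open>opposite_line\<close> for the negative root.
\<close>
lemma root_space_line:
  assumes \<gamma>: "\<gamma> \<in> roots T" and x: "x \<in> gws \<gamma>" "x \<noteq> 0" and y: "y \<in> gws \<gamma>"
  shows "\<exists>c. y = c *s x"
proof -
  obtain e where e: "e \<in> gws (- \<gamma>)" "e \<noteq> 0" using W_nonzero_vector root_W[OF neg_root[OF \<gamma>]] by blast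
  obtain f where s: "sl2 (- \<gamma>) e f" using sl2_exists_with[OF neg_root[OF \<gamma>] e] by blast
  obtain a where a: "x = a *s f" using opposite_line[OF s] x by auto
  obtain b where b: "y = b *s f" using opposite_line[OF s] y by auto
  have "y = (b / a) *s x" using a b x(2) by auto
  then show ?thesis ..
qed

text \<open>
  If \<open>x\<close> killed \<open>y\<close>, then \<open>\<delta>\<close> would take a nonnegative value on the coroot. The string descending from
  above \<open>\<gamma> + \<delta>\<close> would then reach the root space of \<open>\<delta>\<close>, a line, in a vector that \<open>x\<close> does not kill.
\<close>
lemma root_bracket_nonzero:
  assumes \<gamma>: "\<gamma> \<in> roots T" and \<delta>: "\<delta> \<in> roots T" and sum: "\<gamma> + \<delta> \<in> roots T"
    and x: "x \<in> gws \<gamma>" "x \<noteq> 0" and y: "y \<in> gws \<delta>" "y \<noteq> 0"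
  shows "bracket x y \<noteq> 0"
proof
  assume zero: "bracket x y = 0"
  obtain f where s: "sl2 \<gamma> x f" using sl2_exists_with[OF \<gamma> x] by blast
  note d = sl2D[OF s]
  obtain c :: nat where c: "\<delta> (bracket x f) = of_nat c"
    using sl2_highest[OF s root_W[OF \<delta>] y zero] by blast
  obtain z where z: "z \<in> gws (\<gamma> + \<delta>)" "z \<noteq> 0" using W_nonzero_vector root_W[OF sum] by blast
  obtain p m :: nat and w where pm: "(\<gamma> + \<delta>) (bracket x f) = of_nat m - 2 * of_nat p"
    "w \<in> gws (\<gamma> + \<delta> + fscale (of_nat p) \<gamma>)"
    "\<And>k. k \<le> m \<Longrightarrow> (bracket f ^^ k) w \<noteq> 0" "\<And>k. k \<le> m \<Longrightarrow> 0 < k \<Longrightarrow> bracket x ((bracket f ^^ k) w) \<noteq> 0"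
    using string_top[OF s root_W[OF sum] z] by blast
  have "(of_nat m :: 'k) = of_nat (c + 2 + 2 * p)" using pm(1) c d(4) by (simp add: algebra_simps)
  then have m: "m = c + 2 + 2 * p" by (simp only: of_nat_eq_iff)
  have "\<gamma> + \<delta> + fscale (of_nat p) \<gamma> + fscale (of_nat (Suc p)) (- \<gamma>) = \<delta>"
    by (simp add: fscale_def fun_eq_iff algebra_simps)
  then have "(bracket f ^^ Suc p) w \<in> gws \<delta>" using gws_iterate[OF d(3) pm(2), of "Suc p"] by (simp only:)
  from root_space_line[OF \<delta> y this] obtain a where a: "(bracket f ^^ Suc p) w = a *s y" by blast
  have "bracket x ((bracket f ^^ Suc p) w) = 0" unfolding a by (simp add: bracket_scale_right zero)
  then show False using pm(4)[of "Suc p"] m by simp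
qed

lemma root_double: "\<gamma> \<in> roots T \<Longrightarrow> \<gamma> + \<gamma> \<notin> roots T"
  using root_bracket_nonzero[of \<gamma> \<gamma>] W_nonzero_vector[OF root_W] bracket_self by blast

section \<open>Coroots\<close>

definition triple :: "('g \<Rightarrow> 'k) \<Rightarrow> 'g \<times> 'g"
  where "triple \<gamma> = (SOME ef. sl2 \<gamma> (fst ef) (snd ef))"

definition coroot :: "('g \<Rightarrow> 'k) \<Rightarrow> 'g"
  where "coroot \<gamma> = bracket (fst (triple \<gamma>)) (snd (triple \<gamma>))"

text \<open>
  The factor between \<open>\<gamma>\<close> and the functional that the Killing form attaches to the coroot, as
  \<open>kappa_coroot\<close> shows; half the norm of the coroot.
\<close>
definition coroot_norm :: "('g \<Rightarrow> 'k) \<Rightarrow> 'k"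
  where "coroot_norm \<gamma> = kappa (fst (triple \<gamma>)) (snd (triple \<gamma>))"

lemma sl2_triple: "\<gamma> \<in> roots T \<Longrightarrow> sl2 \<gamma> (fst (triple \<gamma>)) (snd (triple \<gamma>))"
  unfolding triple_def by (rule someI_ex) (use W_nonzero_vector[OF root_W] sl2_exists_with in \<open>metis fst_conv snd_conv\<close>)

lemma coroot_T: "\<gamma> \<in> roots T \<Longrightarrow> coroot \<gamma> \<in> T"
  unfolding coroot_def by (rule sl2D(5)[OF sl2_triple])

lemma coroot_self: "\<gamma> \<in> roots T \<Longrightarrow> \<gamma> (coroot \<gamma>) = 2"
  unfolding coroot_def by (rule sl2D(4)[OF sl2_triple])

lemma kappa_coroot: "\<gamma> \<in> roots T \<Longrightarrow> h \<in> T \<Longrightarrow> kappa h (coroot \<gamma>) = coroot_norm \<gamma> * \<gamma> h"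
  unfolding coroot_def coroot_norm_def
  using kappa_opposite_bracket[OF root_W sl2D(2)[OF sl2_triple]] by (simp add: mult.commute)

lemma coroot_norm_nonzero: "\<gamma> \<in> roots T \<Longrightarrow> coroot_norm \<gamma> \<noteq> 0"
proof
  assume \<gamma>: "\<gamma> \<in> roots T" and "coroot_norm \<gamma> = 0"
  then have "coroot \<gamma> = 0" by (intro kappa_T_nondegenerate coroot_T) (simp_all add: kappa_coroot)
  then show False
    using coroot_self[OF \<gamma>] dual_scale[OF root_dual[OF \<gamma>] subspace_0[OF subspace_T], of 0] by simp
qed

lemma coroot_unique:
  assumes \<gamma>: "\<gamma> \<in> roots T" and t: "t \<in> T" "\<And>h. h \<in> T \<Longrightarrow> kappa h t = c * \<gamma> h" "\<gamma> t = 2"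
  shows "t = coroot \<gamma>"
proof -
  let ?c = "coroot_norm \<gamma>" and ?h = "coroot \<gamma>"
  note dual = root_dual[OF \<gamma>]
  have "?c *s t - c *s ?h = 0"
  proof (rule kappa_T_nondegenerate)
    show "?c *s t - c *s ?h \<in> T" using t coroot_T[OF \<gamma>] by (intro subspace_diff subspace_scale subspace_T)
    fix h assume "h \<in> T"
    then show "kappa h (?c *s t - c *s ?h) = 0"
      using kappa_add_right[of h "?c *s t" "(- c) *s ?h"] kappa_coroot[OF \<gamma>] t(2)
      by (simp only: kappa_scale_right) (simp add: kappa_scale_right)
  qed
  then have eq: "?c *s t = c *s ?h" by simp
  have "?c * \<gamma> t = c * \<gamma> ?h" using arg_cong[OF eq, of \<gamma>] dual_scale[OF dual] t(1) coroot_T[OF \<gamma>] by simp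
  then have "?c = c" using t(3) coroot_self[OF \<gamma>] by simp
  then show ?thesis using eq coroot_norm_nonzero[OF \<gamma>] by simp
qed

definition cartan_int :: "('g \<Rightarrow> 'k) \<Rightarrow> ('g \<Rightarrow> 'k) \<Rightarrow> int"
  where "cartan_int \<epsilon> \<gamma> = (SOME n. \<epsilon> (coroot \<gamma>) = of_int n)"

lemma root_reflection:
  assumes \<gamma>: "\<gamma> \<in> roots T" and \<epsilon>: "\<epsilon> \<in> roots T"
  shows "\<epsilon> (coroot \<gamma>) = of_int (cartan_int \<epsilon> \<gamma>) \<and> \<epsilon> - fscale (of_int (cartan_int \<epsilon> \<gamma>)) \<gamma> \<in> roots T"
proof -
  obtain n :: int where n: "\<epsilon> (coroot \<gamma>) = of_int n" "\<epsilon> - fscale (of_int n) \<gamma> \<in> W"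
    using reflection[OF sl2_triple[OF \<gamma>] root_W[OF \<epsilon>]] unfolding coroot_def by blast
  have c: "\<epsilon> (coroot \<gamma>) = of_int (cartan_int \<epsilon> \<gamma>)" unfolding cartan_int_def by (rule someI[of _ n]) (rule n(1))
  with n have cn: "cartan_int \<epsilon> \<gamma> = n" by simp
  have "\<epsilon> - fscale (of_int n) \<gamma> \<noteq> 0"
  proof
    assume "\<epsilon> - fscale (of_int n) \<gamma> = 0"
    then have eq: "\<epsilon> = fscale (of_int n) \<gamma>" by simp
    then have "\<epsilon> (coroot \<gamma>) = of_int n * 2" using coroot_self[OF \<gamma>] by (simp add: fscale_def)
    with n(1) have "n = 0" by simp
    with eq have "\<epsilon> = 0" by (simp add: fscale_def fun_eq_iff)
    with root_nonzero[OF \<epsilon>] show False by simp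
  qed
  with n(2) c cn show ?thesis by (simp add: W_root)
qed

text \<open>
  The right-hand side is dual to the reflected root under the Killing form, up to a factor, and the
  reflected root takes the value 2 on it; this characterizes the coroot.
\<close>
lemma coroot_reflection:
  assumes \<gamma>: "\<gamma> \<in> roots T" and \<delta>: "\<delta> \<in> roots T"
  shows "coroot (\<delta> - fscale (of_int (cartan_int \<delta> \<gamma>)) \<gamma>) = coroot \<delta> - of_int (cartan_int \<gamma> \<delta>) *s coroot \<gamma>"
proof (rule coroot_unique[symmetric])
  let ?s = "\<delta> - fscale (of_int (cartan_int \<delta> \<gamma>)) \<gamma>" and ?t = "coroot \<delta> - of_int (cartan_int \<gamma> \<delta>) *s coroot \<gamma>"
  have T: "coroot \<gamma> \<in> T" "coroot \<delta> \<in> T" "- of_int (cartan_int \<gamma> \<delta>) *s coroot \<gamma> \<in> T"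
    using coroot_T \<gamma> \<delta> by (blast intro: subspace_scale[OF subspace_T])+
  show "?s \<in> roots T" using root_reflection[OF \<gamma> \<delta>] by simp
  show "?t \<in> T" using T by (intro subspace_diff subspace_scale subspace_T)
  have int: "\<delta> (coroot \<gamma>) = of_int (cartan_int \<delta> \<gamma>)" "\<gamma> (coroot \<delta>) = of_int (cartan_int \<gamma> \<delta>)"
    using root_reflection \<gamma> \<delta> by blast+
  have sym: "coroot_norm \<gamma> * of_int (cartan_int \<gamma> \<delta>) = coroot_norm \<delta> * of_int (cartan_int \<delta> \<gamma>)"
    using kappa_coroot[OF \<gamma> T(2)] kappa_coroot[OF \<delta> T(1)] int kappa_sym[of "coroot \<delta>" "coroot \<gamma>"] by simp
  have val: "\<epsilon> ?t = \<epsilon> (coroot \<delta>) - of_int (cartan_int \<gamma> \<delta>) * \<epsilon> (coroot \<gamma>)" if "\<epsilon> \<in> dual T" for \<epsilon>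
    using dual_add[OF that T(2,3)] dual_scale[OF that T(1), of "- of_int (cartan_int \<gamma> \<delta>)"] by simp
  show "kappa h ?t = coroot_norm \<delta> * ?s h" if h: "h \<in> T" for h
  proof -
    have "kappa h ?t = coroot_norm \<delta> * \<delta> h - of_int (cartan_int \<gamma> \<delta>) * (coroot_norm \<gamma> * \<gamma> h)"
      using kappa_add_right[of h "coroot \<delta>" "(- of_int (cartan_int \<gamma> \<delta>)) *s coroot \<gamma>"] kappa_coroot \<gamma> \<delta> h
      by (simp only: kappa_scale_right) (simp add: kappa_scale_right)
    also have "of_int (cartan_int \<gamma> \<delta>) * (coroot_norm \<gamma> * \<gamma> h) = coroot_norm \<delta> * of_int (cartan_int \<delta> \<gamma>) * \<gamma> h"
      unfolding sym[symmetric] by simp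
    finally show ?thesis by (simp add: fscale_def algebra_simps)
  qed
  have "?s ?t = \<delta> ?t - of_int (cartan_int \<delta> \<gamma>) * \<gamma> ?t" by (simp add: fscale_def)
  then show "?s ?t = 2"
    unfolding val[OF root_dual[OF \<gamma>]] val[OF root_dual[OF \<delta>]] int coroot_self[OF \<gamma>] coroot_self[OF \<delta>]
    by (simp add: algebra_simps)
qed

text \<open>
  If \<open>f\<close> killed a vector of weight \<open>\<gamma>\<close>, this would be a lowest weight vector of positive weight.
\<close>
lemma root_difference:
  assumes \<gamma>: "\<gamma> \<in> roots T" and \<delta>: "\<delta> \<in> roots T" and pos: "cartan_int \<gamma> \<delta> > 0" and ne: "\<gamma> \<noteq> \<delta>"
  shows "\<gamma> - \<delta> \<in> roots T"
proof -
  let ?e = "fst (triple \<delta>)" and ?f = "snd (triple \<delta>)"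
  note s = sl2_triple[OF \<delta>]
  note d = sl2D[OF s]
  obtain x where x: "x \<in> gws \<gamma>" "x \<noteq> 0" using W_nonzero_vector root_W[OF \<gamma>] by blast
  have "bracket ?f x \<noteq> 0"
  proof
    assume "bracket ?f x = 0"
    from sl2_highest[OF sl2_swap[OF s] root_W[OF \<gamma>] x this]
    obtain m :: nat where "\<gamma> (bracket ?f ?e) = of_nat m" by blast
    moreover have "\<gamma> (bracket ?f ?e) = - \<gamma> (coroot \<delta>)"
      unfolding coroot_def
      using dual_scale[OF root_dual[OF \<gamma>] d(5), of "- 1"] bracket_anti[of ?f ?e] by simp
    ultimately have "(of_int (- cartan_int \<gamma> \<delta>) :: 'k) = of_int (int m)"
      using root_reflection[OF \<delta> \<gamma>] by simp
    then have "- cartan_int \<gamma> \<delta> = int m" by (simp only: of_int_eq_iff)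
    with pos show False by simp
  qed
  moreover have "bracket ?f x \<in> gws (\<gamma> - \<delta>)" using gws_bracket[OF d(3) x(1)] by simp
  ultimately have "\<gamma> - \<delta> \<in> W"
    by (intro W_I) (auto simp: W_outside[OF root_W[OF \<gamma>]] W_outside[OF root_W[OF \<delta>]])
  then show ?thesis using ne by (intro W_root) auto
qed

end

section \<open>Coordinates of the roots with respect to the base\<close>

lemma sum_fun_apply: "(\<Sum>i\<in>A. f i) x = (\<Sum>i\<in>A. f i x)"
  by (induction A rule: infinite_finite_induct) simp_all

lemma int_comb_apply: "int_comb B n x = (\<Sum>b\<in>B. of_int (n b) * b x)"
  by (simp add: int_comb_def sum_fun_apply fscale_def)

lemma int_comb_diff_scale:
  "int_comb B (\<lambda>b. m b - k * n b) = int_comb B m - fscale (of_int k) (int_comb B n)"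
  by (auto simp: int_comb_apply fscale_def sum_subtractf sum_distrib_left algebra_simps)

lemma int_comb_diff: "int_comb B (m - n) = int_comb B m - int_comb B n"
  by (auto simp: int_comb_apply sum_subtractf algebra_simps)

lemma int_comb_add: "int_comb B (m + n) = int_comb B m + int_comb B n"
  by (auto simp: int_comb_apply sum.distrib algebra_simps)

lemma int_comb_zero: "int_comb B 0 = 0"
  by (auto simp: int_comb_apply)

lemma int_comb_unit: "finite B \<Longrightarrow> b \<in> B \<Longrightarrow> int_comb B (\<lambda>c. if c = b then 1 else 0) = b"
  by (auto simp: int_comb_apply if_distrib[of "\<lambda>x. of_int x * _"] sum.delta cong: if_cong)

context cartan_setup
begin

lemma finite_B: "finite B" and independent_B: "functional.independent B"
  using base by (auto simp: simple_roots_def)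

definition coord :: "('g \<Rightarrow> 'k) \<Rightarrow> ('g \<Rightarrow> 'k) \<Rightarrow> int"
  where "coord \<gamma> b = (if b \<in> B then ht B b \<gamma> else 0)"

lemma coord_int_comb: "(\<And>b. b \<notin> B \<Longrightarrow> n b = 0) \<Longrightarrow> coord (int_comb B n) = n"
  by (auto simp: coord_def ht_int_comb[OF finite_B independent_B])

lemma coord_outside: "b \<notin> B \<Longrightarrow> coord \<gamma> b = 0"
  by (simp add: coord_def)

lemma root_coord:
  assumes "\<gamma> \<in> roots T"
  shows "int_comb B (coord \<gamma>) = \<gamma>" "(\<forall>b\<in>B. 0 \<le> coord \<gamma> b) \<or> (\<forall>b\<in>B. coord \<gamma> b \<le> 0)"
proof -
  obtain n where n: "\<gamma> = int_comb B n" "(\<forall>b\<in>B. 0 \<le> n b) \<or> (\<forall>b\<in>B. n b \<le> 0)"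
    using base assms by (auto simp: simple_roots_def)
  have c: "coord \<gamma> b = n b" if "b \<in> B" for b
    using n(1) that by (simp add: coord_def ht_int_comb[OF finite_B independent_B])
  then show "int_comb B (coord \<gamma>) = \<gamma>" unfolding n(1) int_comb_def by (intro sum.cong) auto
  show "(\<forall>b\<in>B. 0 \<le> coord \<gamma> b) \<or> (\<forall>b\<in>B. coord \<gamma> b \<le> 0)" using n(2) c by auto
qed

lemma coord_inj: "inj_on coord (roots T)"
  using root_coord(1) by (metis inj_onI)

lemma coord_add: "\<gamma> \<in> roots T \<Longrightarrow> \<delta> \<in> roots T \<Longrightarrow> coord (\<gamma> + \<delta>) = coord \<gamma> + coord \<delta>"
  using coord_int_comb[of "coord \<gamma> + coord \<delta>"] by (simp add: int_comb_add root_coord coord_outside)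

lemma coord_diff: "\<gamma> \<in> roots T \<Longrightarrow> \<delta> \<in> roots T \<Longrightarrow> coord (\<gamma> - \<delta>) = coord \<gamma> - coord \<delta>"
  using coord_int_comb[of "coord \<gamma> - coord \<delta>"] by (simp add: int_comb_diff root_coord coord_outside)

lemma sum_in_roots_iff:
  assumes "\<gamma> \<in> roots T" "\<delta> \<in> roots T"
  shows "coord \<gamma> + coord \<delta> \<in> coord ` roots T \<longleftrightarrow> \<gamma> + \<delta> \<in> roots T"
proof
  assume "coord \<gamma> + coord \<delta> \<in> coord ` roots T"
  then obtain \<epsilon> where "\<epsilon> \<in> roots T" "coord \<epsilon> = coord \<gamma> + coord \<delta>" by auto
  then show "\<gamma> + \<delta> \<in> roots T"
    using int_comb_add[of B "coord \<gamma>" "coord \<delta>"] root_coord(1) assms by metis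
next
  assume "\<gamma> + \<delta> \<in> roots T"
  then show "coord \<gamma> + coord \<delta> \<in> coord ` roots T" using coord_add[OF assms] by (metis imageI)
qed

definition pairing :: "(('g \<Rightarrow> 'k) \<Rightarrow> int) \<Rightarrow> (('g \<Rightarrow> 'k) \<Rightarrow> int) \<Rightarrow> int"
  where "pairing x d = (\<Sum>b\<in>B. x b * cartan_int b (int_comb B d))"

definition reflect :: "(('g \<Rightarrow> 'k) \<Rightarrow> int) \<Rightarrow> (('g \<Rightarrow> 'k) \<Rightarrow> int) \<Rightarrow> ('g \<Rightarrow> 'k) \<Rightarrow> int"
  where "reflect d x = (\<lambda>b. x b - pairing x d * d b)"

definition unit_coord :: "('g \<Rightarrow> 'k) \<Rightarrow> ('g \<Rightarrow> 'k) \<Rightarrow> int"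
  where "unit_coord b = (\<lambda>c. if c = b then 1 else 0)"

lemma pairing_coroot:
  assumes "\<delta> \<in> roots T"
  shows "of_int (pairing x (coord \<delta>)) = int_comb B x (coroot \<delta>)"
proof -
  have "b (coroot \<delta>) = of_int (cartan_int b \<delta>)" if "b \<in> B" for b
    using root_reflection[OF assms base_roots[OF that]] by blast
  then show ?thesis unfolding pairing_def root_coord(1)[OF assms] int_comb_apply by simp
qed

lemma pairing_cartan_int: "\<gamma> \<in> roots T \<Longrightarrow> \<delta> \<in> roots T \<Longrightarrow> pairing (coord \<gamma>) (coord \<delta>) = cartan_int \<gamma> \<delta>"
proof -
  assume r: "\<gamma> \<in> roots T" "\<delta> \<in> roots T"
  have "(of_int (pairing (coord \<gamma>) (coord \<delta>)) :: 'k) = of_int (cartan_int \<gamma> \<delta>)"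
    using pairing_coroot[OF r(2), of "coord \<gamma>"] root_reflection[OF r(2,1)] by (simp add: root_coord(1)[OF r(1)])
  then show ?thesis by (simp only: of_int_eq_iff)
qed

lemma reflect_coord:
  assumes "\<gamma> \<in> roots T" "\<delta> \<in> roots T"
  shows "reflect (coord \<delta>) (coord \<gamma>) = coord (\<gamma> - fscale (of_int (cartan_int \<gamma> \<delta>)) \<delta>)"
  unfolding reflect_def pairing_cartan_int[OF assms]
  using coord_int_comb[of "\<lambda>b. coord \<gamma> b - cartan_int \<gamma> \<delta> * coord \<delta> b"]
  by (simp add: int_comb_diff_scale root_coord assms coord_outside)

lemma coord_base: "b \<in> B \<Longrightarrow> coord b = unit_coord b"
  using coord_int_comb[of "unit_coord b"] int_comb_unit[OF finite_B, of b] unfolding unit_coord_def by force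

text \<open>
  Through the Killing form a combination of simple roots corresponds to a combination \<open>t\<close> of coroots.
  If it vanishes on all coroots, all simple roots vanish on \<open>t\<close>.
\<close>
lemma coroots_separate:
  assumes out: "\<And>b. b \<notin> B \<Longrightarrow> x b = 0" and zero: "\<And>\<delta>. \<delta> \<in> roots T \<Longrightarrow> int_comb B x (coroot \<delta>) = 0"
  shows "x = 0"
proof -
  let ?t = "\<Sum>b\<in>B. (of_int (x b) / coroot_norm b) *s coroot b"
  have tT: "?t \<in> T"
    using coroot_T base_roots by (intro subspace_sum subspace_scale subspace_T) auto
  have dual: "kappa h ?t = int_comb B x h" if h: "h \<in> T" for h
  proof -
    have "kappa h (\<Sum>b\<in>A. c b *s coroot b) = (\<Sum>b\<in>A. c b * (coroot_norm b * b h))" if "A \<subseteq> B" "finite A" for A and c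
      using that(2,1) kappa_scale_right[of h 0 0] kappa_coroot[OF base_roots h]
      by (induction A) (simp_all add: kappa_add_right kappa_scale_right)
    from this[OF subset_refl finite_B] show ?thesis
      unfolding int_comb_apply using coroot_norm_nonzero[OF base_roots] by (auto intro!: sum.cong)
  qed
  have "?t = 0"
  proof (rule base_separates[OF tT])
    fix b assume b: "b \<in> B"
    have "coroot_norm b * b ?t = kappa ?t (coroot b)" using kappa_coroot[OF base_roots[OF b] tT] by simp
    also have "\<dots> = 0" using dual[OF coroot_T[OF base_roots[OF b]]] zero[OF base_roots[OF b]] by (simp add: kappa_sym)
    finally show "b ?t = 0" using coroot_norm_nonzero[OF base_roots[OF b]] by simp
  qed
  then have "int_comb B x h = 0" if "h \<in> T" for h using dual[OF that] kappa_scale_right[of h 0 0] by simp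
  moreover have "int_comb B x h = 0" if "h \<notin> T" for h
    unfolding int_comb_apply by (intro sum.neutral ballI) (simp add: W_outside[OF root_W[OF base_roots] that])
  ultimately have "int_comb B x h = int_comb B 0 h" for h by (cases "h \<in> T") (simp_all add: int_comb_zero)
  then have "int_comb B x = int_comb B 0" by (rule ext)
  then show ?thesis using coord_int_comb[of x] coord_int_comb[of 0] out by simp
qed

text \<open>
  If the simple roots split into two parts so that every root is supported in one of them, the
  root spaces supported in \<open>S\<close>, together with the commutators of opposite ones, span an ideal that
  the remaining root spaces centralize.
\<close>
lemma roots_irreducible:
  assumes S: "S \<subseteq> B" "S \<noteq> {}"
    and split: "\<And>\<gamma>. \<gamma> \<in> roots T \<Longrightarrow> (\<forall>b\<in>S. coord \<gamma> b = 0) \<or> (\<forall>b\<in>B - S. coord \<gamma> b = 0)"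
  shows "S = B"
proof (rule ccontr)
  assume "S \<noteq> B"
  then obtain c where c: "c \<in> B" "c \<notin> S" using S by auto
  obtain b where b: "b \<in> S" "b \<in> B" using S by auto
  let ?R = "{\<gamma> \<in> roots T. \<forall>b\<in>B - S. coord \<gamma> b = 0}"
  let ?X = "\<Union>\<gamma>\<in>?R. gws \<gamma>" and ?Y = "{bracket x y | x y. \<exists>\<gamma>\<in>?R. x \<in> gws \<gamma> \<and> y \<in> gws (- \<gamma>)}"
  let ?I = "span (?X \<union> ?Y)"
  have in_R: "\<exists>b\<in>S. coord \<gamma> b \<noteq> 0" if "\<gamma> \<in> ?R" for \<gamma>
  proof (rule ccontr)
    assume "\<not> ?thesis"
    then have "coord \<gamma> b = 0" for b using that coord_outside[of b \<gamma>] by (cases "b \<in> S"; cases "b \<in> B") auto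
    then have "coord \<gamma> = 0" by auto
    then have "\<gamma> = 0" using that root_coord(1)[of \<gamma>] int_comb_zero[of B] by auto
    then show False using that root_nonzero by blast
  qed
  have neg_R: "- \<gamma> \<in> ?R" if "\<gamma> \<in> ?R" for \<gamma>
  proof -
    have "coord (- \<gamma>) = - coord \<gamma>"
      using coord_int_comb[of "- coord \<gamma>"] int_comb_diff[of B 0 "coord \<gamma>"] that root_coord(1)[of \<gamma>]
      by (simp add: int_comb_zero coord_outside)
    then show ?thesis using that neg_root by simp
  qed
  have centralize: "bracket z x = 0" if z: "z \<in> gws \<delta>" "\<delta> \<in> roots T" "\<delta> \<notin> ?R" and x: "x \<in> gws \<gamma>" "\<gamma> \<in> ?R" for z \<delta> x \<gamma>
  proof -
    obtain a where a: "a \<in> B - S" "coord \<delta> a \<noteq> 0" using z by auto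
    obtain b where b: "b \<in> S" "coord \<gamma> b \<noteq> 0" using in_R x(2) by blast
    have \<delta>S: "\<forall>b\<in>S. coord \<delta> b = 0" using split[OF z(2)] a by blast
    have \<gamma>S: "\<forall>b\<in>B - S. coord \<gamma> b = 0" and \<gamma>: "\<gamma> \<in> roots T" using x(2) by auto
    have sum: "coord (\<delta> + \<gamma>) = coord \<delta> + coord \<gamma>" by (rule coord_add[OF z(2) \<gamma>])
    have ca: "coord (\<delta> + \<gamma>) a \<noteq> 0" unfolding sum using a \<gamma>S by simp
    have cb: "coord (\<delta> + \<gamma>) b \<noteq> 0" unfolding sum using b \<delta>S by simp
    have "\<delta> + \<gamma> \<notin> roots T" using split[of "\<delta> + \<gamma>"] a b ca cb by blast
    moreover have "\<delta> + \<gamma> \<noteq> 0"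
    proof
      assume "\<delta> + \<gamma> = 0"
      then have "coord (\<delta> + \<gamma>) = 0" using coord_int_comb[of 0] by (simp add: int_comb_zero)
      then show False using ca by simp
    qed
    ultimately have "\<delta> + \<gamma> \<notin> W" using W_root by blast
    then show ?thesis using gws_bracket_not_weight z(1) x(1) root_W z(2) \<gamma> by blast
  qed
  have centralize_I: "bracket z u = 0" if z: "z \<in> gws \<delta>" "\<delta> \<in> roots T" "\<delta> \<notin> ?R" and u: "u \<in> ?I" for z \<delta> u
  proof -
    have "bracket z u \<in> {0}"
    proof (rule endo_span_subset[OF endo_bracket _ subspace_single_0 u])
      fix u assume "u \<in> ?X \<union> ?Y"
      then consider \<gamma> where "\<gamma> \<in> ?R" "u \<in> gws \<gamma>"
        | x y \<gamma> where "\<gamma> \<in> ?R" "u = bracket x y" "x \<in> gws \<gamma>" "y \<in> gws (- \<gamma>)" by blast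
      then show "bracket z u \<in> {0}"
      proof cases
        case 1
        then show ?thesis using centralize[OF z] by blast
      next
        case 2
        then have "bracket z x = 0" "bracket z y = 0" using centralize[OF z] neg_R by blast+
        then show ?thesis using 2 bracket_derivation[of z x y] by simp
      qed
    qed
    then show ?thesis by simp
  qed
  have stable: "bracket z u \<in> ?I" if z: "z \<in> gws \<delta>" "\<delta> \<in> W" and u: "u \<in> ?X \<union> ?Y" for z \<delta> u
  proof -
    from u consider \<gamma> where "\<gamma> \<in> ?R" "u \<in> gws \<gamma>"
      | x y \<gamma> where "\<gamma> \<in> ?R" "u = bracket x y" "x \<in> gws \<gamma>" "y \<in> gws (- \<gamma>)" by blast
    then show ?thesis
    proof cases
      case 1
      then have \<gamma>: "\<gamma> \<in> roots T" by auto
      consider "\<delta> = 0" | "\<delta> \<noteq> 0" "\<delta> \<in> ?R" | "\<delta> \<in> roots T" "\<delta> \<notin> ?R" using z(2) W_root by blast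
      then show ?thesis
      proof cases
        case a: 1
        then have "bracket z u \<in> gws \<gamma>" using gws_bracket_T 1 z gws_0 by blast
        then show ?thesis using 1 by (intro span_base) auto
      next
        case a: 2
        show ?thesis
        proof (cases "\<delta> + \<gamma> = 0")
          case True
          then have "\<gamma> = - \<delta>" by (simp add: eq_neg_iff_add_eq_0 add.commute)
          then show ?thesis using 1 z(1) a(2) by (intro span_base) blast
        next
          case False
          show ?thesis
          proof (cases "\<delta> + \<gamma> \<in> W")
            case True
            then have "\<delta> + \<gamma> \<in> roots T" using False W_root by blast
            moreover have "coord (\<delta> + \<gamma>) = coord \<delta> + coord \<gamma>" using coord_add \<gamma> a by blast
            ultimately have "\<delta> + \<gamma> \<in> ?R" using 1 a by auto
            then show ?thesis using gws_bracket[OF z(1) 1(2)] by (intro span_base) blast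
          next
            case False
            then show ?thesis using gws_bracket_not_weight[OF z(1) 1(2) z(2) root_W[OF \<gamma>]] span_zero by simp
          qed
        qed
      next
        case 3
        then show ?thesis using centralize_I[OF z(1) 3] span_base[OF u] span_zero by simp
      qed
    next
      case 2
      then have uT: "u \<in> T" using opposite_bracket_T by blast
      have "bracket z u = - (\<delta> u *s z)" using gws_eigen[OF z uT] bracket_anti[of z u] by simp
      consider "\<delta> = 0" | "\<delta> \<in> ?R" | "\<delta> \<in> roots T" "\<delta> \<notin> ?R" using z(2) W_root by blast
      then show ?thesis
      proof cases
        case 1
        then show ?thesis using \<open>bracket z u = _\<close> span_zero by simp
      next
        case 2
        then have "z \<in> ?I" using z(1) by (intro span_base) auto
        then show ?thesis unfolding \<open>bracket z u = _\<close> by (intro span_neg span_scale)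
      next
        case 3
        then show ?thesis using centralize_I[OF z(1) 3] span_base[OF u] span_zero by simp
      qed
    qed
  qed
  have "lie_ideal ?I"
    unfolding lie_ideal_def
  proof (intro conjI allI ballI)
    fix z u assume u: "u \<in> ?I"
    have "bracket (component \<delta> z) u \<in> ?I" if "\<delta> \<in> W" for \<delta>
      by (rule endo_span_subset[OF endo_bracket _ subspace_span u]) (rule stable[OF component_in that])
    then have "(\<Sum>\<delta>\<in>W. bracket (component \<delta> z) u) \<in> ?I" by (rule span_sum)
    then show "bracket z u \<in> ?I"
      using endo_sum[OF endo_bracket_left[of u], where g = "\<lambda>\<delta>. component \<delta> z" and A = W] by (simp add: component_sum)
  qed simp
  then have I: "?I = {0} \<or> ?I = UNIV" by (rule lie_ideal_trivial)
  have "\<forall>a\<in>B - S. coord b a = 0" using coord_base[OF b(2)] b by (auto simp: unit_coord_def)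
  then have bR: "b \<in> ?R" using base_roots b by auto
  obtain x where x: "x \<in> gws b" "x \<noteq> 0" using W_nonzero_vector root_W base_roots b by blast
  have "x \<in> ?I" using x bR by (intro span_base) auto
  with I x have I: "?I = UNIV" by auto
  obtain z where z: "z \<in> gws c" "z \<noteq> 0" using W_nonzero_vector root_W base_roots c by blast
  have "coord c c \<noteq> 0" using coord_base[OF c(1)] by (simp add: unit_coord_def)
  then have "c \<notin> ?R" using c by blast
  then have cent: "bracket z u = 0" for u using centralize_I[OF z(1) base_roots[OF c(1)]] I by blast
  obtain h where h: "h \<in> T" "c h \<noteq> 0" using weight_ne_zero root_W root_nonzero base_roots c by blast
  have "c h *s z = 0" using gws_eigen[OF z(1) root_W[OF base_roots[OF c(1)]] h(1)] cent[of h] bracket_anti[of h z] by simp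
  then show False using h z by simp
qed

lemma finite_roots: "finite (roots T)"
  using finite_W W_eq by simp

sublocale coordinate_root_system "coord ` roots T" B "\<lambda>b d. cartan_int b (int_comb B d)" pairing reflect unit_coord
proof
  show "pairing x d = (\<Sum>b\<in>B. x b * cartan_int b (int_comb B d))" for x d by (rule pairing_def)
  show "reflect d x = (\<lambda>b. x b - pairing x d * d b)" for d x by (rule reflect_def)
  show "unit_coord b = (\<lambda>c. if c = b then 1 else 0)" for b by (rule unit_coord_def)
  show "finite B" by (rule finite_B)
  show "finite (coord ` roots T)" using finite_roots by simp
  show "g b = 0" if "g \<in> coord ` roots T" "b \<notin> B" for g b using that coord_outside by auto
  show "unit_coord b \<in> coord ` roots T" if "b \<in> B" for b using coord_base[OF that] base_roots[OF that] by (metis imageI)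
  show "(\<forall>b\<in>B. 0 \<le> g b) \<or> (\<forall>b\<in>B. g b \<le> 0)" if "g \<in> coord ` roots T" for g using that root_coord(2) by auto
  show "pairing g g = 2" if g: "g \<in> coord ` roots T" for g
  proof -
    obtain \<gamma> where \<gamma>: "\<gamma> \<in> roots T" "g = coord \<gamma>" using g by auto
    have "(of_int (cartan_int \<gamma> \<gamma>) :: 'k) = of_int 2" using root_reflection[OF \<gamma>(1,1)] coroot_self[OF \<gamma>(1)] by simp
    then have "cartan_int \<gamma> \<gamma> = 2" by (simp only: of_int_eq_iff)
    then show ?thesis using pairing_cartan_int \<gamma> by simp
  qed
  show "reflect d g \<in> coord ` roots T" if gd: "g \<in> coord ` roots T" "d \<in> coord ` roots T" for g d
  proof -
    obtain \<gamma> \<delta> where r: "\<gamma> \<in> roots T" "g = coord \<gamma>" "\<delta> \<in> roots T" "d = coord \<delta>" using gd by auto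
    show ?thesis unfolding r(2,4) reflect_coord[OF r(1,3)] using root_reflection[OF r(3,1)] by blast
  qed
  show "pairing x (reflect d g) = pairing (reflect d x) g" if "g \<in> coord ` roots T" "d \<in> coord ` roots T" for x g d
  proof -
    obtain \<gamma> \<delta> where r: "\<gamma> \<in> roots T" "g = coord \<gamma>" "\<delta> \<in> roots T" "d = coord \<delta>" using \<open>g \<in> _\<close> \<open>d \<in> _\<close> by auto
    let ?s = "\<gamma> - fscale (of_int (cartan_int \<gamma> \<delta>)) \<delta>"
    have s: "?s \<in> roots T" using root_reflection[OF r(3,1)] by blast
    let ?x = "int_comb B x"
    have T: "coroot \<gamma> \<in> T" "coroot \<delta> \<in> T" using coroot_T r by auto
    have val: "b (coroot ?s) = b (coroot \<gamma>) - of_int (cartan_int \<delta> \<gamma>) * b (coroot \<delta>)" if "b \<in> B" for b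
    proof -
      note dual = root_dual[OF base_roots[OF that]]
      have "coroot ?s = coroot \<gamma> + (- of_int (cartan_int \<delta> \<gamma>)) *s coroot \<delta>" using coroot_reflection[OF r(3,1)] by simp
      moreover have "(- of_int (cartan_int \<delta> \<gamma>)) *s coroot \<delta> \<in> T" by (rule subspace_scale[OF subspace_T T(2)])
      ultimately show ?thesis
        using dual_add[OF dual T(1)] dual_scale[OF dual T(2)] by (metis diff_conv_add_uminus mult_minus_left)
    qed
    have "(of_int (pairing x (reflect d g)) :: 'k) = ?x (coroot ?s)"
      unfolding r reflect_coord[OF r(1,3)] by (rule pairing_coroot[OF s])
    also have "\<dots> = ?x (coroot \<gamma>) - of_int (cartan_int \<delta> \<gamma>) * ?x (coroot \<delta>)"
      unfolding int_comb_apply by (simp add: val sum_subtractf sum_distrib_left algebra_simps)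
    also have "\<dots> = int_comb B (reflect d x) (coroot \<gamma>)"
      unfolding reflect_def int_comb_diff_scale
      using pairing_coroot[OF r(3), of x] root_reflection[OF r(1,3)] r
      by (simp add: fscale_def root_coord(1))
    also have "\<dots> = of_int (pairing (reflect d x) g)" using pairing_coroot[OF r(1)] r by simp
    finally show ?thesis by (simp only: of_int_eq_iff)
  qed
  show "g - d \<in> coord ` roots T" if gd: "g \<in> coord ` roots T" "d \<in> coord ` roots T" "0 < pairing g d" "g \<noteq> d" for g d
  proof -
    obtain \<gamma> \<delta> where r: "\<gamma> \<in> roots T" "g = coord \<gamma>" "\<delta> \<in> roots T" "d = coord \<delta>" using gd by auto
    then have "\<gamma> - \<delta> \<in> roots T" using root_difference[of \<gamma> \<delta>] pairing_cartan_int gd by auto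
    then show ?thesis using coord_diff r by (metis imageI)
  qed
  show "g + g \<notin> coord ` roots T" if "g \<in> coord ` roots T" for g
    using that sum_in_roots_iff root_double by blast
  show "x = 0" if "\<And>b. b \<notin> B \<Longrightarrow> x b = 0" "\<And>d. d \<in> coord ` roots T \<Longrightarrow> pairing x d = 0" for x
    using coroots_separate[of x] that pairing_coroot[of _ x] by (metis imageI of_int_0)
  show "S = B" if "S \<subseteq> B" "S \<noteq> {}"
    "\<And>g. g \<in> coord ` roots T \<Longrightarrow> (\<forall>b\<in>S. g b = 0) \<or> (\<forall>b\<in>B - S. g b = 0)" for S
    using roots_irreducible[of S] that by blast
qed

lemma highest_root_coord:
  "highest_root T B \<in> roots T \<and> (\<forall>\<gamma>\<in>roots T. \<forall>b\<in>B. coord \<gamma> b \<le> coord (highest_root T B) b)"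
proof -
  obtain \<theta> where \<theta>: "\<theta> \<in> roots T" "\<And>\<gamma> b. \<gamma> \<in> roots T \<Longrightarrow> b \<in> B \<Longrightarrow> coord \<gamma> b \<le> coord \<theta> b"
    using highest_root_exists[OF base_nonempty] by auto
  have "highest_root T B = \<theta>"
    unfolding highest_root_def
  proof (rule the_equality)
    have "\<theta> - \<gamma> = int_comb B (coord \<theta> - coord \<gamma>)" if "\<gamma> \<in> roots T" for \<gamma>
      using \<theta>(1) that by (simp add: int_comb_diff root_coord)
    then show "\<theta> \<in> roots T \<and> (\<forall>\<gamma>\<in>roots T. \<exists>n. \<theta> - \<gamma> = int_comb B n \<and> (\<forall>\<beta>\<in>B. 0 \<le> n \<beta>))"
      using \<theta> by (intro conjI ballI exI[of _ "coord \<theta> - coord _"]) auto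
  next
    fix \<theta>' assume *: "\<theta>' \<in> roots T \<and> (\<forall>\<gamma>\<in>roots T. \<exists>n. \<theta>' - \<gamma> = int_comb B n \<and> (\<forall>\<beta>\<in>B. 0 \<le> n \<beta>))"
    then obtain n where n: "\<theta>' - \<theta> = int_comb B n" "\<forall>\<beta>\<in>B. 0 \<le> n \<beta>" using \<theta>(1) by blast
    have "coord (\<theta>' - \<theta>) b = n b" if "b \<in> B" for b
      unfolding n(1) using that by (simp add: coord_def ht_int_comb[OF finite_B independent_B])
    then have "coord \<theta> b \<le> coord \<theta>' b" if "b \<in> B" for b
      using coord_diff[of \<theta>' \<theta>] * \<theta>(1) n(2) that by force
    moreover have "coord \<theta>' b \<le> coord \<theta> b" if "b \<in> B" for b using \<theta>(2) * that by blast
    ultimately have "coord \<theta>' b = coord \<theta> b" for b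
      using coord_outside[of b] by (cases "b \<in> B") (auto intro: antisym)
    then have "coord \<theta>' = coord \<theta>" by auto
    then show "\<theta>' = \<theta>" using coord_inj * \<theta>(1) by (auto dest: inj_onD)
  qed
  with \<theta> show ?thesis by auto
qed

end

section \<open>Leading terms of an abelian subspace\<close>

text \<open>
  Read the coordinates as digits to a base \<open>K\<close> larger than all differences at the last position.
\<close>
lemma separating_weights_exist:
  fixes X :: "('b \<Rightarrow> int) set"
  assumes "finite B" and X: "finite X"
  shows "\<exists>w :: 'b \<Rightarrow> int. \<forall>x\<in>X. \<forall>y\<in>X. (\<Sum>b\<in>B. w b * x b) = (\<Sum>b\<in>B. w b * y b) \<longrightarrow> (\<forall>b\<in>B. x b = y b)"
  using assms(1)
proof (induction B rule: finite_induct)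
  case (insert c B)
  then obtain w :: "'b \<Rightarrow> int" where w: "\<And>x y. x \<in> X \<Longrightarrow> y \<in> X \<Longrightarrow>
    (\<Sum>b\<in>B. w b * x b) = (\<Sum>b\<in>B. w b * y b) \<Longrightarrow> \<forall>b\<in>B. x b = y b" by blast
  define K where "K = 1 + (\<Sum>x\<in>X. \<Sum>y\<in>X. \<bar>x c - y c\<bar>)"
  have K: "\<bar>x c - y c\<bar> < K" if "x \<in> X" "y \<in> X" for x y
  proof -
    have "\<bar>x c - y c\<bar> \<le> (\<Sum>y\<in>X. \<bar>x c - y c\<bar>)" using that X by (intro member_le_sum) auto
    also have "\<dots> \<le> (\<Sum>x\<in>X. \<Sum>y\<in>X. \<bar>x c - y c\<bar>)"
      using that X by (intro member_le_sum[of x X "\<lambda>x. \<Sum>y\<in>X. \<bar>x c - y c\<bar>"]) (auto intro: sum_nonneg)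
    finally show ?thesis by (simp add: K_def)
  qed
  let ?w = "\<lambda>b. if b = c then 1 else K * w b"
  have sum: "(\<Sum>b\<in>insert c B. ?w b * x b) = x c + K * (\<Sum>b\<in>B. w b * x b)" for x
  proof -
    have "(\<Sum>b\<in>B. ?w b * x b) = (\<Sum>b\<in>B. K * (w b * x b))" using insert.hyps by (intro sum.cong) auto
    then show ?thesis using insert.hyps by (simp add: sum_distrib_left)
  qed
  have "\<forall>b\<in>insert c B. x b = y b"
    if xy: "x \<in> X" "y \<in> X" and eq: "(\<Sum>b\<in>insert c B. ?w b * x b) = (\<Sum>b\<in>insert c B. ?w b * y b)" for x y
  proof -
    define u v where "u = (\<Sum>b\<in>B. w b * x b)" and "v = (\<Sum>b\<in>B. w b * y b)"
    have e: "x c - y c = K * (v - u)" using eq unfolding sum u_def v_def by (simp add: algebra_simps)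
    have "K > 0" using K[OF xy] by simp
    have "u = v"
    proof (rule ccontr)
      assume "u \<noteq> v"
      then have "\<bar>K\<bar> * 1 \<le> \<bar>K\<bar> * \<bar>v - u\<bar>" by (intro mult_left_mono) auto
      then show False using K[OF xy] \<open>K > 0\<close> unfolding e by (simp add: abs_mult)
    qed
    then have "x c = y c" using e by simp
    moreover have "\<forall>b\<in>B. x b = y b" using w[OF xy] \<open>u = v\<close> unfolding u_def v_def by blast
    ultimately show ?thesis by simp
  qed
  then show ?case
    by - (rule exI[of _ ?w], rule ballI, rule ballI, rule impI)
qed simp

locale cartan_marked = cartan_setup scale bracket Basis T B
  for scale :: "'k::{alg_closed_field, field_char_0} \<Rightarrow> 'g::ab_group_add \<Rightarrow> 'g" (infixr \<open>*s\<close> 75)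
    and bracket and Basis and T :: "'g set" and B :: "('g \<Rightarrow> 'k) set" +
  fixes \<alpha> :: "'g \<Rightarrow> 'k"
  assumes \<alpha>: "\<alpha> \<in> B"
begin

sublocale marked_root_system "coord ` roots T" B "\<lambda>b d. cartan_int b (int_comb B d)" pairing reflect unit_coord \<alpha>
  by unfold_locales (rule \<alpha>)

abbreviation R1 :: "('g \<Rightarrow> 'k) set"
  where "R1 \<equiv> roots_of_ht T B \<alpha> 1"

abbreviation g1 :: "'g set"
  where "g1 \<equiv> graded_piece T B \<alpha> 1"

lemma ht_coord: "ht B \<alpha> \<gamma> = coord \<gamma> \<alpha>"
  using \<alpha> by (simp add: coord_def)

lemma R1_iff: "\<gamma> \<in> R1 \<longleftrightarrow> \<gamma> \<in> roots T \<and> coord \<gamma> \<alpha> = 1"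
  by (auto simp: roots_of_ht_def ht_coord)

lemma layer_1: "layer 1 = coord ` R1"
  by (auto simp: layer_def R1_iff)

lemma R1_W: "\<gamma> \<in> R1 \<Longrightarrow> \<gamma> \<in> W"
  using root_W by (auto simp: R1_iff)

lemma finite_R1: "finite R1"
  using finite_roots by (simp add: roots_of_ht_def)

lemma coord_inj_R1: "inj_on coord R1"
  by (rule inj_on_subset[OF coord_inj]) (auto simp: R1_iff)

lemma g1_eq: "g1 = span (\<Union>\<gamma>\<in>R1. gws \<gamma>)"
  using gws_root_space[OF R1_W] by (simp add: graded_piece_def)

lemma gws_g1: "\<gamma> \<in> R1 \<Longrightarrow> x \<in> gws \<gamma> \<Longrightarrow> x \<in> g1"
  unfolding g1_eq by (rule span_base) auto

lemma g1_component:
  assumes x: "x \<in> g1" and \<delta>: "\<delta> \<notin> R1"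
  shows "component \<delta> x = 0"
proof -
  have "component \<delta> x \<in> {0}"
  proof (rule endo_span_subset[OF component_endo _ subspace_single_0 x[unfolded g1_eq]])
    fix x assume "x \<in> (\<Union>\<gamma>\<in>R1. gws \<gamma>)"
    then obtain \<gamma> where "\<gamma> \<in> R1" "x \<in> gws \<gamma>" by blast
    then show "component \<delta> x \<in> {0}" using component_of_member[OF _ R1_W] \<delta> by auto
  qed
  then show ?thesis by simp
qed

lemma g1_sum: "x \<in> g1 \<Longrightarrow> x = (\<Sum>\<gamma>\<in>R1. component \<gamma> x)"
  using component_sum[of x] sum.mono_neutral_right[OF finite_W, of R1 "\<lambda>\<gamma>. component \<gamma> x"] R1_W g1_component
  by force

lemma dim_g1: "card R1 \<le> dim g1"
proof -
  have "\<forall>\<gamma>\<in>R1. \<exists>x. x \<in> gws \<gamma> \<and> x \<noteq> 0" using W_nonzero_vector R1_W by blast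
  then obtain v where v: "\<And>\<gamma>. \<gamma> \<in> R1 \<Longrightarrow> v \<gamma> \<in> gws \<gamma>" "\<And>\<gamma>. \<gamma> \<in> R1 \<Longrightarrow> v \<gamma> \<noteq> 0" by metis
  have comp: "component \<delta> (v \<gamma>) = (if \<delta> = \<gamma> then v \<gamma> else 0)" if "\<gamma> \<in> R1" for \<gamma> \<delta>
    by (rule component_of_member[OF v(1)[OF that] R1_W[OF that]])
  have inj: "inj_on v R1"
  proof (rule inj_onI, rule ccontr)
    fix \<gamma> \<delta> assume r: "\<gamma> \<in> R1" "\<delta> \<in> R1" "v \<gamma> = v \<delta>" "\<gamma> \<noteq> \<delta>"
    then show False using comp[OF r(1), of \<gamma>] comp[OF r(2), of \<gamma>] v(2)[OF r(1)] by simp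
  qed
  have "independent (v ` R1)"
  proof (rule independent_if_scalars_zero)
    show "finite (v ` R1)" using finite_R1 by simp
    fix f x assume sum: "(\<Sum>x\<in>v ` R1. f x *s x) = 0" and x: "x \<in> v ` R1"
    then obtain \<gamma> where \<gamma>: "\<gamma> \<in> R1" "x = v \<gamma>" by blast
    have "0 = component \<gamma> (\<Sum>\<delta>\<in>R1. f (v \<delta>) *s v \<delta>)"
      using sum inj by (simp add: sum.reindex endo_zero[OF component_endo])
    also have "\<dots> = (\<Sum>\<delta>\<in>R1. if \<delta> = \<gamma> then f (v \<gamma>) *s v \<gamma> else 0)"
      unfolding endo_sum[OF component_endo] endo_scale[OF component_endo]
      by (intro sum.cong refl) (simp add: comp)
    also have "\<dots> = f (v \<gamma>) *s v \<gamma>" using \<gamma> finite_R1 by simp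
    finally show "f x = 0" using v(2)[OF \<gamma>(1)] \<gamma>(2) by simp
  qed
  then have "card (v ` R1) \<le> dim g1" using gws_g1 v(1) by (intro independent_card_le_dim) auto
  then show ?thesis using inj by (simp add: card_image)
qed

text \<open>
  An additive injective functional \<open>\<phi>\<close> orders the roots of height one. A vector of \<open>\<aa>\<close> is
  determined by its components at the leading roots of \<open>\<aa>\<close>, so there are at least \<open>dim \<aa>\<close> of
  these; and the leading terms of commuting vectors commute, since no other pair of terms
  contributes to the sum of the two leading roots.
\<close>
lemma leading_roots:
  assumes sub: "subspace \<aa>" and a: "\<aa> \<subseteq> g1" and ab: "abelian \<aa>"
  shows "\<exists>A\<subseteq>R1. dim \<aa> \<le> card A \<and> (\<forall>\<gamma>\<in>A. \<forall>\<delta>\<in>A. \<gamma> \<noteq> \<delta> \<longrightarrow> \<gamma> + \<delta> \<notin> roots T)"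
proof -
  obtain w :: "('g \<Rightarrow> 'k) \<Rightarrow> int" where w: "\<And>x y. x \<in> coord ` R1 \<Longrightarrow> y \<in> coord ` R1 \<Longrightarrow>
    (\<Sum>b\<in>B. w b * x b) = (\<Sum>b\<in>B. w b * y b) \<Longrightarrow> \<forall>b\<in>B. x b = y b"
    using separating_weights_exist[OF finite_B, of "coord ` R1"] finite_R1 by blast
  define \<phi> where "\<phi> \<gamma> = (\<Sum>b\<in>B. w b * coord \<gamma> b)" for \<gamma>
  have \<phi>_inj: "\<gamma> = \<delta>" if "\<gamma> \<in> R1" "\<delta> \<in> R1" "\<phi> \<gamma> = \<phi> \<delta>" for \<gamma> \<delta>
  proof -
    have "\<forall>b\<in>B. coord \<gamma> b = coord \<delta> b" using w[of "coord \<gamma>" "coord \<delta>"] that by (simp add: \<phi>_def)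
    then have "coord \<gamma> b = coord \<delta> b" for b using coord_outside[of b] by (cases "b \<in> B") auto
    then have "coord \<gamma> = coord \<delta>" by auto
    then show ?thesis using coord_inj_R1 that by (auto dest: inj_onD)
  qed
  have \<phi>_add: "\<phi> \<gamma> + \<phi> \<delta> = \<phi> (\<gamma> + \<delta>)" if "\<gamma> \<in> R1" "\<delta> \<in> R1" for \<gamma> \<delta>
  proof -
    have "coord (\<gamma> + \<delta>) = coord \<gamma> + coord \<delta>" using coord_add that by (simp add: R1_iff)
    then show ?thesis by (simp add: \<phi>_def distrib_left sum.distrib)
  qed
  let ?lead = "\<lambda>\<gamma> x. component \<gamma> x \<noteq> 0 \<and> (\<forall>\<delta>\<in>R1. \<phi> \<gamma> < \<phi> \<delta> \<longrightarrow> component \<delta> x = 0)"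
  let ?A = "{\<gamma> \<in> R1. \<exists>x\<in>\<aa>. ?lead \<gamma> x}"
  have finA: "finite ?A" using finite_R1 by simp
  let ?\<pi> = "\<lambda>x. \<Sum>\<gamma>\<in>?A. component \<gamma> x"
  have \<pi>: "endo ?\<pi>"
    by (rule endoI) (simp_all add: endo_add[OF component_endo] endo_scale[OF component_endo] sum.distrib scale_sum_right)
  have kernel: "x = 0" if x: "x \<in> \<aa>" "?\<pi> x = 0" for x
  proof (rule ccontr)
    assume "x \<noteq> 0"
    let ?S = "{\<gamma> \<in> R1. component \<gamma> x \<noteq> 0}"
    have "?S \<noteq> {}"
    proof
      assume "?S = {}"
      then have "(\<Sum>\<gamma>\<in>R1. component \<gamma> x) = 0" by (intro sum.neutral) auto
      then show False using g1_sum[of x] a x(1) \<open>x \<noteq> 0\<close> by auto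
    qed
    then have "Max (\<phi> ` ?S) \<in> \<phi> ` ?S" using finite_R1 by (intro Max_in) auto
    then obtain \<gamma> where \<gamma>: "\<gamma> \<in> ?S" "\<phi> \<gamma> = Max (\<phi> ` ?S)" by auto
    have "component \<delta> x = 0" if "\<delta> \<in> R1" "\<phi> \<gamma> < \<phi> \<delta>" for \<delta>
    proof (rule ccontr)
      assume "component \<delta> x \<noteq> 0"
      then have "\<phi> \<delta> \<le> Max (\<phi> ` ?S)" using that finite_R1 by (intro Max_ge) auto
      then show False using that \<gamma> by simp
    qed
    then have \<gamma>A: "\<gamma> \<in> ?A" using \<gamma>(1) x(1) by blast
    have "0 = component \<gamma> (?\<pi> x)" using x(2) by (simp add: endo_zero[OF component_endo])
    also have "\<dots> = (\<Sum>\<delta>\<in>?A. if \<delta> = \<gamma> then component \<gamma> x else 0)"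
      unfolding endo_sum[OF component_endo]
      by (intro sum.cong refl) (use component_of_member[OF component_in R1_W] in auto)
    also have "\<dots> = component \<gamma> x" using \<gamma>A finA by simp
    finally show False using \<gamma>(1) by simp
  qed
  have "dim \<aa> \<le> card ?A"
  proof -
    obtain C where C: "C \<subseteq> \<aa>" "independent C" "\<aa> \<subseteq> span C" "card C = dim \<aa>" using basis_exists by blast
    have spC: "span C = \<aa>" using C sub by (simp add: span_subspace)
    interpret \<pi>: Vector_Spaces.linear scale scale ?\<pi> by (rule \<pi>)
    have inj: "inj_on ?\<pi> (span C)"
    proof (rule inj_onI)
      fix x y assume xy: "x \<in> span C" "y \<in> span C" "?\<pi> x = ?\<pi> y"
      have "?\<pi> (x - y) = 0" using xy(3) endo_diff[OF \<pi>, of x y] by simp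
      moreover have "x - y \<in> \<aa>" using xy(1,2) unfolding spC by (rule subspace_diff[OF sub])
      ultimately have "x - y = 0" by (rule kernel[rotated])
      then show "x = y" by simp
    qed
    have ind: "independent (?\<pi> ` C)" by (rule \<pi>.independent_injective_image[OF C(2) inj])
    have "\<forall>\<gamma>\<in>R1. \<exists>x. x \<in> gws \<gamma> \<and> x \<noteq> 0" using W_nonzero_vector R1_W by blast
    then obtain v where v: "\<And>\<gamma>. \<gamma> \<in> R1 \<Longrightarrow> v \<gamma> \<in> gws \<gamma>" "\<And>\<gamma>. \<gamma> \<in> R1 \<Longrightarrow> v \<gamma> \<noteq> 0" by metis
    have "?\<pi> x \<in> span (v ` ?A)" for x
    proof (rule span_sum)
      fix \<gamma> assume \<gamma>: "\<gamma> \<in> ?A"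
      then have R: "\<gamma> \<in> R1" by blast
      have "\<exists>c. component \<gamma> x = c *s v \<gamma>"
        by (rule root_space_line[OF _ v(1)[OF R] v(2)[OF R] component_in]) (use R R1_iff in blast)
      then obtain c where "component \<gamma> x = c *s v \<gamma>" ..
      moreover have "v \<gamma> \<in> span (v ` ?A)" using \<gamma> by (intro span_base imageI)
      ultimately show "component \<gamma> x \<in> span (v ` ?A)" by (simp add: span_scale)
    qed
    then have "?\<pi> ` C \<subseteq> span (v ` ?A)" by auto
    then have "card (?\<pi> ` C) \<le> dim (span (v ` ?A))" using ind by (rule independent_card_le_dim)
    also have "\<dots> \<le> card (v ` ?A)" using finA by (intro dim_le_card) auto
    also have "\<dots> \<le> card ?A" using finA by (rule card_image_le)
    also have "card (?\<pi> ` C) = card C" by (rule card_image[OF inj_on_subset[OF inj span_superset]])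
    finally show ?thesis unfolding C(4) .
  qed
  moreover have "\<gamma> + \<delta> \<notin> roots T" if \<gamma>\<delta>: "\<gamma> \<in> ?A" "\<delta> \<in> ?A" "\<gamma> \<noteq> \<delta>" for \<gamma> \<delta>
  proof
    assume sum: "\<gamma> + \<delta> \<in> roots T"
    obtain x where x: "x \<in> \<aa>" "?lead \<gamma> x" using \<gamma>\<delta> by blast
    obtain y where y: "y \<in> \<aa>" "?lead \<delta> y" using \<gamma>\<delta> by blast
    have R: "\<gamma> \<in> R1" "\<delta> \<in> R1" using \<gamma>\<delta> by auto
    let ?b = "\<lambda>\<epsilon> \<zeta>. bracket (component \<epsilon> x) (component \<zeta> y)"
    let ?c = "component (\<gamma> + \<delta>)"
    have contribution: "?c (?b \<epsilon> \<zeta>) = (if \<epsilon> = \<gamma> then if \<zeta> = \<delta> then ?b \<gamma> \<delta> else 0 else 0)"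
      if \<epsilon>\<zeta>: "\<epsilon> \<in> R1" "\<zeta> \<in> R1" for \<epsilon> \<zeta>
    proof (cases "\<epsilon> + \<zeta> \<in> W")
      case W: True
      have mem: "?b \<epsilon> \<zeta> \<in> gws (\<epsilon> + \<zeta>)" by (rule gws_bracket[OF component_in component_in])
      show ?thesis
      proof (cases "\<epsilon> + \<zeta> = \<gamma> + \<delta>")
        case True
        then have eq: "\<phi> \<epsilon> + \<phi> \<zeta> = \<phi> \<gamma> + \<phi> \<delta>" using \<phi>_add \<epsilon>\<zeta> R by metis
        show ?thesis
        proof (cases "\<phi> \<gamma> < \<phi> \<epsilon> \<or> \<phi> \<delta> < \<phi> \<zeta>")
          case True
          then have "?b \<epsilon> \<zeta> = 0" using x(2) y(2) \<epsilon>\<zeta> by auto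
          moreover have "\<not> (\<epsilon> = \<gamma> \<and> \<zeta> = \<delta>)" using True by auto
          ultimately show ?thesis by (auto simp: endo_zero[OF component_endo])
        next
          case False
          then have "\<phi> \<epsilon> = \<phi> \<gamma>" "\<phi> \<zeta> = \<phi> \<delta>" using eq by auto
          then have "\<epsilon> = \<gamma>" "\<zeta> = \<delta>" using \<phi>_inj \<epsilon>\<zeta> R by auto
          then show ?thesis using component_of_member[OF mem W] by simp
        qed
      next
        case False
        then show ?thesis using component_of_member[OF mem W] by auto
      qed
    next
      case False
      then have "?b \<epsilon> \<zeta> = 0"
        using gws_bracket_not_weight[OF component_in component_in R1_W[OF \<epsilon>\<zeta>(1)] R1_W[OF \<epsilon>\<zeta>(2)]] by blast
      moreover have "\<not> (\<epsilon> = \<gamma> \<and> \<zeta> = \<delta>)" using False root_W[OF sum] by auto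
      ultimately show ?thesis by (auto simp: endo_zero[OF component_endo])
    qed
    have "bracket x y = bracket (\<Sum>\<epsilon>\<in>R1. component \<epsilon> x) (\<Sum>\<zeta>\<in>R1. component \<zeta> y)"
      using g1_sum[OF subsetD[OF a x(1)]] g1_sum[OF subsetD[OF a y(1)]] by simp
    also have "\<dots> = (\<Sum>\<epsilon>\<in>R1. \<Sum>\<zeta>\<in>R1. ?b \<epsilon> \<zeta>)"
      unfolding endo_sum[OF endo_bracket_left] unfolding endo_sum[OF endo_bracket] ..
    finally have "?c (bracket x y) = (\<Sum>\<epsilon>\<in>R1. \<Sum>\<zeta>\<in>R1. ?c (?b \<epsilon> \<zeta>))"
      by (simp add: endo_sum[OF component_endo])
    also have "\<dots> = (\<Sum>\<epsilon>\<in>R1. \<Sum>\<zeta>\<in>R1. if \<epsilon> = \<gamma> then if \<zeta> = \<delta> then ?b \<gamma> \<delta> else 0 else 0)"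
      by (intro sum.cong refl contribution)
    also have "\<dots> = (\<Sum>\<epsilon>\<in>R1. if \<epsilon> = \<gamma> then ?b \<gamma> \<delta> else 0)"
      using R finite_R1 by (intro sum.cong refl) auto
    also have "\<dots> = ?b \<gamma> \<delta>" using R finite_R1 by simp
    finally have "?c (bracket x y) = ?b \<gamma> \<delta>" .
    moreover have "bracket x y = 0" using ab x(1) y(1) by (simp add: abelian_def)
    ultimately have "?b \<gamma> \<delta> = 0" by (simp add: endo_zero[OF component_endo])
    moreover have "?b \<gamma> \<delta> \<noteq> 0"
      using R x(2) y(2) by (intro root_bracket_nonzero[OF _ _ sum] component_in) (auto simp: R1_iff)
    ultimately show False by simp
  qed
  ultimately show ?thesis by (intro exI[of _ ?A]) blast
qed

lemma abelian_subspace_bound: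
  assumes "subspace \<aa>" "\<aa> \<subseteq> g1" "abelian \<aa>" and ne: "layer 2 \<noteq> {}"
  shows "2 * dim \<aa> \<le> dim g1"
proof -
  obtain A where A: "A \<subseteq> R1" "dim \<aa> \<le> card A"
    "\<And>\<gamma> \<delta>. \<gamma> \<in> A \<Longrightarrow> \<delta> \<in> A \<Longrightarrow> \<gamma> \<noteq> \<delta> \<Longrightarrow> \<gamma> + \<delta> \<notin> roots T"
    using leading_roots[OF assms(1-3)] by blast
  have "2 * card (coord ` A) \<le> card (layer 1)"
  proof (rule independent_set_le_half[OF _ _ ne])
    show "coord ` A \<subseteq> layer 1" using A(1) layer_1 by auto
    fix g h assume "g \<in> coord ` A" "h \<in> coord ` A" "g \<noteq> h"
    then obtain \<gamma> \<delta> where "\<gamma> \<in> A" "\<delta> \<in> A" "\<gamma> \<noteq> \<delta>" "g = coord \<gamma>" "h = coord \<delta>" by blast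
    then show "g + h \<notin> coord ` roots T" using A sum_in_roots_iff[of \<gamma> \<delta>] by (auto simp: R1_iff subset_iff)
  qed
  moreover have "card (coord ` A) = card A" using coord_inj_R1 A(1) by (metis card_image inj_on_subset)
  moreover have "card (layer 1) = card R1" unfolding layer_1 using coord_inj_R1 by (rule card_image)
  ultimately show ?thesis using A(2) dim_g1 by linarith
qed

lemma grading_depth_coord: "grading_depth T B \<alpha> = coord (highest_root T B) \<alpha>"
  by (simp add: grading_depth_def ht_coord)

lemma grading_depth_pos: "1 \<le> grading_depth T B \<alpha>"
  using highest_root_coord base_roots[OF \<alpha>] \<alpha> coord_base[OF \<alpha>] unfolding grading_depth_coord
  by (metis unit_coord_def)

lemma layer2_if_deep: "grading_depth T B \<alpha> \<noteq> 1 \<Longrightarrow> layer 2 \<noteq> {}"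
  using layer2_nonempty[of "coord (highest_root T B)"] grading_depth_pos highest_root_coord
  unfolding grading_depth_coord by auto

lemma abelian_g1_if_depth_1:
  assumes "grading_depth T B \<alpha> = 1"
  shows "abelian g1"
proof -
  have zero: "bracket x y = 0" if "\<gamma> \<in> R1" "x \<in> gws \<gamma>" "\<delta> \<in> R1" "y \<in> gws \<delta>" for \<gamma> \<delta> x y
  proof -
    have r: "\<gamma> \<in> roots T" "\<delta> \<in> roots T" using that by (auto simp: R1_iff)
    have "coord (\<gamma> + \<delta>) \<alpha> = 2" using coord_add[OF r] that by (simp add: R1_iff)
    moreover have "coord 0 = 0" using coord_int_comb[of 0] by (simp add: int_comb_zero)
    ultimately have "\<gamma> + \<delta> \<notin> W"
      using assms highest_root_coord \<alpha> W_eq unfolding grading_depth_coord by force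
    then show ?thesis using gws_bracket_not_weight that R1_W by blast
  qed
  have "bracket x y = 0" if x: "x \<in> g1" and y: "y \<in> g1" for x y
  proof -
    have "bracket x y = bracket (\<Sum>\<gamma>\<in>R1. component \<gamma> x) (\<Sum>\<delta>\<in>R1. component \<delta> y)"
      using g1_sum[OF x] g1_sum[OF y] by simp
    also have "\<dots> = (\<Sum>\<gamma>\<in>R1. \<Sum>\<delta>\<in>R1. bracket (component \<gamma> x) (component \<delta> y))"
      unfolding endo_sum[OF endo_bracket_left] unfolding endo_sum[OF endo_bracket] ..
    also have "\<dots> = 0" by (intro sum.neutral ballI zero[OF _ component_in _ component_in])
    finally show ?thesis .
  qed
  then show ?thesis by (simp add: abelian_def)
qed

lemma not_abelian_g1:
  assumes "layer 2 \<noteq> {}"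
  shows "\<not> abelian g1"
proof
  assume ab: "abelian g1"
  obtain mu where mu: "mu \<in> layer 2" using assms by blast
  obtain g h where gh: "g \<in> layer 1" "h \<in> layer 1" "g + h = mu" using layer2_splits[OF mu] by blast
  obtain \<gamma> \<delta> where r: "\<gamma> \<in> R1" "\<delta> \<in> R1" "g = coord \<gamma>" "h = coord \<delta>" using gh layer_1 by auto
  have roots: "\<gamma> \<in> roots T" "\<delta> \<in> roots T" using r by (auto simp: R1_iff)
  have sum: "\<gamma> + \<delta> \<in> roots T"
    using sum_in_roots_iff[OF roots] gh r layerD(1)[OF mu] by simp
  obtain x where x: "x \<in> gws \<gamma>" "x \<noteq> 0" using W_nonzero_vector root_W roots by blast
  obtain y where y: "y \<in> gws \<delta>" "y \<noteq> 0" using W_nonzero_vector root_W roots by blast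
  have "bracket x y = 0" using ab gws_g1[OF r(1) x(1)] gws_g1[OF r(2) y(1)] by (simp add: abelian_def)
  then show False using root_bracket_nonzero[OF roots sum x y] by simp
qed

end

section \<open>The bound on abelian subspaces\<close>

theorem theorem4p7:
  fixes scale :: "'k::{alg_closed_field, field_char_0} \<Rightarrow> 'g::ab_group_add \<Rightarrow> 'g"
    and bracket :: "'g \<Rightarrow> 'g \<Rightarrow> 'g"
    and T :: "'g set" and \<Pi> :: "('g \<Rightarrow> 'k) set" and \<alpha> :: "'g \<Rightarrow> 'k"
  assumes "simple_lie_algebra scale bracket"
    and "lie_algebra.cartan_subalgebra scale bracket T"
    and "lie_algebra.simple_roots scale bracket T \<Pi>"
    and "\<alpha> \<in> \<Pi>"
  shows "let g1 = lie_algebra.graded_piece scale bracket T \<Pi> \<alpha> 1 in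
    (lie_algebra.abelian bracket g1 \<longleftrightarrow> lie_algebra.grading_depth scale bracket T \<Pi> \<alpha> = 1) \<and>
    (lie_algebra.abelian bracket g1 \<or>
      (\<forall>\<aa>. module.subspace scale \<aa> \<and> \<aa> \<subseteq> g1 \<and> lie_algebra.abelian bracket \<aa> \<longrightarrow>
        real (vector_space.dim scale \<aa>) \<le> 1 / 2 * real (vector_space.dim scale g1)))"
proof -
  interpret simple_lie_algebra scale bracket by (rule assms(1))
  obtain S where S: "finite S" "span S = UNIV" using finite_dimensional by blast
  obtain Basis where Basis: "independent Basis" "UNIV \<subseteq> span Basis" using basis_exists[of UNIV] by blast
  have "finite Basis" using independent_span_bound[OF S(1) Basis(1)] S(2) by simp
  interpret finite_dimensional_vector_space scale Basis
    by unfold_locales (use Basis \<open>finite Basis\<close> in auto)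
  interpret cartan_marked scale bracket Basis T \<Pi> \<alpha>
    by unfold_locales (use assms in auto)
  have "abelian g1 \<longleftrightarrow> grading_depth T \<Pi> \<alpha> = 1"
    using abelian_g1_if_depth_1 not_abelian_g1 layer2_if_deep by blast
  moreover have "abelian g1 \<or> (\<forall>\<aa>. subspace \<aa> \<and> \<aa> \<subseteq> g1 \<and> abelian \<aa> \<longrightarrow> real (dim \<aa>) \<le> 1 / 2 * real (dim g1))"
  proof (cases "grading_depth T \<Pi> \<alpha> = 1")
    case False
    have "real (dim \<aa>) \<le> 1 / 2 * real (dim g1)" if "subspace \<aa>" "\<aa> \<subseteq> g1" "abelian \<aa>" for \<aa>
    proof -
      have "2 * dim \<aa> \<le> dim g1" using abelian_subspace_bound[OF that layer2_if_deep[OF False]] .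
      then have "real (2 * dim \<aa>) \<le> real (dim g1)" by (simp only: of_nat_le_iff)
      then show ?thesis by simp
    qed
    then show ?thesis by blast
  qed (use abelian_g1_if_depth_1 in blast)
  ultimately show ?thesis by (simp only: Let_def simp_thms)
qed

end
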